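(* Let $X_1, X_2, \ldots$ be i.i.d. random variables with distribution function $F$ on $[0,\infty)$ having a decreasing density $f$, and for each $n$ let $\widehat{f}_n$ be the Grenander estimator based on $X_1,\ldots,X_n$. Let $t_0 \in (0,\infty)$ and suppose that $f(t_0) > 0$, $f'(t_0) < 0$, and $f'$ exists and is continuous in a neighborhood of $t_0$. Then, almost surely, $$\limsup_{n\rightarrow\infty} \frac{n^{1/3}\left(\widehat{f}_n(t_0) - f(t_0)\right)}{(2\log\log n)^{1/3}} = \left|\frac{1}{2} f(t_0) f'(t_0)\right|^{1/3} 2M,$$ where $$M \equiv \sup_{g \in \mathcal{G}} \operatorname{argmax}_{t \in \mathbb{R}} \{ g(t) - t^2 \} = \left(\frac{3}{4}\right)^{1/3}.$$
   Context: "Decreasing" means non-increasing on $[0,\infty)$. The empirical distribution function of $X_1,\ldots,X_n$ is $\mathbb{F}_n(t) = n^{-1}\#\{i \le n : X_i \le t\}$. The Grenander estimator $\widehat{f}_n$ (the maximum likelihood estimator of a decreasing density on $[0,\infty)$) is the left derivative of the least concave majorant of $\mathbb{F}_n$ on $[0,\infty)$, i.e. of the smallest concave function on $[0,\infty)$ that is $\ge \mathbb{F}_n$. The two-sided Strassen limit set on $\mathbb{R}$ is $$\mathcal{G} = \left\{ g : \mathbb{R} \to \mathbb{R} \;\middle|\; g(t) = \int_0^t \dot{g}(s)\,ds \text{ for all } t \in \mathbb{R}, \ \int_{-\infty}^{\infty} \dot{g}(s)^2\,ds \le 1 \right\},$$ where $\dot{g}$ is a measurable function and, for $t<0$, $\int_0^t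 = -\int_t^0$. In the definition of $M$, the supremum is taken over all $g \in \mathcal{G}$ and all maximizers $t$ of $t \mapsto g(t) - t^2$ over $\mathbb{R}$. *)

theory Defs
  imports "HOL-Probability.Probability"
begin

text \<open>A sample is a sequence \<open>x 0, x 1, \<dots>\<close>; its first \<open>n\<close> members are those with index below \<open>n\<close>.\<close>

definition emp_cdf :: "(nat \<Rightarrow> real) \<Rightarrow> nat \<Rightarrow> real \<Rightarrow> real" where
  "emp_cdf x n t = real (card {i. i < n \<and> x i \<le> t}) / real n"

definition concave_majorants :: "(real \<Rightarrow> real) \<Rightarrow> (real \<Rightarrow> real) set" where
  "concave_majorants h = {\<phi>. concave_on {0..} \<phi> \<and> (\<forall>t\<ge>0. h t \<le> \<phi> t)}"

text \<open>Only the values on \<open>[0, \<infinity>)\<close> are meaningful. The two lemmas below show that, as soon as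
  some concave majorant exists, the pointwise infimum is itself the smallest one.\<close>

definition least_concave_majorant :: "(real \<Rightarrow> real) \<Rightarrow> real \<Rightarrow> real" where
  "least_concave_majorant h t = (INF \<phi>\<in>concave_majorants h. \<phi> t)"

lemma least_concave_majorant_le:
  assumes "\<phi> \<in> concave_majorants h" "t \<ge> 0"
  shows "least_concave_majorant h t \<le> \<phi> t"
  unfolding least_concave_majorant_def
proof (rule cINF_lower[OF _ assms(1)])
  show "bdd_below ((\<lambda>\<phi>. \<phi> t) ` concave_majorants h)"
    using assms(2) by (intro bdd_belowI[where m = "h t"]) (auto simp: concave_majorants_def)
qed

lemma least_concave_majorant_in:
  assumes "concave_majorants h \<noteq> {}"
  shows "least_concave_majorant h \<in> concave_majorants h"
proof -
  have maj: "h t \<le> least_concave_majorant h t" if "t \<ge> 0" for t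
    unfolding least_concave_majorant_def
    by (rule cINF_greatest[OF assms]) (use that in \<open>auto simp: concave_majorants_def\<close>)
  have conc: "u * least_concave_majorant h a + v * least_concave_majorant h b
      \<le> least_concave_majorant h (u * a + v * b)"
    if uv: "u \<ge> 0" "v \<ge> 0" "u + v = 1" and ab: "a \<ge> 0" "b \<ge> 0" for u v a b :: real
    unfolding least_concave_majorant_def[of h "u * a + v * b"]
  proof (rule cINF_greatest[OF assms])
    fix \<phi> assume \<phi>: "\<phi> \<in> concave_majorants h"
    have "u * least_concave_majorant h a + v * least_concave_majorant h b \<le> u * \<phi> a + v * \<phi> b"
      using uv ab \<phi> by (intro add_mono mult_left_mono least_concave_majorant_le) auto
    also have "\<dots> \<le> \<phi> (u * a + v * b)"
      using \<phi> uv ab by (auto simp: concave_majorants_def concave_on_iff)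
    finally show "u * least_concave_majorant h a + v * least_concave_majorant h b
      \<le> \<phi> (u * a + v * b)" .
  qed
  have "concave_on {0..} (least_concave_majorant h)"
    unfolding concave_on_iff using conc by auto
  with maj show ?thesis by (simp add: concave_majorants_def)
qed

definition left_deriv :: "(real \<Rightarrow> real) \<Rightarrow> real \<Rightarrow> real" where
  "left_deriv \<phi> t = (THE D. (\<phi> has_real_derivative D) (at_left t))"

definition grenander :: "(nat \<Rightarrow> real) \<Rightarrow> nat \<Rightarrow> real \<Rightarrow> real" where
  "grenander x n t = left_deriv (least_concave_majorant (emp_cdf x n)) t"

text \<open>The interval integral is oriented, so it equals minus the integral over \<open>[t, 0]\<close> when
  \<open>t < 0\<close>. The bound on the square makes the derivative locally integrable. Allowing
  Lebesgue instead of Borel measurable derivatives would give the same set of functions.\<close>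

definition strassen_set :: "(real \<Rightarrow> real) set" where
  "strassen_set = {g. \<exists>g'\<in>borel_measurable borel.
     (\<forall>t. g t = (LBINT s=ereal 0..ereal t. g' s)) \<and>
     (\<integral>\<^sup>+s. ennreal ((g' s)\<^sup>2) \<partial>lborel) \<le> 1}"

text \<open>The supremum is taken in the extended reals, so a real value of it entails that the
  set of maximizers is nonempty and bounded above.\<close>

definition sup_argmax :: ereal where
  "sup_argmax = Sup {ereal t | g t. g \<in> strassen_set \<and>
     is_arg_max (\<lambda>s. g s - s\<^sup>2) (\<lambda>_. True) t}"

end

theory Submission
  imports Defs "HOL-Real_Asymp.Real_Asymp"
begin

text \<open>Write \<open>D = - deriv f t0\<close>, \<open>f0 = f t0\<close> and \<open>x\<^sub>n = (2 ln ln n / n) powr (1/3)\<close>. By concavity, and up to ties, the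
  estimator at \<open>t0\<close> exceeds \<open>a\<close> exactly when some \<open>t \<ge> t0\<close> satisfies
  \<open>F\<^sub>n t - a * t > F\<^sub>n s - a * s\<close> for all \<open>s < t0\<close>. For \<open>a = f0 + c * x\<^sub>n\<close> only \<open>s\<close> and \<open>t\<close> within a
  multiple of \<open>x\<^sub>n\<close> of \<open>t0\<close> matter: a chaining bound and peeling dispose of the rest.

  For the upper bound, average the inequality over \<open>s\<close> with the optimal weights. This gives a sum of
  i.i.d. bounded variables whose Bernstein bound over a geometric block is
  \<open>(ln N) powr - (c ^ 3 / (3 * f0 * D))\<close> up to a factor arbitrarily close to one in the exponent, so
  Borel--Cantelli applies as soon as \<open>c ^ 3 > 3 * f0 * D\<close>.

  For the lower bound, tilt the density near \<open>t0\<close> so that the event has probability close to one. The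
  relative entropy of the tilted sample is \<open>(c ^ 3 / (3 * f0 * D)) * ln ln N\<close>; since the blocks of
  new observations are independent, the second Borel--Cantelli lemma applies when
  \<open>c ^ 3 < 3 * f0 * D\<close>. Hence the limit superior is \<open>(3 * f0 * D) powr (1/3)\<close>.\<close>


section \<open>Maximal inequalities and chaining\<close>

text \<open>The two halves meet because they solve the same quadratic problem. The level
  \<open>f0 + D * \<sigma>\<close> is, to first order, the density at \<open>t0 - \<sigma>\<close>;
  the cheapest way for the estimator to reach it is that the density is raised to this level between
  \<open>t0 - \<sigma>\<close> and \<open>t0\<close>, that is by
  \<open>D * (u - t0 + \<sigma>)\<close>. With \<open>n\<close> observations this costs half of the
  chi-square \<open>n * D^2 * \<sigma>^3 / (3 * f0)\<close>, and
  \<open>\<sigma> = c * rate n / D\<close> turns it into the exponent of the overview. A witness to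
  the right of \<open>t0\<close> only adds to the cost. No Gaussian approximation is involved: the
  upper half puts the dual test function of this problem into an exponential inequality, the lower
  half uses the primal optimum as a tilt. The obstacle is uniformity, over all \<open>n\<close> in a
  block and over points far from \<open>t0\<close>: there the quadratic loss or gain
  \<open>D * h^2\<close> of the distribution function at distance \<open>h\<close> has to dominate
  the fluctuations, and this dictates most of the auxiliary constants. The constant of the Strassen
  ball is computed separately by a similar mean-square comparison; it meets the probabilistic
  constant only in the final arithmetic.\<close>

context real_distribution
begin

section \<open>Exponential inequalities for maxima of partial sums\<close>

abbreviation sample :: "nat set \<Rightarrow> (nat \<Rightarrow> real) measure" where
  "sample I \<equiv> Pi\<^sub>M I (\<lambda>_. M)"

lemma product_prob_space_sample: "product_prob_space (\<lambda>_::nat. M)"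
  by unfold_locales

lemma prob_space_sample: "prob_space (sample I)"
  by (intro prob_space_PiM prob_space_axioms)

lemma prob_UNIV: "measure M UNIV = 1"
  using prob_space by simp

lemma sets_sample: "sets (sample I) = sets (Pi\<^sub>M I (\<lambda>_. borel))"
  by (intro sets_PiM_cong) auto

lemma measurable_sample_coord [measurable]:
  "i \<in> I \<Longrightarrow> (\<lambda>x. x i) \<in> borel_measurable (sample I)"
  using measurable_component_singleton[of i I "\<lambda>_. M"] by (simp cong: measurable_cong_sets)

text \<open>This is the optional stopping bound for an exponential martingale, proved by adding one
  coordinate in front. Fix its value \<open>v\<close>: either \<open>y <= g v\<close>, and
  \<open>exp (g v - y)\<close> is already at least 1, or the remaining sums have to reach
  \<open>y - g v\<close> and the induction hypothesis applies, which is why \<open>y\<close> is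
  generalised. Integrating \<open>exp (g v)\<close> yields one factor \<open>\<psi>\<close>;
  \<open>1 <= \<psi>\<close> lets the bound survive an early passage.\<close>

lemma maximal_exp_aux:
  assumes g[measurable]: "g \<in> borel_measurable borel"
    and \<psi>: "(\<integral>\<^sup>+x. ennreal (exp (g x)) \<partial>M) \<le> ennreal \<psi>" "1 \<le> \<psi>"
  shows "k \<le> N \<Longrightarrow> emeasure (sample {k..<N})
      {x\<in>space (sample {k..<N}). \<exists>n\<in>{k<..N}. y \<le> (\<Sum>i\<in>{k..<n}. g (x i))}
      \<le> ennreal (exp (- y) * \<psi> ^ (N - k))"
proof (induction k arbitrary: y rule: inc_induct)
  case base
  then show ?case by simp
next
  case (step k)
  interpret P: product_prob_space "\<lambda>_::nat. M" by (rule product_prob_space_sample)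
  have ins: "{k..<N} = insert k {Suc k..<N}" using step by auto
  let ?E = "{x\<in>space (sample {k..<N}). \<exists>n\<in>{k<..N}. y \<le> (\<Sum>i\<in>{k..<n}. g (x i))}"
  have coord: "(\<lambda>x. g (x i)) \<in> borel_measurable (sample I)" if "i \<in> I" for i I
    using that by measurable
  have [measurable]: "?E \<in> sets (sample {k..<N})"
    by (auto intro!: sets.sets_Collect_countable_Bex measurable_sets borel_measurable_le borel_measurable_sum coord)
  have inner: "(\<integral>\<^sup>+ x. indicator ?E (x(k := v)) \<partial>sample {Suc k..<N})
      \<le> ennreal (exp (g v)) * ennreal (exp (- y) * \<psi> ^ (N - Suc k))" for v
  proof (cases "y \<le> g v")
    case True
    interpret S: prob_space "sample {Suc k..<N}" by (rule prob_space_sample)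
    have "(\<integral>\<^sup>+ x. indicator ?E (x(k := v)) \<partial>sample {Suc k..<N})
        \<le> (\<integral>\<^sup>+ x. 1 \<partial>sample {Suc k..<N})"
      by (intro nn_integral_mono) (auto simp: indicator_def)
    also have "\<dots> = 1" using S.emeasure_space_1 by simp
    also have "1 \<le> ennreal (exp (g v) * (exp (- y) * \<psi> ^ (N - Suc k)))"
    proof -
      have "1 * 1 \<le> exp (g v + - y) * \<psi> ^ (N - Suc k)"
        using True \<psi>(2) by (intro mult_mono one_le_power) auto
      then show ?thesis by (simp add: exp_diff exp_minus field_simps)
    qed
    finally show ?thesis using \<psi>(2) by (simp add: ennreal_mult)
  next
    case False
    have "(\<integral>\<^sup>+ x. indicator ?E (x(k := v)) \<partial>sample {Suc k..<N})
        \<le> (\<integral>\<^sup>+ x. indicator {x\<in>space (sample {Suc k..<N}). \<exists>n\<in>{Suc k<..N}.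
              y - g v \<le> (\<Sum>i\<in>{Suc k..<n}. g (x i))} x \<partial>sample {Suc k..<N})"
    proof (intro nn_integral_mono)
      fix x assume x: "x \<in> space (sample {Suc k..<N})"
      have "\<exists>n\<in>{Suc k<..N}. y - g v \<le> (\<Sum>i\<in>{Suc k..<n}. g (x i))"
        if n: "n \<in> {k<..N}" "y \<le> (\<Sum>i\<in>{k..<n}. g ((x(k := v)) i))" for n
      proof -
        have "{k..<n} = insert k {Suc k..<n}" using n by auto
        then have "(\<Sum>i\<in>{k..<n}. g ((x(k := v)) i)) = g v + (\<Sum>i\<in>{Suc k..<n}. g (x i))"
          by (auto intro!: sum.cong)
        with n False have *: "y - g v \<le> (\<Sum>i\<in>{Suc k..<n}. g (x i))" by simp
        \<comment> \<open>For \<open>n = Suc k\<close> the remaining sum is empty and would give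
          \<open>y <= g v\<close>.\<close>
        have "n \<noteq> Suc k" using * False by auto
        with n * show ?thesis by (intro bexI[of _ n]) auto
      qed
      with x show "indicator ?E (x(k := v)) \<le> (indicator {x\<in>space (sample {Suc k..<N}).
          \<exists>n\<in>{Suc k<..N}. y - g v \<le> (\<Sum>i\<in>{Suc k..<n}. g (x i))} x :: ennreal)"
        by (auto simp: indicator_def simp del: sum.op_ivl_Suc)
    qed
    also have "\<dots> = emeasure (sample {Suc k..<N}) {x\<in>space (sample {Suc k..<N}). \<exists>n\<in>{Suc k<..N}.
              y - g v \<le> (\<Sum>i\<in>{Suc k..<n}. g (x i))}"
      by (intro nn_integral_indicator)
        (auto intro!: sets.sets_Collect_countable_Bex measurable_sets borel_measurable_le borel_measurable_sum coord)
    also have "\<dots> \<le> ennreal (exp (- (y - g v)) * \<psi> ^ (N - Suc k))"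
      by (rule step.IH)
    also have "\<dots> = ennreal (exp (g v)) * ennreal (exp (- y) * \<psi> ^ (N - Suc k))"
      using \<psi>(2) by (simp add: ennreal_mult'[symmetric] exp_diff exp_minus field_simps)
    finally show ?thesis .
  qed
  have "emeasure (sample {k..<N}) ?E = (\<integral>\<^sup>+ x. indicator ?E x \<partial>sample {k..<N})"
    by simp
  also have "\<dots> = (\<integral>\<^sup>+ v. (\<integral>\<^sup>+ x. indicator ?E (x(k := v)) \<partial>sample {Suc k..<N}) \<partial>M)"
    using P.product_nn_integral_insert_rev[of "{Suc k..<N}" k "indicator ?E"]
    unfolding ins[symmetric] by simp
  also have "\<dots> \<le> (\<integral>\<^sup>+ v. ennreal (exp (g v)) * ennreal (exp (- y) * \<psi> ^ (N - Suc k)) \<partial>M)"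
    by (intro nn_integral_mono inner)
  also have "\<dots> = (\<integral>\<^sup>+ v. ennreal (exp (g v)) \<partial>M) * ennreal (exp (- y) * \<psi> ^ (N - Suc k))"
    by (intro nn_integral_multc) simp
  also have "\<dots> \<le> ennreal \<psi> * ennreal (exp (- y) * \<psi> ^ (N - Suc k))"
    by (intro mult_right_mono \<psi>) auto
  also have "\<dots> = ennreal (exp (- y) * \<psi> ^ (N - k))"
  proof -
    have "N - k = Suc (N - Suc k)" using step by auto
    then show ?thesis using \<psi>(2) by (simp add: ennreal_mult'[symmetric] mult_ac)
  qed
  finally show ?case .
qed

lemma maximal_exp:
  assumes g[measurable]: "g \<in> borel_measurable borel"
    and \<psi>: "(\<integral>\<^sup>+x. ennreal (exp (g x)) \<partial>M) \<le> ennreal \<psi>" "1 \<le> \<psi>"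
    and y: "0 < y"
  shows "{x\<in>space (sample {..<N}). \<exists>n\<le>N. y \<le> (\<Sum>i<n. g (x i))} \<in> sets (sample {..<N})" (is ?A)
    and "measure (sample {..<N}) {x\<in>space (sample {..<N}). \<exists>n\<le>N. y \<le> (\<Sum>i<n. g (x i))}
      \<le> exp (- y) * \<psi> ^ N" (is ?B)
proof -
  interpret S: prob_space "sample {..<N}" by (rule prob_space_sample)
  have eq: "{x\<in>space (sample {..<N}). \<exists>n\<le>N. y \<le> (\<Sum>i<n. g (x i))}
     = {x\<in>space (sample {..<N}). \<exists>n\<in>{0<..N}. y \<le> (\<Sum>i\<in>{0..<n}. g (x i))}"
  proof -
    have "(\<exists>n\<le>N. y \<le> (\<Sum>i<n. g (x i))) \<longleftrightarrow> (\<exists>n\<in>{0<..N}. y \<le> (\<Sum>i\<in>{0..<n}. g (x i)))" for x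
      using y by (auto simp: lessThan_atLeast0 intro!: bexI) (metis bot_nat_0.not_eq_extremum linorder_not_less sum.empty atLeastLessThan0)+
    then show ?thesis by simp
  qed
  have coord: "(\<lambda>x. g (x i)) \<in> borel_measurable (sample I)" if "i \<in> I" for i I
    using that by measurable
  show ?A unfolding eq
    by (auto intro!: sets.sets_Collect_countable_Bex measurable_sets borel_measurable_le borel_measurable_sum coord)
  show ?B
    using maximal_exp_aux[OF g \<psi>, of 0 N y] \<psi>(2) unfolding eq
    by (simp add: S.emeasure_eq_measure[unfolded lessThan_atLeast0] lessThan_atLeast0)
qed

lemma exp_le_quadratic:
  fixes z c :: real
  assumes "\<bar>z\<bar> \<le> c"
  shows "exp z \<le> 1 + z + z\<^sup>2 / 2 * exp c"
proof -
  obtain t where t: "\<bar>t\<bar> \<le> \<bar>z\<bar>" "exp z = (\<Sum>m<2. z ^ m / fact m) + exp t / fact 2 * z ^ 2"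
    using Maclaurin_exp_le[of z 2] by auto
  have "exp t * z\<^sup>2 \<le> exp c * z\<^sup>2" using t(1) assms by (intro mult_right_mono) auto
  then show ?thesis using t(2) by (simp add: numeral_2_eq_2 mult.commute)
qed

text \<open>Taylor expansion to second order, with the remainder controlled by
  \<open>exp (\<theta> * b)\<close>. This factor is kept as it is: in the decisive use
  \<open>\<theta> * b\<close> tends to 0, so that the constant \<open>v / 2\<close> of the Gaussian
  bound is reached asymptotically.\<close>

lemma mgf_bound:
  assumes g[measurable]: "g \<in> borel_measurable borel" and b: "\<And>x. \<bar>g x\<bar> \<le> b"
    and z: "(\<integral>x. g x \<partial>M) = 0" and v: "(\<integral>x. (g x)\<^sup>2 \<partial>M) \<le> v" and "0 \<le> \<theta>"
  shows "(\<integral>\<^sup>+x. ennreal (exp (\<theta> * g x)) \<partial>M) \<le> ennreal (exp (\<theta>\<^sup>2 * v / 2 * exp (\<theta> * b)))"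
proof -
  have b0: "0 \<le> b" using b[of 0] by linarith
  have int[simp]: "integrable M g" using b by (intro integrable_const_bound[where B = b]) auto
  have int2[simp]: "integrable M (\<lambda>x. (g x)\<^sup>2)"
    using b b0 by (intro integrable_const_bound[where B = "b\<^sup>2"]) (auto simp: abs_le_square_iff[symmetric])
  have le: "exp (\<theta> * g x) \<le> 1 + \<theta> * g x + \<theta>\<^sup>2 / 2 * exp (\<theta> * b) * (g x)\<^sup>2" for x
  proof -
    have "\<bar>\<theta> * g x\<bar> \<le> \<theta> * b" using b \<open>0 \<le> \<theta>\<close> by (simp add: abs_mult mult_left_mono)
    from exp_le_quadratic[OF this] show ?thesis by (simp add: power_mult_distrib mult_ac)
  qed
  have "(\<integral>\<^sup>+x. ennreal (exp (\<theta> * g x)) \<partial>M)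
      \<le> (\<integral>\<^sup>+x. ennreal (1 + \<theta> * g x + \<theta>\<^sup>2 / 2 * exp (\<theta> * b) * (g x)\<^sup>2) \<partial>M)"
    by (intro nn_integral_mono ennreal_leI le)
  also have "\<dots> = ennreal (\<integral>x. 1 + \<theta> * g x + \<theta>\<^sup>2 / 2 * exp (\<theta> * b) * (g x)\<^sup>2 \<partial>M)"
  proof (intro nn_integral_eq_integral AE_I2)
    show "0 \<le> 1 + \<theta> * g x + \<theta>\<^sup>2 / 2 * exp (\<theta> * b) * (g x)\<^sup>2" for x
      by (rule order_trans[OF exp_ge_zero le])
  qed simp
  also have "(\<integral>x. 1 + \<theta> * g x + \<theta>\<^sup>2 / 2 * exp (\<theta> * b) * (g x)\<^sup>2 \<partial>M)
      = 1 + \<theta>\<^sup>2 / 2 * exp (\<theta> * b) * (\<integral>x. (g x)\<^sup>2 \<partial>M)"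
    using z prob_space by simp
  also have "\<dots> \<le> 1 + \<theta>\<^sup>2 / 2 * exp (\<theta> * b) * v" using v by (intro add_left_mono mult_left_mono) auto
  also have "\<dots> \<le> exp (\<theta>\<^sup>2 * v / 2 * exp (\<theta> * b))"
    using exp_ge_add_one_self[of "\<theta>\<^sup>2 * v / 2 * exp (\<theta> * b)"] by (simp add: mult_ac)
  finally show ?thesis by (simp add: ennreal_leI)
qed

text \<open>\<open>\<theta>\<close> stays free because its optimal value depends on the threshold in
  the chaining bounds, but is a constant for the dual statistic.\<close>

lemma maximal_bernstein:
  assumes g[measurable]: "g \<in> borel_measurable borel" and b: "\<And>x. \<bar>g x\<bar> \<le> b"
    and z: "(\<integral>x. g x \<partial>M) = 0" and v: "(\<integral>x. (g x)\<^sup>2 \<partial>M) \<le> v" and "0 < \<theta>" and y: "0 < y"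
  shows "{x\<in>space (sample {..<N}). \<exists>n\<le>N. y \<le> (\<Sum>i<n. g (x i))} \<in> sets (sample {..<N})" (is ?A)
    and "measure (sample {..<N}) {x\<in>space (sample {..<N}). \<exists>n\<le>N. y \<le> (\<Sum>i<n. g (x i))}
      \<le> exp (- \<theta> * y + real N * (\<theta>\<^sup>2 * v / 2 * exp (\<theta> * b)))" (is ?B)
proof -
  have eq: "(y \<le> (\<Sum>i<n. g (x i))) \<longleftrightarrow> \<theta> * y \<le> (\<Sum>i<n. \<theta> * g (x i))" for n and x :: "nat \<Rightarrow> real"
    using \<open>0 < \<theta>\<close> by (simp add: sum_distrib_left[symmetric])
  have "0 \<le> (\<integral>x. (g x)\<^sup>2 \<partial>M)" by simp
  with v have v0: "0 \<le> v" by linarith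
  note * = maximal_exp[of "\<lambda>x. \<theta> * g x" "exp (\<theta>\<^sup>2 * v / 2 * exp (\<theta> * b))" "\<theta> * y" N]
  show ?A unfolding eq using mgf_bound[OF g b z v, of \<theta>] \<open>0 < \<theta>\<close> y v0 by (intro *) auto
  have "measure (sample {..<N}) {x\<in>space (sample {..<N}). \<exists>n\<le>N. \<theta> * y \<le> (\<Sum>i<n. \<theta> * g (x i))}
     \<le> exp (- (\<theta> * y)) * exp (\<theta>\<^sup>2 * v / 2 * exp (\<theta> * b)) ^ N"
    using mgf_bound[OF g b z v, of \<theta>] \<open>0 < \<theta>\<close> y v0 by (intro *) auto
  then show ?B unfolding eq by (simp only: exp_add exp_of_nat_mult minus_mult_left)
qed

text \<open>\<open>n\<close> times the difference between the empirical and the true distribution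
  function. Without division by \<open>n\<close> it is a random walk in \<open>n\<close>, so that
  the maximal inequalities cover all sample sizes of a block at once.\<close>

definition dev :: "(nat \<Rightarrow> real) \<Rightarrow> nat \<Rightarrow> real \<Rightarrow> real" where
  "dev x n t = (\<Sum>i<n. indicator {..t} (x i) - cdf M t)"

lemma dev_diff:
  assumes "s \<le> t"
  shows "dev x n t - dev x n s = (\<Sum>i<n. indicator {s<..t} (x i) - measure M {s<..t})"
  unfolding dev_def sum_subtractf[symmetric]
proof (intro sum.cong refl)
  fix i
  have "cdf M t - cdf M s = measure M {s<..t}"
    using assms by (cases "s = t") (auto simp: cdf_diff_eq)
  then show "indicator {..t} (x i) - cdf M t - (indicator {..s} (x i) - cdf M s)
     = indicator {s<..t} (x i) - measure M {s<..t}"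
    using assms by (auto simp: indicator_def)
qed

text \<open>The increment is a centred binomial sum with variance at most \<open>N * p\<close>. The
  restriction \<open>y <= 4 * (real N * p)\<close> keeps the exponential parameter below 1, where
  the tail is of Gaussian type.\<close>

lemma increment_tail:
  assumes st: "s \<le> t" and p: "measure M {s<..t} \<le> p" and y: "0 < y" "y \<le> 4 * (real N * p)"
  shows "{x\<in>space (sample {..<N}). \<exists>n\<le>N. y \<le> \<bar>dev x n t - dev x n s\<bar>} \<in> sets (sample {..<N})" (is ?A)
    and "measure (sample {..<N}) {x\<in>space (sample {..<N}). \<exists>n\<le>N. y \<le> \<bar>dev x n t - dev x n s\<bar>}
      \<le> 2 * exp (- y\<^sup>2 / (8 * (real N * p)))" (is ?B)
proof -
  interpret S: prob_space "sample {..<N}" by (rule prob_space_sample)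
  define m where "m = measure M {s<..t}"
  have m: "0 \<le> m" "m \<le> 1" "m \<le> p" using p by (auto simp: m_def)
  have Np: "0 < real N * p" using y by linarith
  \<comment> \<open>The minimiser of \<open>- \<theta> * y + 2 * real N * \<theta>^2 * p\<close>,
    the exponent that remains after estimating \<open>exp \<theta> / 2\<close> by 2; its value there
    is \<open>- y^2 / (8 * (real N * p))\<close>.\<close>
  define \<theta> where "\<theta> = y / (4 * (real N * p))"
  have l: "0 < \<theta>" "\<theta> \<le> 1" using y Np by (auto simp: \<theta>_def)
  have int[simp]: "integrable M (indicator {s<..t} :: real \<Rightarrow> real)"
    by (intro integrable_real_indicator) (auto simp: less_top[symmetric])
  have i1: "(\<integral>x. indicator {s<..t} x - m \<partial>M) = 0" by (simp add: m_def prob_UNIV)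
  have "(\<integral>x. (indicator {s<..t} x - m)\<^sup>2 \<partial>M) = (\<integral>x. (1 - 2 * m) * indicator {s<..t} x + m\<^sup>2 \<partial>M)"
    by (intro Bochner_Integration.integral_cong) (auto simp: indicator_def power2_eq_square algebra_simps)
  also have "\<dots> = (1 - 2 * m) * m + m\<^sup>2" by (simp add: m_def prob_UNIV)
  also have "\<dots> \<le> p" using m by (simp add: power2_eq_square algebra_simps) (smt (verit) mult_nonneg_nonneg)
  finally have i2: "(\<integral>x. (indicator {s<..t} x - m)\<^sup>2 \<partial>M) \<le> p" .
  then have i2': "(\<integral>x. (m - indicator {s<..t} x)\<^sup>2 \<partial>M) \<le> p" by (simp add: power2_commute)
  have bnd: "\<bar>indicator {s<..t} x - m\<bar> \<le> 1" for x using m by (auto simp: indicator_def)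
  have bnd': "\<bar>m - indicator {s<..t} x\<bar> \<le> 1" for x using m by (auto simp: indicator_def)
  have i1': "(\<integral>x. m - indicator {s<..t} x \<partial>M) = 0" by (simp add: m_def prob_UNIV)
  have meas[measurable]: "(\<lambda>x. indicator {s<..t} x - m) \<in> borel_measurable borel"
    "(\<lambda>x. m - indicator {s<..t} x) \<in> borel_measurable borel" by measurable
  note P = maximal_bernstein[OF meas(1) bnd i1 i2 l(1) y(1), of N]
  note Q = maximal_bernstein[OF meas(2) bnd' i1' i2' l(1) y(1), of N]
  let ?P = "{x\<in>space (sample {..<N}). \<exists>n\<le>N. y \<le> (\<Sum>i<n. indicator {s<..t} (x i) - m)}"
  let ?Q = "{x\<in>space (sample {..<N}). \<exists>n\<le>N. y \<le> (\<Sum>i<n. m - indicator {s<..t} (x i))}"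
  have neg: "(\<Sum>i<n. m - indicator {s<..t} (x i)) = - (\<Sum>i<n. indicator {s<..t} (x i) - m)"
    for n and x :: "nat \<Rightarrow> real" by (simp add: sum_negf[symmetric])
  have eq: "{x\<in>space (sample {..<N}). \<exists>n\<le>N. y \<le> \<bar>dev x n t - dev x n s\<bar>} = ?P \<union> ?Q"
    unfolding dev_diff[OF st] m_def[symmetric] neg using y(1) by (auto simp: abs_if)
  show ?A unfolding eq using P(1) Q(1) by simp
  have "exp \<theta> \<le> exp 1" using l(2) by simp
  then have "exp \<theta> \<le> 3" using exp_le by linarith
  then have "\<theta>\<^sup>2 * p / 2 * exp (\<theta> * 1) \<le> \<theta>\<^sup>2 * p / 2 * 3"
    using m by (intro mult_left_mono) auto
  also have "\<dots> \<le> 2 * \<theta>\<^sup>2 * p" using m by (auto simp: mult_ac)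
  finally have "- \<theta> * y + real N * (\<theta>\<^sup>2 * p / 2 * exp (\<theta> * 1)) \<le> - \<theta> * y + real N * (2 * \<theta>\<^sup>2 * p)"
    by (intro add_left_mono mult_left_mono) auto
  also have "\<dots> = - y\<^sup>2 / (8 * (real N * p))"
    using Np by (simp add: \<theta>_def power2_eq_square field_simps)
  finally have e: "exp (- \<theta> * y + real N * (\<theta>\<^sup>2 * p / 2 * exp (\<theta> * 1))) \<le> exp (- y\<^sup>2 / (8 * (real N * p)))"
    by simp
  have "measure (sample {..<N}) (?P \<union> ?Q) \<le> measure (sample {..<N}) ?P + measure (sample {..<N}) ?Q"
    by (rule measure_Un_le[OF P(1) Q(1)])
  with P(2) Q(2) e show ?B unfolding eq by linarith
qed

end

lemma sum_three_quarters_le: "(\<Sum>i\<le>r. (3/4::real) ^ i) \<le> 4"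
proof -
  have "(\<Sum>i\<le>r. (3/4::real) ^ i) = 4 - 3 * (3/4) ^ r" by (induction r) auto
  then show ?thesis by simp
qed

lemma sum_halves_le: "(\<Sum>i\<le>r. (1/2::real) ^ i) \<le> 2"
proof -
  have "(\<Sum>i\<le>r. (1/2::real) ^ i) = 2 - (1/2) ^ r" by (induction r) auto
  then show ?thesis by simp
qed

lemma power_of_two_between:
  fixes c :: real
  assumes "1 < c"
  obtains R :: nat where "c \<le> 2 ^ R" "2 ^ R \<le> 2 * c"
proof -
  define R where "R = (LEAST r::nat. c \<le> 2 ^ r)"
  have ex: "\<exists>r::nat. c \<le> 2 ^ r" using real_arch_pow[of 2 c] by (auto intro: less_imp_le)
  have R: "c \<le> 2 ^ R" unfolding R_def by (rule LeastI_ex[OF ex])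
  with assms have "R \<noteq> 0" by (intro notI) auto
  then obtain r where r: "R = Suc r" by (cases R) auto
  then have "\<not> c \<le> 2 ^ r" using not_less_Least[of r "\<lambda>r. c \<le> 2 ^ r"] R_def by auto
  with R r show ?thesis by (intro that[of R]) auto
qed

lemma exp_neg_two_le: "exp (- 2) \<le> (1/4 :: real)"
proof -
  have "2 \<le> exp (1::real)" using exp_ge_add_one_self[of 1] by simp
  then have "2 * 2 \<le> exp (1::real) * exp 1" by (intro mult_mono) auto
  then have "4 \<le> exp (2::real)" by (simp add: exp_add[symmetric])
  then show ?thesis by (simp add: exp_minus field_simps)
qed

section \<open>Chaining over dyadic grids\<close>

context real_distribution
begin

definition cdf_lipschitz :: "real \<Rightarrow> real \<Rightarrow> real \<Rightarrow> bool" where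
  "cdf_lipschitz K a b \<longleftrightarrow> (\<forall>s t. a \<le> s \<longrightarrow> s \<le> t \<longrightarrow> t \<le> b \<longrightarrow> cdf M t - cdf M s \<le> K * (t - s))"

lemma cdf_lipschitz_subset:
  "cdf_lipschitz K a b \<Longrightarrow> a \<le> a' \<Longrightarrow> b' \<le> b \<Longrightarrow> cdf_lipschitz K a' b'"
  by (auto simp: cdf_lipschitz_def)

text \<open>Adding \<open>n\<close> times the distribution function turns \<open>dev\<close> into a
  monotone count. Hence between two grid points it strays from the grid values by at most the
  expected number of observations between them.\<close>

lemma dev_mono:
  assumes "s \<le> t"
  shows "dev x n s \<le> dev x n t + real n * (cdf M t - cdf M s)"
proof -
  have "dev x n s \<le> (\<Sum>i<n. (indicator {..t} (x i) - cdf M t) + (cdf M t - cdf M s))"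
    unfolding dev_def using assms by (intro sum_mono) (auto simp: indicator_def)
  then show ?thesis unfolding sum.distrib dev_def by simp
qed

text \<open>Chaining over the dyadic subintervals of \<open>{u..u + l}\<close>. The threshold at level \<open>r\<close> is
  proportional to \<open>(3/4) ^ r\<close>, which decays more slowly than the standard deviation \<open>2 powr (- r / 2)\<close> of
  an increment, and the levels stop once the expected number of observations in a dyadic
  subinterval is below \<open>y / 4\<close>.\<close>

lemma oscillation:
  assumes lip: "cdf_lipschitz K u (u + l)"
    and l: "0 < l" and y: "0 < y" "y \<le> real N * (K * l)" "8192 * (real N * (K * l)) \<le> y\<^sup>2"
  obtains A where "A \<in> sets (sample {..<N})"
    and "measure (sample {..<N}) A \<le> 4 * exp (- y\<^sup>2 / (512 * (real N * (K * l))))"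
    and "\<forall>x\<in>space (sample {..<N}) - A. \<forall>n\<le>N. \<forall>t. u \<le> t \<longrightarrow> t \<le> u + l \<longrightarrow>
          \<bar>dev x n t - dev x n u\<bar> \<le> y"
proof -
  interpret S: prob_space "sample {..<N}" by (rule prob_space_sample)
  have K: "cdf M t - cdf M s \<le> K * (t - s)" if "u \<le> s" "s \<le> t" "t \<le> u + l" for s t
    using lip that by (auto simp: cdf_lipschitz_def)
  define V where "V = real N * (K * l)"
  have V: "0 < V" "y \<le> V" "8192 * V \<le> y\<^sup>2" using y by (auto simp: V_def)
  have N: "0 < N" using V by (auto simp: V_def intro: gr0I)
  have K0: "0 < K" using V l N by (auto simp: V_def zero_less_mult_iff)
  define a where "a = y\<^sup>2 / (512 * V)"
  have a: "16 \<le> a" using V by (auto simp: a_def field_simps)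
  \<comment> \<open>At the finest level \<open>R\<close> a cell contains at most
    \<open>y / 4\<close> expected observations, so that monotonicity takes over. Overshooting by at
    most a factor 2 keeps all levels in the Gaussian regime, see \<open>th_le\<close>.\<close>
  have "1 < 4 * V / y" using V y by (auto simp: field_simps)
  then obtain R :: nat where R: "4 * V / y \<le> 2 ^ R" "2 ^ R \<le> 2 * (4 * V / y)"
    by (rule power_of_two_between)
  \<comment> \<open>The weights \<open>(3/4) ^ r\<close> sum to at most 4, so the grid contributes
    at most \<open>y / 2\<close> in total and leaves room for the \<open>y / 4\<close> lost inside a
    cell.\<close>
  define th where "th r = y * (3/4) ^ r / 8" for r :: nat
  define G where "G r j = u + real j * (l / 2 ^ r)" for r j :: nat
  have Gl: "G r j \<le> u + l" if "j \<le> 2 ^ r" for r j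
  proof -
    have "real j \<le> 2 ^ r" using that by (metis of_nat_le_iff of_nat_numeral of_nat_power)
    then show ?thesis using l by (simp add: G_def field_simps)
  qed
  have Gu: "u \<le> G r j" for r j using l by (simp add: G_def)
  have Gm: "G r j \<le> G r (Suc j)" for r j using l by (simp add: G_def field_simps)
  have Gd: "cdf M (G r (Suc j)) - cdf M (G r j) \<le> K * (l / 2 ^ r)" if "j < 2 ^ r" for r j
  proof -
    have "cdf M (G r (Suc j)) - cdf M (G r j) \<le> K * (G r (Suc j) - G r j)"
      using that by (intro K Gu Gm Gl) auto
    also have "G r (Suc j) - G r j = l / 2 ^ r" by (simp add: G_def add_divide_distrib ring_distribs)
    finally show ?thesis .
  qed
  define B where "B r j = {x\<in>space (sample {..<N}). \<exists>n\<le>N. th r \<le> \<bar>dev x n (G r (Suc j)) - dev x n (G r j)\<bar>}" for r j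
  have th0: "0 < th r" for r using y by (simp add: th_def)
  have th_le: "th r \<le> 4 * (real N * (K * (l / 2 ^ r)))" if "r \<le> R" for r
  proof -
    have "(3/2) ^ r \<le> (2::real) ^ r" by (intro power_mono) auto
    also have "\<dots> \<le> 2 ^ R" using that by (intro power_increasing) auto
    also have "\<dots> \<le> 2 * (4 * V / y)" by (rule R)
    finally have "y * (3/2) ^ r / 8 \<le> V" using y by (simp add: field_simps)
    then have "y * (3/2) ^ r / 8 / 2 ^ r \<le> V / 2 ^ r" by (intro divide_right_mono) auto
    also have "y * (3/2) ^ r / 8 / 2 ^ r = th r"
      by (simp add: th_def power_divide) (simp add: field_simps power_mult_distrib[symmetric])
    also have "V / 2 ^ r \<le> (4 * V) / 2 ^ r" using V by (intro divide_right_mono) auto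
    also have "\<dots> = 4 * (real N * (K * (l / 2 ^ r)))" by (simp add: V_def)
    finally show ?thesis .
  qed
  have pr: "measure M {G r j<..G r (Suc j)} \<le> K * (l / 2 ^ r)" if "j < 2 ^ r" for r j
    using Gd[OF that] Gm[of r j] K0 l by (cases "G r j = G r (Suc j)") (auto simp: cdf_diff_eq)
  have Bm: "B r j \<in> sets (sample {..<N})" if "r \<le> R" "j < 2 ^ r" for r j
    unfolding B_def by (rule increment_tail[OF Gm pr th0 th_le]) fact+
  \<comment> \<open>Each level halves the variance but multiplies the squared threshold by 9/16, so
    the exponent grows by the factor 9/8. By Bernoulli's inequality and \<open>16 <= a\<close> this
    already gives the factor \<open>exp (- 2 * r)\<close>, hence \<open>(1/4) ^ r\<close>, against
    only \<open>2 ^ r\<close> cells.\<close>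
  have Bp: "measure (sample {..<N}) (B r j) \<le> 2 * exp (- a) * (1/4) ^ r" if rj: "r \<le> R" "j < 2 ^ r" for r j
  proof -
    have "measure (sample {..<N}) (B r j) \<le> 2 * exp (- (th r)\<^sup>2 / (8 * (real N * (K * (l / 2 ^ r)))))"
      unfolding B_def by (rule increment_tail[OF Gm pr th0 th_le]) fact+
    also have "(th r)\<^sup>2 / (8 * (real N * (K * (l / 2 ^ r)))) = a * (9/8) ^ r"
    proof -
      define P :: real where "P = (3/4) ^ r"
      have "P\<^sup>2 = (9/16) ^ r" unfolding P_def by (simp add: power2_eq_square power_mult_distrib[symmetric])
      then have "P\<^sup>2 * 2 ^ r = (9/8) ^ r" by (simp add: power_mult_distrib[symmetric])
      moreover have "(th r)\<^sup>2 / (8 * (real N * (K * (l / 2 ^ r)))) = a * (P\<^sup>2 * 2 ^ r)"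
      proof -
        have "th r = y * P / 8" by (simp only: th_def P_def)
        show ?thesis unfolding \<open>th r = y * P / 8\<close> a_def V_def by (simp add: power_mult_distrib power_divide)
      qed
      ultimately show ?thesis by simp
    qed
    then have "- (th r)\<^sup>2 / (8 * (real N * (K * (l / 2 ^ r)))) = - (a * (9/8) ^ r)" by simp
    also have "exp (- (a * (9/8) ^ r)) \<le> exp (- a + - 2 * real r)"
    proof -
      have "1 + real r * (1/8) \<le> (1 + 1/8) ^ r" by (rule Bernoulli_inequality) auto
      then have "a * (1 + real r * (1/8)) \<le> a * (9/8) ^ r" using a by (intro mult_left_mono) auto
      moreover have "16 * real r \<le> a * real r" using a by (intro mult_right_mono) auto
      moreover have "a * (1 + real r * (1/8)) = a + (a * real r) / 8" by (simp add: algebra_simps)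
      ultimately have "a + 2 * real r \<le> a * (9/8) ^ r" by linarith
      then show ?thesis by simp
    qed
    also have "\<dots> = exp (- a) * exp (- 2) ^ r"
      by (simp add: exp_add exp_of_nat_mult[symmetric] mult.commute) (simp add: exp_diff exp_minus field_simps)
    also have "\<dots> \<le> exp (- a) * (1/4) ^ r"
      using exp_neg_two_le by (intro mult_left_mono power_mono) auto
    finally show ?thesis by simp
  qed
  define A where "A = (\<Union>r\<in>{..R}. \<Union>j\<in>{..<2 ^ r}. B r j)"
  show ?thesis
  proof (rule that[of A])
    show "A \<in> sets (sample {..<N})" unfolding A_def using Bm by auto
    have "measure (sample {..<N}) A \<le> (\<Sum>r\<in>{..R}. measure (sample {..<N}) (\<Union>j\<in>{..<2 ^ r}. B r j))"
      unfolding A_def using Bm by (intro measure_UNION_le) auto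
    also have "\<dots> \<le> (\<Sum>r\<in>{..R}. \<Sum>j\<in>{..<2 ^ r}. measure (sample {..<N}) (B r j))"
      using Bm by (intro sum_mono measure_UNION_le) auto
    also have "\<dots> \<le> (\<Sum>r\<in>{..R}. \<Sum>j\<in>{..<2 ^ r::nat}. 2 * exp (- a) * (1/4) ^ r)"
      using Bp by (intro sum_mono) auto
    also have "\<dots> = 2 * exp (- a) * (\<Sum>r\<in>{..R}. (1/2) ^ r)"
      unfolding sum_distrib_left
      by (intro sum.cong refl) (simp add: power_mult_distrib[symmetric] mult_ac)
    also have "\<dots> \<le> 2 * exp (- a) * 2" by (intro mult_left_mono sum_halves_le) auto
    finally show "measure (sample {..<N}) A \<le> 4 * exp (- y\<^sup>2 / (512 * (real N * (K * l))))"
      by (simp add: a_def V_def)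
  next
    show "\<forall>x\<in>space (sample {..<N}) - A. \<forall>n\<le>N. \<forall>t. u \<le> t \<longrightarrow> t \<le> u + l \<longrightarrow>
          \<bar>dev x n t - dev x n u\<bar> \<le> y"
    proof (intro ballI allI impI)
    fix x n t assume x: "x \<in> space (sample {..<N}) - A" and n: "n \<le> N" and t: "u \<le> t" "t \<le> u + l"
    have inc: "\<bar>dev x n (G r (Suc j)) - dev x n (G r j)\<bar> \<le> th r" if "r \<le> R" "j < 2 ^ r" for r j
    proof (rule ccontr)
      assume "\<not> ?thesis"
      then have "x \<in> B r j" using x n by (auto simp: B_def)
      with that x show False by (auto simp: A_def)
    qed
    \<comment> \<open>An even point of level \<open>r + 1\<close> is a point of level
      \<open>r\<close>; an odd one is a single increment away from an even one.\<close>
    have grid: "\<bar>dev x n (G r j) - dev x n u\<bar> \<le> (\<Sum>i\<le>r. th i)" if "r \<le> R" "j \<le> 2 ^ r" for r j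
      using that
    proof (induction r arbitrary: j)
      case 0
      then consider "j = 0" | "j = 1" by force
      then show ?case
      proof cases
        case 1 then show ?thesis using th0[of 0] by (simp add: G_def)
      next
        case 2 then show ?thesis using inc[of 0 0] by (simp add: G_def)
      qed
    next
      case (Suc r)
      have GS: "G (Suc r) (2 * i) = G r i" for i by (simp add: G_def)
      show ?case
      proof (cases "even j")
        case True
        then obtain i where i: "j = 2 * i" by blast
        then have "\<bar>dev x n (G r i) - dev x n u\<bar> \<le> (\<Sum>i\<le>r. th i)"
          using Suc.prems by (intro Suc.IH) auto
        then show ?thesis using th0[of "Suc r"] by (simp add: i GS)
      next
        case False
        then obtain i where i: "j = Suc (2 * i)" by (metis oddE Suc_eq_plus1)
        then have "\<bar>dev x n (G r i) - dev x n u\<bar> \<le> (\<Sum>i\<le>r. th i)"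
          using Suc.prems by (intro Suc.IH) auto
        moreover have "\<bar>dev x n (G (Suc r) (Suc (2 * i))) - dev x n (G (Suc r) (2 * i))\<bar> \<le> th (Suc r)"
          using Suc.prems i by (intro inc) auto
        ultimately show ?thesis unfolding i GS by simp
      qed
    qed
    have half: "(\<Sum>i\<le>r. th i) \<le> y / 2" for r
    proof -
      have "(\<Sum>i\<le>r. th i) = y / 8 * (\<Sum>i\<le>r. (3/4) ^ i)"
        by (simp add: th_def sum_distrib_left)
      also have "\<dots> \<le> y / 8 * 4" using y by (intro mult_left_mono sum_three_quarters_le) auto
      finally show ?thesis by simp
    qed
    obtain j where j: "j < 2 ^ R" "G R j \<le> t" "t \<le> G R (Suc j)"
    proof (cases "t = u + l")
      \<comment> \<open>At the right end point the floor used below would give the index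
        \<open>2 ^ R\<close>, one beyond the last cell.\<close>
      case True
      have "G R (Suc (2 ^ R - 1)) = t" using True by (simp add: G_def)
      then show ?thesis using Gm[of R "2 ^ R - 1"] by (intro that[of "2 ^ R - 1"]) auto
    next
      case False
      define z where "z = (t - u) * 2 ^ R / l"
      have "(t - u) * 2 ^ R < l * 2 ^ R" using t False by (intro mult_strict_right_mono) auto
      then have z: "0 \<le> z" "z < 2 ^ R" using t l by (auto simp: z_def divide_less_eq mult.commute)
      have tz: "t = u + z * (l / 2 ^ R)" using l by (simp add: z_def)
      have fl: "real (nat \<lfloor>z\<rfloor>) \<le> z" "z \<le> real (Suc (nat \<lfloor>z\<rfloor>))"
        using z by (auto simp: of_nat_nat) linarith+
      have "(2::real) ^ R = real (2 ^ R)" by simp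
      with fl(1) z(2) have "nat \<lfloor>z\<rfloor> < 2 ^ R" by (metis le_less_trans of_nat_less_iff)
      moreover have "G R (nat \<lfloor>z\<rfloor>) \<le> t" "t \<le> G R (Suc (nat \<lfloor>z\<rfloor>))"
        unfolding G_def tz using fl l by (intro add_left_mono mult_right_mono; simp)+
      ultimately show ?thesis by (rule that)
    qed
    have gap: "real n * (cdf M b - cdf M c) \<le> y / 4" if "G R j \<le> c" "c \<le> b" "b \<le> G R (Suc j)" for b c
    proof -
      have "cdf M b - cdf M c \<le> cdf M (G R (Suc j)) - cdf M (G R j)"
        using that by (intro diff_mono cdf_nondecreasing) auto
      also have "\<dots> \<le> K * (l / 2 ^ R)" by (rule Gd[OF j(1)])
      finally have "real n * (cdf M b - cdf M c) \<le> real N * (K * (l / 2 ^ R))"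
        using n that cdf_nondecreasing[of c b] by (intro mult_mono) auto
      also have "\<dots> = V / 2 ^ R" by (simp add: V_def)
      also have "\<dots> \<le> y / 4" using R(1) y by (simp add: field_simps)
      finally show ?thesis .
    qed
    have "dev x n t \<le> dev x n (G R (Suc j)) + y / 4"
      using dev_mono[of t "G R (Suc j)" x n] gap[of t "G R (Suc j)"] j by auto
    moreover have "dev x n (G R j) \<le> dev x n t + y / 4"
      using dev_mono[of "G R j" t x n] gap[of "G R j" t] j by auto
    moreover have "\<bar>dev x n (G R j) - dev x n u\<bar> \<le> y / 2" "\<bar>dev x n (G R (Suc j)) - dev x n u\<bar> \<le> y / 2"
      using grid[of R j] grid[of R "Suc j"] half[of R] j(1) by auto
    ultimately show "\<bar>dev x n t - dev x n u\<bar> \<le> y" using y by linarith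
    qed
  qed
qed

end

section \<open>The Grenander estimator and its dual\<close>

lemma concave_on_secant_le:
  fixes \<phi> :: "real \<Rightarrow> real"
  assumes "concave_on S \<phi>" "a \<in> S" "c \<in> S" "a < b" "b < c"
  shows "(\<phi> c - \<phi> a) * (b - a) \<le> (\<phi> b - \<phi> a) * (c - a)"
    and "(\<phi> c - \<phi> b) * (c - a) \<le> (\<phi> c - \<phi> a) * (c - b)"
proof -
  define u where "u = (c - b) / (c - a)"
  have u: "0 \<le> u" "0 \<le> 1 - u" using assms by (auto simp: u_def field_simps)
  have "u * a + (1 - u) * c = c - u * (c - a)" by (simp add: algebra_simps)
  also have "\<dots> = b" using assms by (simp add: u_def)
  finally have b: "u * a + (1 - u) * c = b" .
  have "u * \<phi> a + (1 - u) * \<phi> c \<le> \<phi> (u * a + (1 - u) * c)"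
    using assms u unfolding concave_on_iff by (metis (no_types, lifting) add.commute diff_add_cancel real_scaleR_def)
  then have "(u * \<phi> a + (1 - u) * \<phi> c) * (c - a) \<le> \<phi> b * (c - a)"
    using assms b by (intro mult_right_mono) auto
  moreover have "u * (c - a) = c - b" using assms by (simp add: u_def)
  moreover have "(u * \<phi> a + (1 - u) * \<phi> c) * (c - a) = (u * (c - a)) * \<phi> a + ((c - a) - u * (c - a)) * \<phi> c"
    by (simp add: algebra_simps)
  ultimately have *: "(c - b) * \<phi> a + (b - a) * \<phi> c \<le> \<phi> b * (c - a)" by simp
  then show "(\<phi> c - \<phi> a) * (b - a) \<le> (\<phi> b - \<phi> a) * (c - a)"
    and "(\<phi> c - \<phi> b) * (c - a) \<le> (\<phi> c - \<phi> a) * (c - b)"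
    by (simp_all add: algebra_simps)
qed

lemma left_deriv_eqI:
  assumes "(\<phi> has_real_derivative D) (at_left t)"
  shows "left_deriv \<phi> t = D"
  unfolding left_deriv_def
proof (rule the_equality)
  show "(\<phi> has_real_derivative D) (at_left t)" by (rule assms)
  fix D' assume "(\<phi> has_real_derivative D') (at_left t)"
  with assms show "D' = D"
    unfolding has_field_derivative_iff using tendsto_unique[OF trivial_limit_at_left_real] by blast
qed

text \<open>The slopes of the secants from \<open>s\<close> to \<open>t\<close> decrease as
  \<open>s\<close> increases to \<open>t\<close>, so the left derivative is their infimum. It is
  finite because each of these slopes dominates the slope from \<open>t\<close> to
  \<open>t + 1\<close>; all three estimates are properties of this infimum.\<close>

lemma concave_left_deriv:
  assumes c: "concave_on {0..} \<phi>" and t: "0 < t"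
  shows left_deriv_le_slope: "\<And>s. 0 \<le> s \<Longrightarrow> s < t \<Longrightarrow> left_deriv \<phi> t * (t - s) \<le> \<phi> t - \<phi> s"
    and left_deriv_ge_slope: "\<And>s. t \<le> s \<Longrightarrow> \<phi> s - \<phi> t \<le> left_deriv \<phi> t * (s - t)"
    and left_deriv_approx: "\<And>a. left_deriv \<phi> t < a \<Longrightarrow> \<exists>s\<ge>0. s < t \<and> \<phi> t - \<phi> s < a * (t - s)"
proof -
  define sl where "sl s = (\<phi> t - \<phi> s) / (t - s)" for s
  define D where "D = Inf (sl ` {0..<t})"
  have right: "\<phi> s - \<phi> t \<le> sl r * (s - t)" if "t \<le> s" "0 \<le> r" "r < t" for s r
  proof (cases "s = t")
    case False
    then have "(\<phi> s - \<phi> r) * (t - r) \<le> (\<phi> t - \<phi> r) * (s - r)"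
      using that by (intro concave_on_secant_le[OF c]) auto
    then have "(\<phi> s - \<phi> t) * (t - r) \<le> (\<phi> t - \<phi> r) * (s - t)" by (simp add: algebra_simps)
    then show ?thesis using that by (simp add: sl_def field_simps)
  qed simp
  have anti: "sl s \<le> sl r" if "0 \<le> r" "r < s" "s < t" for r s
  proof -
    have "(\<phi> t - \<phi> s) * (t - r) \<le> (\<phi> t - \<phi> r) * (t - s)"
      using that by (intro concave_on_secant_le[OF c]) auto
    then show ?thesis using that by (simp add: sl_def field_simps)
  qed
  have bdd: "bdd_below (sl ` {0..<t})"
  proof (rule bdd_belowI)
    fix y assume "y \<in> sl ` {0..<t}"
    then show "\<phi> (t + 1) - \<phi> t \<le> y" using right[of "t + 1"] by auto
  qed
  have ne: "sl ` {0..<t} \<noteq> {}" using t by auto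
  have Dle: "D \<le> sl s" if "0 \<le> s" "s < t" for s
    unfolding D_def using that by (intro cInf_lower bdd) auto
  have approx: "\<exists>s\<ge>0. s < t \<and> sl s < a" if "D < a" for a
    using cInf_lessD[OF ne, of a] that by (auto simp: D_def)
  have "(\<phi> has_real_derivative D) (at_left t)"
    unfolding has_field_derivative_iff
  proof (rule order_tendstoI)
    fix a assume a: "a < D"
    show "\<forall>\<^sub>F y in at_left t. a < (\<phi> y - \<phi> t) / (y - t)"
      unfolding eventually_at_left_field
    proof (intro exI[of _ 0] conjI allI impI t)
      fix y assume "0 < y" "y < t"
      with Dle[of y] a have "a < sl y" by auto
      also have "sl y = (\<phi> y - \<phi> t) / (y - t)" by (simp add: sl_def) (metis minus_diff_eq minus_divide_divide)
      finally show "a < (\<phi> y - \<phi> t) / (y - t)" .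
    qed
  next
    fix a assume a: "D < a"
    then obtain s where s: "0 \<le> s" "s < t" "sl s < a" using approx by blast
    show "\<forall>\<^sub>F y in at_left t. (\<phi> y - \<phi> t) / (y - t) < a"
      unfolding eventually_at_left_field
    proof (intro exI[of _ s] conjI allI impI s)
      fix y assume "s < y" "y < t"
      with anti[of s y] s have "sl y < a" by auto
      also have "sl y = (\<phi> y - \<phi> t) / (y - t)" by (simp add: sl_def) (metis minus_diff_eq minus_divide_divide)
      finally show "(\<phi> y - \<phi> t) / (y - t) < a" .
    qed
  qed
  then have D: "left_deriv \<phi> t = D" by (rule left_deriv_eqI)
  show "left_deriv \<phi> t * (t - s) \<le> \<phi> t - \<phi> s" if "0 \<le> s" "s < t" for s
    using Dle[OF that] that unfolding D by (simp add: sl_def field_simps)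
  show "\<exists>s\<ge>0. s < t \<and> \<phi> t - \<phi> s < a * (t - s)" if "left_deriv \<phi> t < a" for a
    using approx[OF that[unfolded D]] by (auto simp: sl_def field_simps)
  show "\<phi> s - \<phi> t \<le> left_deriv \<phi> t * (s - t)" if s: "t \<le> s" for s
  proof (cases "s = t")
    case False
    with s have "(\<phi> s - \<phi> t) / (s - t) \<le> D" unfolding D_def
      using right[OF s] by (intro cInf_greatest ne) (auto simp: field_simps)
    then show ?thesis using False s unfolding D by (simp add: field_simps)
  qed simp
qed

section \<open>Duality between the estimator and the empirical distribution function\<close>

lemma emp_cdf_le_1: "emp_cdf x n t \<le> 1"
proof -
  have "card {i. i < n \<and> x i \<le> t} \<le> card {..<n}" by (intro card_mono) auto
  then show ?thesis by (simp add: emp_cdf_def divide_le_eq)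
qed

lemma lcm_emp_cdf_in: "least_concave_majorant (emp_cdf x n) \<in> concave_majorants (emp_cdf x n)"
proof (rule least_concave_majorant_in)
  have "(\<lambda>_. 1) \<in> concave_majorants (emp_cdf x n)"
    using emp_cdf_le_1 by (auto simp: concave_majorants_def concave_on_const)
  then show "concave_majorants (emp_cdf x n) \<noteq> {}" by blast
qed

text \<open>Affine majorants are the only competitors that the two duality lemmas have to
  exhibit.\<close>

lemma lcm_le_line:
  assumes "\<And>u. 0 \<le> u \<Longrightarrow> h u \<le> a * u + b" "0 \<le> t"
  shows "least_concave_majorant h t \<le> a * t + b"
proof -
  have "concave_on {0..} (\<lambda>u::real. a * u + b)"
    by (auto simp: concave_on_iff algebra_simps) (metis distrib_left mult.commute mult_1 order_refl)
  then show ?thesis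
    using assms least_concave_majorant_le[of "\<lambda>u. a * u + b" h t] by (auto simp: concave_majorants_def)
qed

text \<open>If the left derivative of the majorant \<open>L\<close> were below \<open>a\<close>, the
  line of slope \<open>a\<close> through the graph of \<open>L\<close> at \<open>t0\<close> would
  run above the data: to the right by concavity, and to the left because \<open>t\<close> does at
  least as well as every \<open>s\<close>. Then it lies above \<open>L\<close> too, although some
  point of \<open>L\<close> to the left of \<open>t0\<close> is strictly above it.\<close>

lemma grenander_ge:
  assumes t0: "0 < t0" and t: "t0 \<le> t"
    and le: "\<And>s. 0 \<le> s \<Longrightarrow> s < t0 \<Longrightarrow> emp_cdf x n s - a * s \<le> emp_cdf x n t - a * t"
  shows "a \<le> grenander x n t0"
proof (rule ccontr)
  define h where "h = emp_cdf x n"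
  define L where "L = least_concave_majorant h"
  have L: "concave_on {0..} L" "\<And>u. 0 \<le> u \<Longrightarrow> h u \<le> L u"
    using lcm_emp_cdf_in[of x n] by (auto simp: L_def h_def concave_majorants_def)
  assume "\<not> a \<le> grenander x n t0"
  then have D: "left_deriv L t0 < a" by (simp add: grenander_def L_def h_def)
  from left_deriv_approx[OF L(1) t0 D] obtain s
    where s: "0 \<le> s" "s < t0" "L t0 - L s < a * (t0 - s)" by blast
  have ge: "h u \<le> a * u + (L t0 - a * t0)" if "t0 \<le> u" for u
  proof -
    have "h u \<le> L u" using that t0 by (intro L) auto
    moreover have "L u - L t0 \<le> left_deriv L t0 * (u - t0)" by (rule left_deriv_ge_slope[OF L(1) t0 that])
    moreover have "left_deriv L t0 * (u - t0) \<le> a * (u - t0)" using D that by (intro mult_right_mono) auto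
    ultimately show ?thesis by (simp add: algebra_simps)
  qed
  have "L s \<le> a * s + (L t0 - a * t0)"
    unfolding L_def
  proof (rule lcm_le_line[OF _ s(1)], fold L_def)
    fix u :: real assume u: "0 \<le> u"
    show "h u \<le> a * u + (L t0 - a * t0)"
    proof (cases "t0 \<le> u")
      case False
      then show ?thesis using le[OF u] ge[OF t] by (simp add: h_def)
    qed (rule ge)
  qed
  with s(3) show False by (simp add: algebra_simps)
qed

lemma finite_max_attained:
  fixes f :: "'b \<Rightarrow> real"
  assumes "finite P" "P \<noteq> {}"
  obtains p where "p \<in> P" "\<And>r. r \<in> P \<Longrightarrow> f r \<le> f p"
proof -
  have "Max (f ` P) \<in> f ` P" using assms by (intro Max_in) auto
  then obtain p where "p \<in> P" "Max (f ` P) = f p" by auto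
  with assms that show ?thesis by (metis Max_ge finite_imageI imageI)
qed

text \<open>The empirical distribution function is constant between observations. So, for
  \<open>a >= 0\<close>, maximising \<open>emp_cdf x n u - a * u\<close> to the right of
  \<open>b\<close> is a problem with finitely many candidates; \<open>b\<close> itself is one of
  them because there may be no observation between \<open>b\<close> and \<open>u\<close>.\<close>

lemma emp_cdf_attained:
  assumes "b \<le> u"
  shows "\<exists>p\<in>insert b {x i | i. i < n \<and> b \<le> x i}. p \<le> u \<and> emp_cdf x n u = emp_cdf x n p"
proof -
  define P where "P = insert b {x i | i. i < n \<and> b \<le> x i \<and> x i \<le> u}"
  have fin: "finite P" by (simp add: P_def)
  have "Max P \<in> P" using fin by (intro Max_in) (auto simp: P_def)
  moreover have "{i. i < n \<and> x i \<le> u} = {i. i < n \<and> x i \<le> Max P}"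
  proof -
    have "x i \<le> Max P" if "i < n" "x i \<le> u" for i
    proof (cases "b \<le> x i")
      case True then show ?thesis using that fin by (intro Max_ge) (auto simp: P_def)
    next
      case False
      have "b \<le> Max P" using fin by (intro Max_ge) (auto simp: P_def)
      with False show ?thesis by linarith
    qed
    moreover have "Max P \<le> u" using assms fin by (subst Max_le_iff) (auto simp: P_def)
    ultimately show ?thesis by (auto intro: order_trans)
  qed
  ultimately show ?thesis using assms by (intro bexI[of _ "Max P"]) (auto simp: P_def emp_cdf_def)
qed

text \<open>Let \<open>p\<close> maximise \<open>emp_cdf x n u - a * u\<close> before
  \<open>t0\<close>. The line of slope \<open>a\<close> through the graph at \<open>p\<close>
  dominates the whole graph, hence also the majorant at \<open>t0\<close>, and so the secant of the
  majorant from \<open>p\<close> to \<open>t0\<close> has slope at most \<open>a\<close>.\<close>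

lemma grenander_le:
  assumes t0: "0 < t0" and a: "0 \<le> a" and s: "0 \<le> s" "s < t0"
    and le: "\<And>t. t0 \<le> t \<Longrightarrow> emp_cdf x n t - a * t \<le> emp_cdf x n s - a * s"
  shows "grenander x n t0 \<le> a"
proof (rule ccontr)
  define h where "h = emp_cdf x n"
  define L where "L = least_concave_majorant h"
  have L: "concave_on {0..} L" "\<And>u. 0 \<le> u \<Longrightarrow> h u \<le> L u"
    using lcm_emp_cdf_in[of x n] by (auto simp: L_def h_def concave_majorants_def)
  assume "\<not> grenander x n t0 \<le> a"
  then have D: "a < left_deriv L t0" by (simp add: grenander_def L_def h_def)
  define P where "P = {p\<in>insert 0 {x i | i. i < n \<and> 0 \<le> x i}. p < t0}"
  have fin: "finite P" and ne: "P \<noteq> {}" using t0 by (auto simp: P_def)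
  obtain p where p: "p \<in> P" "\<And>r. r \<in> P \<Longrightarrow> h r - a * r \<le> h p - a * p"
    using finite_max_attained[OF fin ne, of "\<lambda>r. h r - a * r"] by blast
  have p0: "0 \<le> p" "p < t0" using p(1) by (auto simp: P_def)
  have below: "h u - a * u \<le> h p - a * p" if u: "0 \<le> u" "u < t0" for u
  proof -
    obtain r where r: "r \<in> insert 0 {x i | i. i < n \<and> 0 \<le> x i}" "r \<le> u" "h u = h r"
      using emp_cdf_attained[OF u(1), of x n] unfolding h_def by blast
    have "h r - a * r \<le> h p - a * p" using r u by (intro p(2)) (auto simp: P_def)
    moreover have "a * r \<le> a * u" using a r by (intro mult_left_mono) auto
    ultimately show ?thesis using r(3) by linarith
  qed
  have "L t0 \<le> a * t0 + (h p - a * p)"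
    unfolding L_def
  proof (rule lcm_le_line)
    fix u :: real assume u: "0 \<le> u"
    show "h u \<le> a * u + (h p - a * p)"
    proof (cases "u < t0")
      case True with below[OF u] show ?thesis by simp
    next
      case False
      then show ?thesis using le[of u] below[OF s] by (simp add: h_def)
    qed
  qed (use t0 in auto)
  moreover have "left_deriv L t0 * (t0 - p) \<le> L t0 - L p"
    by (rule left_deriv_le_slope[OF L(1) t0 p0])
  moreover have "h p \<le> L p" by (rule L(2)[OF p0(1)])
  moreover have "a * (t0 - p) < left_deriv L t0 * (t0 - p)" using D p0 by (intro mult_strict_right_mono) auto
  ultimately show False by (simp add: algebra_simps)
qed

text \<open>Negating \<open>grenander_le\<close> yields a \<open>t\<close> for each \<open>s\<close>
  separately. The maximiser over the finitely many candidates from \<open>t0\<close> on beats all of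
  these and so serves every \<open>s\<close> simultaneously, which the averaging over
  \<open>s\<close> requires.\<close>

lemma grenander_gt_witness:
  assumes t0: "0 < t0" and a: "0 \<le> a" and gt: "a < grenander x n t0"
  obtains t where "t0 \<le> t"
    and "\<And>s. 0 \<le> s \<Longrightarrow> s < t0 \<Longrightarrow> emp_cdf x n s - a * s < emp_cdf x n t - a * t"
proof -
  define h where "h = emp_cdf x n"
  define P where "P = insert t0 {x i | i. i < n \<and> t0 \<le> x i}"
  have fin: "finite P" and ne: "P \<noteq> {}" by (auto simp: P_def)
  obtain p where p: "p \<in> P" "\<And>r. r \<in> P \<Longrightarrow> h r - a * r \<le> h p - a * p"
    using finite_max_attained[OF fin ne, of "\<lambda>r. h r - a * r"] by blast
  show ?thesis
  proof (rule that[of p])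
    show "t0 \<le> p" using p(1) by (auto simp: P_def)
    fix s assume s: "0 \<le> s" "s < t0"
    have "\<not> (\<forall>t\<ge>t0. h t - a * t \<le> h s - a * s)"
      using grenander_le[OF t0 a s, of x n] gt unfolding h_def by auto
    then obtain t where t: "t0 \<le> t" "h s - a * s < h t - a * t" by (auto simp: not_le)
    obtain r where r: "r \<in> P" "r \<le> t" "h t = h r"
      using emp_cdf_attained[OF t(1), of x n] unfolding h_def P_def by blast
    have "h r - a * r \<le> h p - a * p" by (rule p(2)[OF r(1)])
    moreover have "a * r \<le> a * t" using a r by (intro mult_left_mono) auto
    ultimately show "emp_cdf x n s - a * s < emp_cdf x n p - a * p" using r(3) t unfolding h_def by linarith
  qed
qed

section \<open>The constant of the Strassen ball\<close>

text \<open>Integrating \<open>g t - g s \<ge> t\<^sup>2 - s\<^sup>2\<close> over \<open>0 \<le> s \<le> t\<close> bounds \<open>\<integral> u g'(u) du\<close> from below;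
  comparing \<open>g'\<close> with its optimal value \<open>2 u\<close> in the mean square then bounds \<open>t\<close>.\<close>

lemma strassen_argmax_le:
  assumes g: "g \<in> strassen_set" and max: "\<And>s. g s - s\<^sup>2 \<le> g t - t\<^sup>2" and t: "0 < t"
  shows "4 / 3 * t ^ 3 \<le> 1"
proof -
  from g obtain g' where g'[measurable]: "g' \<in> borel_measurable borel"
    and gt: "\<And>t. g t = (LBINT s=ereal 0..ereal t. g' s)"
    and en: "(\<integral>\<^sup>+s. ennreal ((g' s)\<^sup>2) \<partial>lborel) \<le> 1"
    unfolding strassen_set_def by blast
  have sq: "integrable lborel (\<lambda>s. (g' s)\<^sup>2)"
    using en by (intro integrableI_nonneg) (auto simp: le_less_trans)
  have "ennreal (\<integral>s. (g' s)\<^sup>2 \<partial>lborel) \<le> 1"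
    using en sq by (subst nn_integral_eq_integral[symmetric]) auto
  then have sq1: "(\<integral>s. (g' s)\<^sup>2 \<partial>lborel) \<le> 1" by simp
  have loc: "integrable lborel (\<lambda>s. indicator {a..b} s * g' s)" for a b :: real
  proof (rule Bochner_Integration.integrable_bound)
    show "integrable lborel (\<lambda>s. indicator {a..b} s + (g' s)\<^sup>2)"
      by (intro Bochner_Integration.integrable_add integrable_real_indicator sq) (auto simp: emeasure_lborel_Icc_eq)
    have "\<bar>z\<bar> \<le> 1 + z\<^sup>2" for z :: real
      using zero_le_power2[of "\<bar>z\<bar> - 1 / 2"] by (simp add: power2_diff power_divide)
    then show "AE s in lborel. norm (indicator {a..b} s * g' s) \<le> norm (indicator {a..b} s + (g' s)\<^sup>2)"
      by (auto simp: indicator_def)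
  qed simp
  have gint: "g s = (\<integral>u. indicator {0..s} u * g' u \<partial>lborel)" if "0 \<le> s" for s
    using that by (simp add: gt interval_integral_Icc set_lebesgue_integral_def)
  have incr: "(\<integral>u. indicator {s<..t} u * g' u \<partial>lborel) = g t - g s" if "0 \<le> s" "s \<le> t" for s
  proof -
    have "g t - g s = (\<integral>u. indicator {0..t} u * g' u - indicator {0..s} u * g' u \<partial>lborel)"
      using that t loc by (simp add: gint)
    also have "\<dots> = (\<integral>u. indicator {s<..t} u * g' u \<partial>lborel)"
      using that by (intro Bochner_Integration.integral_cong) (auto simp: indicator_def)
    finally show ?thesis by simp
  qed
  \<comment> \<open>Integrating this kernel over \<open>u\<close> first gives the increments
    \<open>g t - g s\<close>, over \<open>s\<close> first the weight \<open>u * g' u\<close>; its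
    support lies in the triangle \<open>0 <= s < u <= t\<close>.\<close>
  define H where "H = (\<lambda>(s, u). indicator {0..t} s * (indicator {0..t} u * (if s < u then g' u else 0)))"
  have H[measurable]: "H \<in> borel_measurable (lborel \<Otimes>\<^sub>M lborel)" unfolding H_def by measurable
  have Hs: "H (s, u) = indicator {0..t} s * (indicator {s<..t} u * g' u)" for s u
    by (auto simp: H_def indicator_def)
  have locs: "integrable lborel (\<lambda>u. indicator {s<..t} u * g' u)" for s
    by (rule Bochner_Integration.integrable_bound[OF loc[of s t]]) (auto simp: indicator_def)
  have intH: "integrable (lborel \<Otimes>\<^sub>M lborel) H"
  proof (rule lborel_pair.Fubini_integrable[OF H])
    show "AE s in lborel. integrable lborel (\<lambda>u. H (s, u))" using locs by (simp add: Hs)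
    show "integrable lborel (\<lambda>s. \<integral>u. norm (H (s, u)) \<partial>lborel)"
    proof (rule Bochner_Integration.integrable_bound)
      show "integrable lborel (\<lambda>s. indicator {0..t} s * (\<integral>u. \<bar>indicator {0..t} u * g' u\<bar> \<partial>lborel))"
        by (intro integrable_mult_left integrable_real_indicator) (auto simp: emeasure_lborel_Icc_eq)
      have "(\<integral>u. \<bar>H (s, u)\<bar> \<partial>lborel) \<le> indicator {0..t} s * (\<integral>u. \<bar>indicator {0..t} u * g' u\<bar> \<partial>lborel)" for s
      proof (cases "s \<in> {0..t}")
        case True
        then have "(\<integral>u. \<bar>H (s, u)\<bar> \<partial>lborel) \<le> (\<integral>u. \<bar>indicator {0..t} u * g' u\<bar> \<partial>lborel)"
          using locs[of s] loc[of 0 t]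
          by (intro integral_mono) (auto simp: Hs indicator_def)
        with True show ?thesis by simp
      qed (simp add: Hs)
      then show "AE s in lborel. norm (\<integral>u. norm (H (s, u)) \<partial>lborel)
          \<le> norm (indicator {0..t} s * (\<integral>u. \<bar>indicator {0..t} u * g' u\<bar> \<partial>lborel))"
        by (intro AE_I2) (auto intro!: order_trans[OF _ abs_ge_self] simp: abs_of_nonneg integral_nonneg_AE)
    qed (simp add: lborel.borel_measurable_lebesgue_integral)
  qed
  have "(\<integral>s. (\<integral>u. H (s, u) \<partial>lborel) \<partial>lborel) = (\<integral>u. (\<integral>s. H (s, u) \<partial>lborel) \<partial>lborel)"
    using lborel_pair.Fubini_integral[of "\<lambda>s u. H (s, u)"] intH by (simp add: case_prod_beta')
  moreover have "(\<integral>u. H (s, u) \<partial>lborel) = indicator {0..t} s * (g t - g s)" for s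
    using incr[of s] by (auto simp: Hs indicator_def)
  moreover have "(\<integral>s. H (s, u) \<partial>lborel) = indicator {0..t} u * (u * g' u)" for u
  proof (cases "u \<in> {0..t}")
    case True
    then have "H (s, u) = indicator {0..<u} s * g' u" for s by (auto simp: H_def indicator_def)
    with True show ?thesis by simp
  qed (simp add: H_def)
  ultimately have fub: "(\<integral>s. indicator {0..t} s * (g t - g s) \<partial>lborel) = (\<integral>u. indicator {0..t} u * (u * g' u) \<partial>lborel)"
    by simp
  have int1: "integrable lborel (\<lambda>s. indicator {0..t} s * (g t - g s))"
  proof -
    have "integrable lborel (\<lambda>s. \<integral>u. H (s, u) \<partial>lborel)" by (rule lborel_pair.integrable_fst'[OF intH])
    also have "(\<lambda>s. \<integral>u. H (s, u) \<partial>lborel) = (\<lambda>s. indicator {0..t} s * (g t - g s))"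
      using incr by (auto simp: Hs indicator_def)
    finally show ?thesis .
  qed
  have p2: "has_bochner_integral lborel (\<lambda>s. (t\<^sup>2 - s\<^sup>2) * indicator {0..t} s) (2 / 3 * t ^ 3)"
  proof -
    have "has_bochner_integral lborel (\<lambda>s. (t\<^sup>2 - s\<^sup>2) * indicator {0..t} s) ((t\<^sup>2 * t - t ^ 3 / 3) - (t\<^sup>2 * 0 - 0 ^ 3 / 3))"
    proof (rule has_bochner_integral_FTC_Icc_real)
      show "((\<lambda>s. t\<^sup>2 * s - s ^ 3 / 3) has_real_derivative t\<^sup>2 - x\<^sup>2) (at x)" for x
        by (auto intro!: derivative_eq_intros)
    qed (use t in \<open>auto intro!: continuous_intros\<close>)
    moreover have "t\<^sup>2 * t - t ^ 3 / 3 - (t\<^sup>2 * 0 - 0 ^ 3 / 3) = 2 / 3 * t ^ 3"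
      by (simp add: power2_eq_square power3_eq_cube)
    ultimately show ?thesis by simp
  qed
  have p3: "has_bochner_integral lborel (\<lambda>s. (4 * s\<^sup>2) * indicator {0..t} s) (4 / 3 * t ^ 3)"
  proof -
    have "has_bochner_integral lborel (\<lambda>s. (4 * s\<^sup>2) * indicator {0..t} s) (4 / 3 * t ^ 3 - 4 / 3 * 0 ^ 3)"
    proof (rule has_bochner_integral_FTC_Icc_real)
      show "((\<lambda>s. 4 / 3 * s ^ 3) has_real_derivative 4 * x\<^sup>2) (at x)" for x
        by (auto intro!: derivative_eq_intros)
    qed (use t in \<open>auto intro!: continuous_intros\<close>)
    then show ?thesis by simp
  qed
  have "2 / 3 * t ^ 3 = (\<integral>s. (t\<^sup>2 - s\<^sup>2) * indicator {0..t} s \<partial>lborel)"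
    using p2 by (simp add: has_bochner_integral_iff)
  also have "\<dots> \<le> (\<integral>s. indicator {0..t} s * (g t - g s) \<partial>lborel)"
  proof (rule integral_mono)
    show "integrable lborel (\<lambda>s. (t\<^sup>2 - s\<^sup>2) * indicator {0..t} s)"
      using p2 by (simp add: has_bochner_integral_iff)
    show "(t\<^sup>2 - s\<^sup>2) * indicator {0..t} s \<le> indicator {0..t} s * (g t - g s)" for s
      using max[of s] by (auto simp: indicator_def)
  qed (rule int1)
  finally have lower: "2 / 3 * t ^ 3 \<le> (\<integral>u. indicator {0..t} u * (u * g' u) \<partial>lborel)" by (simp add: fub)
  have int2: "integrable lborel (\<lambda>u. indicator {0..t} u * (u * g' u))"
  proof (rule Bochner_Integration.integrable_bound)
    show "integrable lborel (\<lambda>u. t * (indicator {0..t} u * g' u))" using loc by simp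
    show "AE u in lborel. norm (indicator {0..t} u * (u * g' u)) \<le> norm (t * (indicator {0..t} u * g' u))"
      using t by (intro AE_I2) (auto simp: indicator_def abs_mult intro!: mult_right_mono)
  qed simp
  have int3: "integrable lborel (\<lambda>u. indicator {0..t} u * (g' u)\<^sup>2)"
    by (rule Bochner_Integration.integrable_bound[OF sq]) (auto simp: indicator_def)
  \<comment> \<open>Expanding the square gives \<open>0 <= 1 - 4 * (2/3 * t^3) + 4/3 * t^3\<close>,
    which is the claim. Equality here forces \<open>g' u = 2 * u\<close> almost everywhere on
    \<open>{0..t}\<close>, which suggests the extremal function below.\<close>
  have "0 \<le> (\<integral>u. indicator {0..t} u * (g' u - 2 * u)\<^sup>2 \<partial>lborel)" by (intro integral_nonneg_AE) auto
  also have "\<dots> = (\<integral>u. indicator {0..t} u * (g' u)\<^sup>2 - 4 * (indicator {0..t} u * (u * g' u))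
      + (4 * u\<^sup>2) * indicator {0..t} u \<partial>lborel)"
    by (intro Bochner_Integration.integral_cong) (auto simp: indicator_def power2_eq_square algebra_simps)
  also have "\<dots> = (\<integral>u. indicator {0..t} u * (g' u)\<^sup>2 \<partial>lborel)
      - 4 * (\<integral>u. indicator {0..t} u * (u * g' u) \<partial>lborel) + 4 / 3 * t ^ 3"
    using int2 int3 p3 by (simp add: has_bochner_integral_iff)
  also have "(\<integral>u. indicator {0..t} u * (g' u)\<^sup>2 \<partial>lborel) \<le> (\<integral>u. (g' u)\<^sup>2 \<partial>lborel)"
    using int3 sq by (intro integral_mono) (auto simp: indicator_def)
  finally show ?thesis using sq1 lower by linarith
qed

text \<open>The extremal function has derivative \<open>2 * s\<close> up to \<open>T\<close> and 0
  elsewhere: it follows the parabola \<open>s^2\<close> on \<open>{0..T}\<close>, where all points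
  tie, and lies below it elsewhere. The normalisation of \<open>T\<close> makes its energy equal to
  1.\<close>

lemma strassen_argmax_attained:
  assumes T: "0 < T" "4 / 3 * T ^ 3 = 1"
  obtains g where "g \<in> strassen_set" "\<And>s. g s - s\<^sup>2 \<le> g T - T\<^sup>2"
proof -
  define g' :: "real \<Rightarrow> real" where "g' s = 2 * s * indicator {0..T} s" for s
  define g where "g t = (LBINT s=ereal 0..ereal t. g' s)" for t
  have sq: "has_bochner_integral lborel (\<lambda>s. (2 * s) * indicator {0..t} s) (t\<^sup>2)" if "0 \<le> t" for t :: real
  proof -
    have "has_bochner_integral lborel (\<lambda>s. (2 * s) * indicator {0..t} s) (t\<^sup>2 - 0\<^sup>2)"
    proof (rule has_bochner_integral_FTC_Icc_real)
      show "((\<lambda>s. s\<^sup>2) has_real_derivative 2 * x) (at x)" for x :: real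
        by (auto intro!: derivative_eq_intros)
    qed (use that in \<open>auto intro!: continuous_intros\<close>)
    then show ?thesis by simp
  qed
  have [measurable]: "g' \<in> borel_measurable borel" unfolding g'_def by measurable
  have "(\<integral>\<^sup>+s. ennreal ((g' s)\<^sup>2) \<partial>lborel) = (\<integral>\<^sup>+s. ennreal (4 * s\<^sup>2) * indicator {0..T} s \<partial>lborel)"
    by (intro nn_integral_cong) (auto simp: g'_def indicator_def power_mult_distrib)
  also have "\<dots> = ennreal (4 / 3 * T ^ 3 - 4 / 3 * 0 ^ 3)"
    using T by (intro nn_integral_FTC_Icc) (auto intro!: derivative_eq_intros simp: power2_eq_square power3_eq_cube)
  also have "\<dots> = 1" using T by simp
  finally have "g \<in> strassen_set" unfolding strassen_set_def g_def by (auto intro!: bexI[of _ g'])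
  moreover have gT: "g T = T\<^sup>2"
  proof -
    have "g T = (\<integral>s. indicator {0..T} s * g' s \<partial>lborel)"
      using T by (simp add: g_def interval_integral_Icc set_lebesgue_integral_def)
    also have "\<dots> = (\<integral>s. (2 * s) * indicator {0..T} s \<partial>lborel)"
      by (intro Bochner_Integration.integral_cong) (auto simp: g'_def indicator_def)
    also have "\<dots> = T\<^sup>2" using sq[of T] T by (simp add: has_bochner_integral_iff)
    finally show ?thesis .
  qed
  moreover have "g s \<le> s\<^sup>2" for s
  proof (cases "0 \<le> s")
    case True
    then have "g s = (\<integral>u. indicator {0..s} u * g' u \<partial>lborel)"
      by (simp add: g_def interval_integral_Icc set_lebesgue_integral_def)
    also have "\<dots> \<le> (\<integral>u. (2 * u) * indicator {0..s} u \<partial>lborel)"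
    proof (rule integral_mono)
      show i: "integrable lborel (\<lambda>u. 2 * u * indicator {0..s} u)"
        using sq[OF True] by (simp add: has_bochner_integral_iff)
      show "integrable lborel (\<lambda>u. indicator {0..s} u * g' u)"
        by (rule Bochner_Integration.integrable_bound[OF i]) (auto simp: g'_def indicator_def)
    qed (auto simp: g'_def indicator_def)
    also have "\<dots> = s\<^sup>2" using sq[OF True] by (simp add: has_bochner_integral_iff)
    finally show ?thesis .
  next
    case False
    have "g s = - (LBINT u=ereal s..ereal 0. g' u)" unfolding g_def by (rule interval_integral_endpoints_reverse)
    also have "(LBINT u=ereal s..ereal 0. g' u) = (\<integral>u. indicator {s..0} u * g' u \<partial>lborel)"
      using False by (simp add: interval_integral_Icc set_lebesgue_integral_def)
    also have "(\<lambda>u. indicator {s..0} u * g' u) = (\<lambda>u. 0)"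
      by (auto simp: g'_def indicator_def)
    finally show ?thesis by simp
  qed
  ultimately show ?thesis by (intro that[of g]) auto
qed

lemma sup_argmax_eq: "sup_argmax = ereal ((3/4) powr (1/3))"
proof -
  define T :: real where "T = (3/4) powr (1/3)"
  have T0: "0 < T" by (simp add: T_def)
  have "T ^ 3 = T powr 3" using T0 by (simp add: powr_numeral)
  also have "\<dots> = 3/4" by (simp add: T_def powr_powr)
  finally have T3: "T ^ 3 = 3/4" .
  have "ereal t \<le> ereal T" if g: "g \<in> strassen_set" "is_arg_max (\<lambda>s. g s - s\<^sup>2) (\<lambda>_. True) t" for g t
  proof (cases "0 < t")
    case True
    have "g s - s\<^sup>2 \<le> g t - t\<^sup>2" for s using g(2) by (auto simp: is_arg_max_def not_less)
    from strassen_argmax_le[OF g(1) this True] have "t ^ 3 \<le> T ^ 3" using T3 by simp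
    then show ?thesis using T0 True by (simp add: power_mono_iff)
  qed (use T0 in auto)
  moreover obtain g where "g \<in> strassen_set" "\<And>s. g s - s\<^sup>2 \<le> g T - T\<^sup>2"
    using strassen_argmax_attained[OF T0] T3 by auto
  then have "\<exists>g. g \<in> strassen_set \<and> is_arg_max (\<lambda>s. g s - s\<^sup>2) (\<lambda>_. True) T"
    by (auto simp: is_arg_max_def not_less)
  ultimately show ?thesis unfolding sup_argmax_def T_def[symmetric]
    by (intro antisym Sup_least Sup_upper) auto
qed

section \<open>Two-sided oscillation\<close>

lemma power_of_two_below:
  fixes c :: real
  assumes "1 \<le> c"
  obtains J :: nat where "2 ^ J \<le> c" "c \<le> 2 * 2 ^ J"
proof (cases "c = 1")
  case True then show ?thesis by (intro that[of 0]) auto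
next
  case False
  with assms have "1 < c" by simp
  then obtain R :: nat where R: "c \<le> 2 ^ R" "2 ^ R \<le> 2 * c" by (rule power_of_two_between)
  have "R \<noteq> 0" using R \<open>1 < c\<close> by (intro notI) auto
  then obtain J where "R = Suc J" by (cases R) auto
  with R show ?thesis by (intro that[of J]) auto
qed

context real_distribution
begin

text \<open>The one-sided bound is applied from the left end point with half the threshold over
  twice the length, and the centre is compared with that end point too. This changes 512 into
  \<open>512 * 2 * 4 = 4096\<close>.\<close>

lemma oscillation_two_sided:
  assumes K: "cdf_lipschitz K (c - l) (c + l)"
    and l: "0 < l" and y: "0 < y" "y \<le> 4 * (real N * (K * l))" "65536 * (real N * (K * l)) \<le> y\<^sup>2"
  obtains A where "A \<in> sets (sample {..<N})"
    and "measure (sample {..<N}) A \<le> 4 * exp (- y\<^sup>2 / (4096 * (real N * (K * l))))"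
    and "\<forall>x\<in>space (sample {..<N}) - A. \<forall>n\<le>N. \<forall>t. \<bar>t - c\<bar> \<le> l \<longrightarrow> \<bar>dev x n t - dev x n c\<bar> \<le> y"
proof -
  have K': "cdf_lipschitz K (c - l) (c - l + 2 * l)"
    by (rule cdf_lipschitz_subset[OF K]) auto
  have y': "0 < 2 * l" "0 < y / 2" "y / 2 \<le> real N * (K * (2 * l))"
    "8192 * (real N * (K * (2 * l))) \<le> (y / 2)\<^sup>2" using l y by (auto simp: power_divide)
  obtain A where A: "A \<in> sets (sample {..<N})"
    "measure (sample {..<N}) A \<le> 4 * exp (- (y / 2)\<^sup>2 / (512 * (real N * (K * (2 * l)))))"
    "\<forall>x\<in>space (sample {..<N}) - A. \<forall>n\<le>N. \<forall>t. c - l \<le> t \<longrightarrow> t \<le> c - l + 2 * l \<longrightarrow>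
          \<bar>dev x n t - dev x n (c - l)\<bar> \<le> y / 2"
    by (rule oscillation[OF K' y']) (rule that)
  show ?thesis
  proof (rule that[OF A(1)])
    show "measure (sample {..<N}) A \<le> 4 * exp (- y\<^sup>2 / (4096 * (real N * (K * l))))"
      using A(2) by (simp add: power_divide)
    show "\<forall>x\<in>space (sample {..<N}) - A. \<forall>n\<le>N. \<forall>t. \<bar>t - c\<bar> \<le> l \<longrightarrow> \<bar>dev x n t - dev x n c\<bar> \<le> y"
    proof (intro ballI allI impI)
    fix x n t assume x: "x \<in> space (sample {..<N}) - A" "n \<le> N" and t: "\<bar>t - c\<bar> \<le> l"
    have "\<bar>dev x n t - dev x n (c - l)\<bar> \<le> y / 2" using A(3) x t by auto
    moreover have "\<bar>dev x n c - dev x n (c - l)\<bar> \<le> y / 2" using A(3) x l by auto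
    ultimately show "\<bar>dev x n t - dev x n c\<bar> \<le> y" by linarith
    qed
  qed
qed

text \<open>On the ball of radius \<open>r j = 2 ^ j * l\<close> the threshold is
  \<open>z * N * (r j)^2\<close>, a parabola to be compared with the quadratic drift of the
  distribution function. The exponent is then proportional to \<open>N * (r j)^3\<close> and grows
  by the factor 8 per shell, so the innermost shell decides. The ratio 2 of the radii costs the
  factor 4 in the conclusion.\<close>

lemma oscillation_peeling:
  assumes K: "cdf_lipschitz K (c - L) (c + L)"
    and l: "0 < l" "l \<le> L" and K0: "0 < K" and z: "0 < z" "z * L \<le> 4 * K"
    and a: "a = z\<^sup>2 * (real N * l ^ 3) / (4096 * K)" "16 \<le> a"
  obtains A where "A \<in> sets (sample {..<N})"
    and "measure (sample {..<N}) A \<le> 8 * exp (- a)"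
    and "\<forall>x\<in>space (sample {..<N}) - A. \<forall>n\<le>N. \<forall>t. \<bar>t - c\<bar> \<le> L / 2 \<longrightarrow>
          \<bar>dev x n t - dev x n c\<bar> \<le> 4 * (z * real N) * (max l \<bar>t - c\<bar>)\<^sup>2"
proof -
  have N: "0 < N" using a z K0 by (intro gr0I) auto
  have "1 \<le> L / l" using l by simp
  then obtain J :: nat where J: "2 ^ J \<le> L / l" "L / l \<le> 2 * 2 ^ J" by (rule power_of_two_below)
  define r where "r j = 2 ^ j * l" for j :: nat
  have r0: "0 < r j" for j using l by (simp add: r_def)
  have rL: "r j \<le> L" if "j \<le> J" for j
  proof -
    have "(2::real) ^ j \<le> 2 ^ J" using that by (intro power_increasing) auto
    then have "2 ^ j \<le> L / l" using J(1) by linarith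
    then show ?thesis using l by (simp add: r_def field_simps)
  qed
  define y where "y j = z * (real N * (r j)\<^sup>2)" for j
  have "\<exists>A. A \<in> sets (sample {..<N})
    \<and> measure (sample {..<N}) A \<le> 4 * exp (- a) * (1/2) ^ j
    \<and> (\<forall>x\<in>space (sample {..<N}) - A. \<forall>n\<le>N. \<forall>t. \<bar>t - c\<bar> \<le> r j \<longrightarrow>
          \<bar>dev x n t - dev x n c\<bar> \<le> y j)" if j: "j \<le> J" for j
  proof -
    have ya: "(y j)\<^sup>2 / (4096 * (real N * (K * r j))) = a * 8 ^ j"
    proof -
      have "(y j)\<^sup>2 / (4096 * (real N * (K * r j))) = z\<^sup>2 * (real N * (r j) ^ 3) / (4096 * K)"
        using r0[of j] N K0 by (simp add: y_def field_simps power2_eq_square power3_eq_cube)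
      also have "(r j) ^ 3 = l ^ 3 * 8 ^ j" 
      proof -
        have "((2::real) ^ j) ^ 3 = (2 ^ 3) ^ j" by (simp only: power_mult[symmetric] mult.commute)
        then show ?thesis by (simp add: r_def power_mult_distrib)
      qed
      finally show ?thesis by (simp add: a)
    qed
    have "1 * 16 \<le> 8 ^ j * a" using a by (intro mult_mono) auto
    then have a16: "16 \<le> (y j)\<^sup>2 / (4096 * (real N * (K * r j)))" unfolding ya by (simp only: mult_1 mult.commute)
    have pos: "0 < real N * (K * r j)" using r0 N K0 by simp
    have K': "cdf_lipschitz K (c - r j) (c + r j)"
      using rL[OF j] by (intro cdf_lipschitz_subset[OF K]) auto
    have y1: "0 < y j" using r0[of j] N z by (simp add: y_def)
    \<comment> \<open>The hypothesis on \<open>z * L\<close> keeps every shell within the Gaussian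
      regime of the oscillation bound.\<close>
    have "z * r j \<le> 4 * K" using rL[OF j] z by (smt (verit) mult_left_mono)
    then have "(z * r j) * (real N * r j) \<le> (4 * K) * (real N * r j)" using r0[of j] by (intro mult_right_mono) auto
    then have y2: "y j \<le> 4 * (real N * (K * r j))" by (simp add: y_def power2_eq_square mult_ac)
    have y3: "65536 * (real N * (K * r j)) \<le> (y j)\<^sup>2" using a16 pos by (simp add: field_simps)
    obtain A where A: "A \<in> sets (sample {..<N})"
      "measure (sample {..<N}) A \<le> 4 * exp (- (y j)\<^sup>2 / (4096 * (real N * (K * r j))))"
      "\<forall>x\<in>space (sample {..<N}) - A. \<forall>n\<le>N. \<forall>t. \<bar>t - c\<bar> \<le> r j \<longrightarrow> \<bar>dev x n t - dev x n c\<bar> \<le> y j"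
      by (rule oscillation_two_sided[OF K' r0 y1 y2 y3]) (rule that)
    have "exp (- (y j)\<^sup>2 / (4096 * (real N * (K * r j)))) = exp (- (a * 8 ^ j))"
      by (simp add: ya[symmetric])
    also have "\<dots> \<le> exp (- a + - real j)"
    proof -
      have "1 + real j * 7 \<le> (1 + 7) ^ j" by (rule Bernoulli_inequality) auto
      then have "1 + real j \<le> 8 ^ j" by simp
      then have "a * (1 + real j) \<le> a * 8 ^ j" using a by (intro mult_left_mono) auto
      moreover have "1 * real j \<le> a * real j" using a by (intro mult_right_mono) auto
      moreover have "a * (1 + real j) = a + a * real j" by (simp add: algebra_simps)
      ultimately have "a + real j \<le> a * 8 ^ j" by linarith
      then show ?thesis by simp
    qed
    also have "\<dots> = exp (- a) * exp (- 1) ^ j"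
      by (simp add: exp_diff exp_minus exp_of_nat_mult[symmetric] field_simps)
    also have "\<dots> \<le> exp (- a) * (1/2) ^ j"
    proof -
      have "2 \<le> exp (1::real)" using exp_ge_add_one_self[of 1] by simp
      then have "exp (- 1) \<le> (1/2::real)" by (simp add: exp_minus field_simps)
      then show ?thesis by (intro mult_left_mono power_mono) auto
    qed
    finally have "measure (sample {..<N}) A \<le> 4 * exp (- a) * (1/2) ^ j" using A(2) by linarith
    with A show ?thesis by blast
  qed
  then obtain A where A: "\<And>j. j \<le> J \<Longrightarrow> A j \<in> sets (sample {..<N})"
    "\<And>j. j \<le> J \<Longrightarrow> measure (sample {..<N}) (A j) \<le> 4 * exp (- a) * (1/2) ^ j"
    "\<And>j x n t. j \<le> J \<Longrightarrow> x \<in> space (sample {..<N}) - A j \<Longrightarrow> n \<le> N \<Longrightarrow> \<bar>t - c\<bar> \<le> r j \<Longrightarrow>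
          \<bar>dev x n t - dev x n c\<bar> \<le> y j"
    by metis
  show ?thesis
  proof (rule that[of "\<Union>j\<in>{..J}. A j"])
    show "(\<Union>j\<in>{..J}. A j) \<in> sets (sample {..<N})" using A(1) by auto
    have "measure (sample {..<N}) (\<Union>j\<in>{..J}. A j) \<le> (\<Sum>j\<in>{..J}. measure (sample {..<N}) (A j))"
      using A(1) by (intro measure_UNION_le) auto
    also have "\<dots> \<le> (\<Sum>j\<in>{..J}. 4 * exp (- a) * (1/2) ^ j)" using A(2) by (intro sum_mono) auto
    also have "\<dots> = 4 * exp (- a) * (\<Sum>j\<in>{..J}. (1/2) ^ j)" by (simp add: sum_distrib_left)
    also have "\<dots> \<le> 4 * exp (- a) * 2" by (intro mult_left_mono sum_halves_le) auto
    finally show "measure (sample {..<N}) (\<Union>j\<in>{..J}. A j) \<le> 8 * exp (- a)" by simp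
  next
    show "\<forall>x\<in>space (sample {..<N}) - (\<Union>j\<in>{..J}. A j). \<forall>n\<le>N. \<forall>t. \<bar>t - c\<bar> \<le> L / 2 \<longrightarrow>
          \<bar>dev x n t - dev x n c\<bar> \<le> 4 * (z * real N) * (max l \<bar>t - c\<bar>)\<^sup>2"
    proof (intro ballI allI impI)
    fix x n t assume x: "x \<in> space (sample {..<N}) - (\<Union>j\<in>{..J}. A j)" "n \<le> N" and t: "\<bar>t - c\<bar> \<le> L / 2"
    have "\<bar>t - c\<bar> \<le> r J" using J(2) t l by (simp add: r_def field_simps)
    define j where "j = (LEAST j. \<bar>t - c\<bar> \<le> r j)"
    have j: "\<bar>t - c\<bar> \<le> r j" "j \<le> J" unfolding j_def
      using \<open>\<bar>t - c\<bar> \<le> r J\<close> by (rule LeastI, rule Least_le)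
    define m where "m = max l \<bar>t - c\<bar>"
    have m: "l \<le> m" "\<bar>t - c\<bar> \<le> m" by (simp_all only: m_def max.cobounded1 max.cobounded2)
    have "r j \<le> 2 * m"
    proof (cases j)
      case 0
      then have "r j = l" by (simp add: r_def)
      then show ?thesis using l m by linarith
    next
      case (Suc i)
      then have "\<not> \<bar>t - c\<bar> \<le> r i" using not_less_Least[of i "\<lambda>j. \<bar>t - c\<bar> \<le> r j"] j_def by auto
      moreover have "r j = 2 * r i" by (simp add: Suc r_def)
      ultimately show ?thesis using m by linarith
    qed
    then have "(r j)\<^sup>2 \<le> (2 * m)\<^sup>2" using r0[of j] by (intro power_mono) auto
    then have "y j \<le> z * (real N * (2 * m)\<^sup>2)"
      unfolding y_def using z by (intro mult_left_mono) auto
    moreover have "\<bar>dev x n t - dev x n c\<bar> \<le> y j" using A(3) x j by auto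
    ultimately show "\<bar>dev x n t - dev x n c\<bar> \<le> 4 * (z * real N) * (max l \<bar>t - c\<bar>)\<^sup>2"
      unfolding m_def[symmetric] by (simp add: power_mult_distrib mult_ac)
    qed
  qed
qed

end

section \<open>Local behaviour of a decreasing density\<close>

text \<open>As a sum over observations the count splits directly over blocks of indices, see
  \<open>cnt_add\<close>; the lower bound treats old and new observations separately.\<close>

definition cnt :: "(nat \<Rightarrow> real) \<Rightarrow> nat \<Rightarrow> real \<Rightarrow> real" where
  "cnt x n t = (\<Sum>i<n. indicator {..t} (x i))"

lemma emp_cdf_eq_cnt: "emp_cdf x n t = cnt x n t / real n"
proof -
  have "cnt x n t = (\<Sum>i\<in>{i\<in>{..<n}. x i \<le> t}. 1)"
    unfolding cnt_def by (intro sum.mono_neutral_cong_right) (auto simp: indicator_def)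
  then show ?thesis by (simp add: emp_cdf_def Collect_conj_eq lessThan_def)
qed

lemma cnt_diff_iff:
  assumes "0 < n"
  shows "real n * a * (t - s) \<le> cnt x n t - cnt x n s \<longleftrightarrow> emp_cdf x n s - a * s \<le> emp_cdf x n t - a * t"
proof -
  have "real n * a * (t - s) \<le> cnt x n t - cnt x n s
      \<longleftrightarrow> real n * (a * (t - s)) \<le> real n * (emp_cdf x n t - emp_cdf x n s)"
    using assms by (simp add: emp_cdf_eq_cnt right_diff_distrib mult.assoc)
  also have "\<dots> \<longleftrightarrow> a * (t - s) \<le> emp_cdf x n t - emp_cdf x n s"
    using assms by (intro mult_le_cancel_left_pos) auto
  finally show ?thesis by (auto simp: algebra_simps)
qed

lemma cnt_le: "cnt x n t \<le> real n"
proof -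
  have "cnt x n t \<le> (\<Sum>i<n. 1)" unfolding cnt_def by (intro sum_mono) (auto simp: indicator_def)
  then show ?thesis by simp
qed

lemma cnt_nonneg: "0 \<le> cnt x n t"
  unfolding cnt_def by (intro sum_nonneg) auto

lemma cnt_mono: "s \<le> t \<Longrightarrow> cnt x n s \<le> cnt x n t"
  unfolding cnt_def by (intro sum_mono) (auto simp: indicator_def)

lemma cnt_diff: "s \<le> t \<Longrightarrow> cnt x n t - cnt x n s = (\<Sum>i<n. indicator {s<..t} (x i))"
  unfolding cnt_def sum_subtractf[symmetric] by (intro sum.cong) (auto simp: indicator_def)

lemma grenander_ge_cnt:
  assumes "0 < t0" "t0 \<le> t" "0 < n"
    and "\<And>s. 0 \<le> s \<Longrightarrow> s < t0 \<Longrightarrow> real n * a * (t - s) \<le> cnt x n t - cnt x n s"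
  shows "a \<le> grenander x n t0"
proof (rule grenander_ge[OF assms(1,2)])
  fix s assume "0 \<le> s" "s < t0"
  from assms(4)[OF this] show "emp_cdf x n s - a * s \<le> emp_cdf x n t - a * t"
    using cnt_diff_iff[OF assms(3)] by simp
qed

lemma grenander_gt_cnt:
  assumes "0 < t0" "0 \<le> a" "a < grenander x n t0" "0 < n"
  obtains t where "t0 \<le> t"
    and "\<forall>s. 0 \<le> s \<longrightarrow> s < t0 \<longrightarrow> real n * a * (t - s) \<le> cnt x n t - cnt x n s"
proof -
  obtain t where t: "t0 \<le> t" "\<And>s. 0 \<le> s \<Longrightarrow> s < t0 \<Longrightarrow> emp_cdf x n s - a * s < emp_cdf x n t - a * t"
    by (rule grenander_gt_witness[OF assms(1-3)]) blast
  show ?thesis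
  proof (rule that[OF t(1)], intro allI impI)
    fix s assume "0 \<le> s" "s < t0"
    from t(2)[OF this] show "real n * a * (t - s) \<le> cnt x n t - cnt x n s"
      using cnt_diff_iff[OF assms(4)] by (simp add: less_imp_le)
  qed
qed

section \<open>A decreasing density with negative slope at \<open>t0\<close>\<close>

locale decreasing_density =
  fixes f :: "real \<Rightarrow> real" and t0 f0 D :: real
  assumes meas[measurable]: "f \<in> borel_measurable borel"
    and nonneg: "\<And>x. 0 \<le> f x"
    and total: "(\<integral>\<^sup>+x. ennreal (f x) \<partial>lborel) = 1"
    and anti: "antimono_on {0<..} f"
    and t0: "0 < t0"
    and f0: "f0 = f t0" "0 < f0"
    and D: "0 < D" "(f has_real_derivative - D) (at t0)"
begin

abbreviation \<mu> :: "real measure" where "\<mu> \<equiv> density lborel (\<lambda>x. ennreal (f x))"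

sublocale real_distribution \<mu>
proof (rule real_distribution.intro)
  show "prob_space \<mu>" by (rule prob_spaceI) (use total in \<open>simp add: emeasure_density\<close>)
  show "real_distribution_axioms \<mu>" by (rule real_distribution_axioms.intro) simp
qed

lemma antiD: "0 < s \<Longrightarrow> s \<le> t \<Longrightarrow> f t \<le> f s"
  using monotone_onD[OF anti, of s t] by simp

lemma integrable_f: "integrable lborel f"
proof (rule integrableI_nonneg)
  show "(\<integral>\<^sup>+x. ennreal (f x) \<partial>lborel) < \<infinity>" unfolding total by simp
qed (simp_all add: nonneg)

lemma integrable_bounded_mult:
  assumes [measurable]: "g \<in> borel_measurable borel" and "\<And>u. \<bar>g u\<bar> \<le> b"
  shows "integrable lborel (\<lambda>u. g u * f u)"
proof (rule Bochner_Integration.integrable_bound)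
  show "integrable lborel (\<lambda>u. b * f u)" using integrable_f by simp
  show "AE u in lborel. norm (g u * f u) \<le> norm (b * f u)"
  proof (rule AE_I2)
    fix u
    have "\<bar>g u\<bar> \<le> \<bar>b\<bar>" using assms(2)[of u] by linarith
    then show "norm (g u * f u) \<le> norm (b * f u)" using nonneg[of u] by (simp add: abs_mult mult_right_mono)
  qed
qed simp

lemma expectation_eq:
  assumes [measurable]: "g \<in> borel_measurable borel"
  shows "(\<integral>x. g x \<partial>\<mu>) = (\<integral>u. g u * f u \<partial>lborel)"
proof -
  have "(\<integral>x. g x \<partial>\<mu>) = (\<integral>u. f u *\<^sub>R g u \<partial>lborel)"
    by (rule integral_density) (simp_all add: nonneg)
  then show ?thesis by (simp only: real_scaleR_def mult.commute)
qed

lemma cdf_diff: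
  assumes "s \<le> t"
  shows "cdf \<mu> t - cdf \<mu> s = (\<integral>u. indicator {s<..t} u * f u \<partial>lborel)"
proof -
  have "cdf \<mu> t - cdf \<mu> s = measure \<mu> {s<..t}"
    using assms by (cases "s = t") (auto simp: cdf_diff_eq)
  also have "\<dots> = (\<integral>x. indicator {s<..t} x \<partial>\<mu>)" by simp
  also have "\<dots> = (\<integral>u. indicator {s<..t} u * f u \<partial>lborel)" by (rule expectation_eq) simp
  finally show ?thesis .
qed

lemma integral_primitive_Ioc:
  fixes p P :: "real \<Rightarrow> real"
  assumes "a \<le> b" and "\<And>u. (P has_real_derivative p u) (at u)" and "continuous_on UNIV p"
  shows "integrable lborel (\<lambda>u. indicator {a<..b} u * p u)"
    and "(\<integral>u. indicator {a<..b} u * p u \<partial>lborel) = P b - P a"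
proof -
  have "has_bochner_integral lborel (\<lambda>u. p u * indicator {a..b} u) (P b - P a)"
  proof (rule has_bochner_integral_FTC_Icc_real[OF assms(1)])
    show "(P has_real_derivative p x) (at x)" for x by (rule assms(2))
    show "isCont p x" for x using assms(3) by (simp add: continuous_on_eq_continuous_at)
  qed
  then have *: "has_bochner_integral lborel (\<lambda>u. indicator {a..b} u * p u) (P b - P a)"
    by (simp add: mult.commute)
  have [measurable]: "p \<in> borel_measurable borel" using assms(3) by (rule borel_measurable_continuous_onI)
  have ae: "AE u in lborel. indicator {a..b} u * p u = indicator {a<..b} u * p u"
    by (rule AE_I[where N = "{a}"]) (auto simp: indicator_def)
  have "has_bochner_integral lborel (\<lambda>u. indicator {a<..b} u * p u) (P b - P a)"
    using * by (rule has_bochner_integralI_AE) (use ae in auto)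
  then show "integrable lborel (\<lambda>u. indicator {a<..b} u * p u)"
    and "(\<integral>u. indicator {a<..b} u * p u \<partial>lborel) = P b - P a"
    by (simp_all add: has_bochner_integral_iff)
qed

text \<open>With its counterpart below this reduces estimates of integrals against \<open>f\<close>
  to a polynomial bound for the integrand whose primitive is written down, so that only differences
  of polynomials remain.\<close>

lemma integral_le_primitive:
  fixes p P :: "real \<Rightarrow> real"
  assumes "a \<le> b" and P: "\<And>u. (P has_real_derivative p u) (at u)" "continuous_on UNIV p"
    and g: "integrable lborel (\<lambda>u. indicator {a<..b} u * g u)"
    and le: "\<And>u. a < u \<Longrightarrow> u \<le> b \<Longrightarrow> g u \<le> p u"
  shows "(\<integral>u. indicator {a<..b} u * g u \<partial>lborel) \<le> P b - P a"
proof -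
  have "(\<integral>u. indicator {a<..b} u * g u \<partial>lborel) \<le> (\<integral>u. indicator {a<..b} u * p u \<partial>lborel)" 
    by (rule integral_mono[OF g integral_primitive_Ioc(1)[OF assms(1) P]]) (auto simp: indicator_def le)
  then show ?thesis by (simp only: integral_primitive_Ioc(2)[OF assms(1) P])
qed

lemma integral_ge_primitive:
  fixes p P :: "real \<Rightarrow> real"
  assumes "a \<le> b" and P: "\<And>u. (P has_real_derivative p u) (at u)" "continuous_on UNIV p"
    and g: "integrable lborel (\<lambda>u. indicator {a<..b} u * g u)"
    and le: "\<And>u. a < u \<Longrightarrow> u \<le> b \<Longrightarrow> p u \<le> g u"
  shows "P b - P a \<le> (\<integral>u. indicator {a<..b} u * g u \<partial>lborel)"
proof -
  have "(\<integral>u. indicator {a<..b} u * p u \<partial>lborel) \<le> (\<integral>u. indicator {a<..b} u * g u \<partial>lborel)" 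
    by (rule integral_mono[OF integral_primitive_Ioc(1)[OF assms(1) P] g]) (auto simp: indicator_def le)
  then show ?thesis by (simp only: integral_primitive_Ioc(2)[OF assms(1) P])
qed

lemma integrable_indicator_f: "integrable lborel (\<lambda>u. indicator {a<..b} u * f u)"
proof (rule integrable_bounded_mult)
  show "\<bar>indicator {a<..b} u\<bar> \<le> (1::real)" for u by (simp add: indicator_def)
qed simp

lemma cdf_diff_le:
  assumes "s \<le> t" "\<And>u. s < u \<Longrightarrow> u \<le> t \<Longrightarrow> f u \<le> K"
  shows "cdf \<mu> t - cdf \<mu> s \<le> K * (t - s)"
proof -
  have "cdf \<mu> t - cdf \<mu> s \<le> K * t - K * s" unfolding cdf_diff[OF assms(1)]
  proof (rule integral_le_primitive[where p = "\<lambda>_. K" and P = "\<lambda>u. K * u", OF assms(1) _ _ integrable_indicator_f assms(2)])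
    show "((*) K has_real_derivative K) (at u)" for u by (auto intro!: derivative_eq_intros)
  qed auto
  then show ?thesis by (simp add: algebra_simps)
qed

lemma cdf_diff_ge:
  assumes "s \<le> t" "\<And>u. s < u \<Longrightarrow> u \<le> t \<Longrightarrow> K \<le> f u"
  shows "K * (t - s) \<le> cdf \<mu> t - cdf \<mu> s"
proof -
  have "K * t - K * s \<le> cdf \<mu> t - cdf \<mu> s" unfolding cdf_diff[OF assms(1)]
  proof (rule integral_ge_primitive[where p = "\<lambda>_. K" and P = "\<lambda>u. K * u", OF assms(1) _ _ integrable_indicator_f assms(2)])
    show "((*) K has_real_derivative K) (at u)" for u by (auto intro!: derivative_eq_intros)
  qed auto
  then show ?thesis by (simp add: algebra_simps)
qed

lemma cdf_lipschitzI: "0 < a \<Longrightarrow> f a \<le> K \<Longrightarrow> cdf_lipschitz K a b"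
  unfolding cdf_lipschitz_def
proof (intro allI impI)
  fix s t assume *: "0 < a" "f a \<le> K" "a \<le> s" "s \<le> t" "t \<le> b"
  show "cdf \<mu> t - cdf \<mu> s \<le> K * (t - s)"
  proof (rule cdf_diff_le[OF *(4)])
    fix u assume "s < u"
    then have "f u \<le> f a" using * by (intro antiD) auto
    then show "f u \<le> K" using * by linarith
  qed
qed

text \<open>Differentiability at \<open>t0\<close>, with the error measured in units of
  \<open>D * \<bar>h\<bar>\<close> so that it acts as a change of the slope \<open>D\<close> to
  \<open>(1 - \<kappa>) * D\<close> or \<open>(1 + \<kappa>) * D\<close>. The bound
  \<open>\<eta> <= t0 / 2\<close> keeps the window inside the half-line on which \<open>f\<close> is
  monotone.\<close>

definition expands :: "real \<Rightarrow> real \<Rightarrow> bool" where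
  "expands \<kappa> \<eta> \<longleftrightarrow> 0 < \<eta> \<and> \<eta> \<le> t0 / 2 \<and> (\<forall>h. \<bar>h\<bar> \<le> \<eta> \<longrightarrow> \<bar>f (t0 + h) - (f0 - D * h)\<bar> \<le> \<kappa> * D * \<bar>h\<bar>)"

lemma ex_expands:
  assumes "0 < \<kappa>"
  obtains \<eta> where "expands \<kappa> \<eta>"
proof -
  have "(\<lambda>h. (f (t0 + h) - f t0) / h) \<midarrow>0\<rightarrow> - D" using D(2) by (simp add: DERIV_def)
  from LIM_D[OF this, of "\<kappa> * D"] obtain s where s: "0 < s"
    "\<And>h. h \<noteq> 0 \<Longrightarrow> \<bar>h\<bar> < s \<Longrightarrow> \<bar>(f (t0 + h) - f t0) / h - - D\<bar> < \<kappa> * D"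
    using D assms by auto
  define \<eta> where "\<eta> = min (s / 2) (t0 / 2)"
  have "\<bar>f (t0 + h) - (f0 - D * h)\<bar> \<le> \<kappa> * D * \<bar>h\<bar>" if "\<bar>h\<bar> \<le> \<eta>" for h
  proof (cases "h = 0")
    case False
    have "f (t0 + h) - (f0 - D * h) = ((f (t0 + h) - f t0) / h - - D) * h"
      using False f0 by (simp add: field_simps)
    then have "\<bar>f (t0 + h) - (f0 - D * h)\<bar> = \<bar>(f (t0 + h) - f t0) / h - - D\<bar> * \<bar>h\<bar>"
      by (simp add: abs_mult)
    also have "\<dots> \<le> (\<kappa> * D) * \<bar>h\<bar>"
      using that s False by (intro mult_right_mono less_imp_le[OF s(2)]) (auto simp: \<eta>_def)
    finally show ?thesis .
  qed (use f0 in auto)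
  with s(1) t0 show ?thesis by (intro that[of \<eta>]) (auto simp: expands_def \<eta>_def)
qed

lemma expandsD:
  assumes "expands \<kappa> \<eta>" "\<bar>h\<bar> \<le> \<eta>"
  shows "f (t0 + h) \<le> f0 - D * h + \<kappa> * D * \<bar>h\<bar>" "f0 - D * h - \<kappa> * D * \<bar>h\<bar> \<le> f (t0 + h)"
proof -
  have "\<bar>f (t0 + h) - (f0 - D * h)\<bar> \<le> \<kappa> * D * \<bar>h\<bar>" using assms unfolding expands_def by blast
  then show "f (t0 + h) \<le> f0 - D * h + \<kappa> * D * \<bar>h\<bar>" "f0 - D * h - \<kappa> * D * \<bar>h\<bar> \<le> f (t0 + h)"
    by linarith+
qed

lemma cdf_right:
  assumes "expands \<kappa> \<eta>" "0 \<le> h" "h \<le> \<eta>"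
  shows "cdf \<mu> (t0 + h) - cdf \<mu> t0 \<le> f0 * h - (1 - \<kappa>) * D * h\<^sup>2 / 2"
    and "f0 * h - (1 + \<kappa>) * D * h\<^sup>2 / 2 \<le> cdf \<mu> (t0 + h) - cdf \<mu> t0"
proof -
  define P where "P k u = f0 * (u - t0) - k * D * (u - t0)\<^sup>2 / 2" for k u :: real
  have P: "(P k has_real_derivative f0 - k * D * (u - t0)) (at u)" for k u
    unfolding P_def by (auto intro!: derivative_eq_intros)
  have "cdf \<mu> (t0 + h) - cdf \<mu> t0 \<le> P (1 - \<kappa>) (t0 + h) - P (1 - \<kappa>) t0"
    unfolding cdf_diff[of t0 "t0 + h", OF add_increasing2[OF assms(2) order_refl]]
  proof (rule integral_le_primitive[OF _ P _ integrable_indicator_f])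
    fix u assume "t0 < u" "u \<le> t0 + h"
    then show "f u \<le> f0 - (1 - \<kappa>) * D * (u - t0)"
      using expandsD(1)[OF assms(1), of "u - t0"] assms(3) by (simp add: algebra_simps)
  qed (use assms in \<open>simp, intro continuous_intros\<close>)
  then show "cdf \<mu> (t0 + h) - cdf \<mu> t0 \<le> f0 * h - (1 - \<kappa>) * D * h\<^sup>2 / 2" by (simp add: P_def)
  have "P (1 + \<kappa>) (t0 + h) - P (1 + \<kappa>) t0 \<le> cdf \<mu> (t0 + h) - cdf \<mu> t0"
    unfolding cdf_diff[of t0 "t0 + h", OF add_increasing2[OF assms(2) order_refl]]
  proof (rule integral_ge_primitive[OF _ P _ integrable_indicator_f])
    fix u assume "t0 < u" "u \<le> t0 + h"
    then show "f0 - (1 + \<kappa>) * D * (u - t0) \<le> f u"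
      using expandsD(2)[OF assms(1), of "u - t0"] assms(3) by (simp add: algebra_simps)
  qed (use assms in \<open>simp, intro continuous_intros\<close>)
  then show "f0 * h - (1 + \<kappa>) * D * h\<^sup>2 / 2 \<le> cdf \<mu> (t0 + h) - cdf \<mu> t0" by (simp add: P_def)
qed

lemma cdf_left:
  assumes "expands \<kappa> \<eta>" "0 \<le> h" "h \<le> \<eta>"
  shows "cdf \<mu> t0 - cdf \<mu> (t0 - h) \<le> f0 * h + (1 + \<kappa>) * D * h\<^sup>2 / 2"
    and "f0 * h + (1 - \<kappa>) * D * h\<^sup>2 / 2 \<le> cdf \<mu> t0 - cdf \<mu> (t0 - h)"
proof -
  define P where "P k u = f0 * (u - t0) - k * D * (u - t0)\<^sup>2 / 2" for k u :: real
  have P: "(P k has_real_derivative f0 - k * D * (u - t0)) (at u)" for k u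
    unfolding P_def by (auto intro!: derivative_eq_intros)
  have "t0 - h \<le> t0" using assms by simp
  note eq = cdf_diff[OF this]
  have "cdf \<mu> t0 - cdf \<mu> (t0 - h) \<le> P (1 + \<kappa>) t0 - P (1 + \<kappa>) (t0 - h)"
    unfolding eq
  proof (rule integral_le_primitive[OF _ P _ integrable_indicator_f])
    fix u assume "t0 - h < u" "u \<le> t0"
    then show "f u \<le> f0 - (1 + \<kappa>) * D * (u - t0)"
      using expandsD(1)[OF assms(1), of "u - t0"] assms(3) by (simp add: algebra_simps)
  qed (use assms in \<open>simp, intro continuous_intros\<close>)
  then show "cdf \<mu> t0 - cdf \<mu> (t0 - h) \<le> f0 * h + (1 + \<kappa>) * D * h\<^sup>2 / 2" by (simp add: P_def)
  have "P (1 - \<kappa>) t0 - P (1 - \<kappa>) (t0 - h) \<le> cdf \<mu> t0 - cdf \<mu> (t0 - h)"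
    unfolding eq
  proof (rule integral_ge_primitive[OF _ P _ integrable_indicator_f])
    fix u assume "t0 - h < u" "u \<le> t0"
    then show "f0 - (1 - \<kappa>) * D * (u - t0) \<le> f u"
      using expandsD(2)[OF assms(1), of "u - t0"] assms(3) by (simp add: algebra_simps)
  qed (use assms in \<open>simp, intro continuous_intros\<close>)
  then show "f0 * h + (1 - \<kappa>) * D * h\<^sup>2 / 2 \<le> cdf \<mu> t0 - cdf \<mu> (t0 - h)" by (simp add: P_def)
qed

lemma dev_eq_cnt: "dev x n t = cnt x n t - real n * cdf \<mu> t"
  by (simp add: dev_def cnt_def sum_subtractf)

end

section \<open>The upper bound\<close>

context decreasing_density
begin

text \<open>\<open>ramp s0 T\<close> averages the increments over \<open>{s<..T}\<close> for \<open>s0 \<le> s \<le> t0\<close>: up to normalisation it is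
  the statistic dual to the cheapest deviation that lets the estimator exceed \<open>f0 + D * (t0 - s0)\<close>.\<close>

definition ramp :: "real \<Rightarrow> real \<Rightarrow> real \<Rightarrow> real" where
  "ramp s0 T u = indicator {s0<..t0} u * (u - s0) + indicator {t0<..T} u * (t0 - s0)"

lemma ramp_measurable[measurable]: "ramp s0 T \<in> borel_measurable borel"
  unfolding ramp_def by measurable

lemma ramp_bounds: "s0 \<le> t0 \<Longrightarrow> 0 \<le> ramp s0 T u" "s0 \<le> t0 \<Longrightarrow> ramp s0 T u \<le> t0 - s0"
  by (auto simp: ramp_def indicator_def)

text \<open>For fixed \<open>u\<close> the integral is the length of the set of those
  \<open>s\<close> for which \<open>u\<close> is counted in \<open>{s<..T}\<close>. This turns an
  average of increments into a sum over observations.\<close>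

lemma ramp_eq_integral:
  assumes "s0 \<le> t0" "t0 \<le> T"
  shows "integrable lborel (\<lambda>s. indicator {s0<..t0} s * (indicator {s<..T} u :: real))"
    and "(\<integral>s. indicator {s0<..t0} s * indicator {s<..T} u \<partial>lborel) = ramp s0 T u"
proof -
  have "(indicator {s0<..t0} s * indicator {s<..T} u :: real)
      = (if u \<le> T then indicator ({s0<..t0} \<inter> {..<u}) s else 0)" for s
    by (auto simp: indicator_def)
  moreover have "{s0<..t0} \<inter> {..<u} = (if u \<le> t0 then {s0<..<u} else {s0<..t0})" by auto
  ultimately have eq: "(\<lambda>s. indicator {s0<..t0} s * indicator {s<..T} u :: real)
      = (\<lambda>s. if u \<le> T then (if u \<le> t0 then indicator {s0<..<u} s else indicator {s0<..t0} s) else 0)"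
    by auto
  have i: "integrable lborel (indicator {s0<..<u} :: real \<Rightarrow> real)" "integrable lborel (indicator {s0<..t0} :: real \<Rightarrow> real)"
  proof -
    have "bounded {s0<..<u}" "bounded {s0<..t0}"
      by (rule bounded_subset[of "{s0..u}"]; auto) (rule bounded_subset[of "{s0..t0}"]; auto)
    then show "integrable lborel (indicator {s0<..<u} :: real \<Rightarrow> real)"
      "integrable lborel (indicator {s0<..t0} :: real \<Rightarrow> real)"
      by (intro integrable_real_indicator emeasure_bounded_finite; simp)+
  qed
  show "integrable lborel (\<lambda>s. indicator {s0<..t0} s * (indicator {s<..T} u :: real))"
    unfolding eq using i by (cases "u \<le> T"; cases "u \<le> t0"; simp)
  show "(\<integral>s. indicator {s0<..t0} s * indicator {s<..T} u \<partial>lborel) = ramp s0 T u"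
  proof -
    have rv: "ramp s0 T u = (if u \<le> T \<and> s0 < u then if u \<le> t0 then u - s0 else t0 - s0 else 0)"
      using assms by (auto simp: ramp_def indicator_def)
    show ?thesis unfolding eq rv using assms by (cases "u \<le> T"; cases "u \<le> t0"; cases "s0 < u"; simp)
  qed
qed

text \<open>Infinitely many constraints, one for each \<open>s\<close>, are replaced by their
  integral, which is a single sum of independent terms. \<open>Y\<close> is the allowance for moving
  the witness to a grid point. The value \<open>s = t0\<close>, which the hypothesis leaves out, has
  measure zero.\<close>

lemma sum_ramp_ge:
  assumes s0: "s0 \<le> t0" "t0 \<le> T"
    and ge: "\<And>s. s0 \<le> s \<Longrightarrow> s < t0 \<Longrightarrow> \<alpha> * (T - s) - Y \<le> cnt x n T - cnt x n s"
  shows "\<alpha> * ((t0 - s0) * (T - t0) + (t0 - s0)\<^sup>2 / 2) - (t0 - s0) * Y \<le> (\<Sum>i<n. ramp s0 T (x i))"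
proof -
  define P where "P s = \<alpha> * (T * s - s\<^sup>2 / 2) - Y * s" for s
  have P: "(P has_real_derivative \<alpha> * (T - s) - Y) (at s)" for s
    unfolding P_def by (auto intro!: derivative_eq_intros)
  have cont: "continuous_on UNIV (\<lambda>s. \<alpha> * (T - s) - Y)" by (intro continuous_intros)
  note prim = integral_primitive_Ioc[OF s0(1) P cont]
  have "P t0 - P s0 = (\<integral>s. indicator {s0<..t0} s * (\<alpha> * (T - s) - Y) \<partial>lborel)"
    by (simp add: prim(2))
  also have "\<dots> \<le> (\<integral>s. (\<Sum>i<n. indicator {s0<..t0} s * indicator {s<..T} (x i)) \<partial>lborel)"
  proof (rule integral_mono_AE[OF prim(1)])
    show "integrable lborel (\<lambda>s. \<Sum>i<n. indicator {s0<..t0} s * (indicator {s<..T} (x i) :: real))"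
      by (intro Bochner_Integration.integrable_sum ramp_eq_integral s0)
    show "AE s in lborel. indicator {s0<..t0} s * (\<alpha> * (T - s) - Y)
        \<le> (\<Sum>i<n. indicator {s0<..t0} s * indicator {s<..T} (x i))"
      using AE_lborel_singleton[of t0]
    proof eventually_elim
      case (elim s)
      show ?case
      proof (cases "s0 < s \<and> s < t0")
        case True
        then have "\<alpha> * (T - s) - Y \<le> (\<Sum>i<n. indicator {s<..T} (x i))"
          using ge[of s] s0 by (subst cnt_diff[symmetric]) auto
        with True show ?thesis by simp
      next
        case False
        with elim have "s \<notin> {s0<..t0}" by auto
        then show ?thesis by simp
      qed
    qed
  qed
  also have "\<dots> = (\<Sum>i<n. ramp s0 T (x i))"
    by (subst Bochner_Integration.integral_sum) (simp_all add: ramp_eq_integral s0)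
  also have "P t0 - P s0 = \<alpha> * ((t0 - s0) * (T - t0) + (t0 - s0)\<^sup>2 / 2) - (t0 - s0) * Y"
    by (simp add: P_def power2_eq_square field_simps)
  finally show ?thesis .
qed

text \<open>Between \<open>t0 - \<sigma>\<close> and \<open>t0\<close> the density exceeds
  \<open>f0\<close> by about \<open>D * (t0 - u)\<close>, which contributes
  \<open>D * \<sigma>^3 / 6\<close>. The level \<open>f0 + D * \<sigma>\<close> asks for the excess
  \<open>D * \<sigma> * (\<sigma>^2 / 2 + \<sigma> * h)\<close>, so that a deviation of
  \<open>D * \<sigma>^2 * (h + \<sigma> / 3)\<close> per observation is left to chance.\<close>

lemma ramp_expectation_le:
  assumes e: "expands \<kappa> \<eta>" and s: "0 \<le> \<sigma>" "\<sigma> \<le> \<eta>" and T: "0 \<le> h"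
  shows "(\<integral>u. ramp (t0 - \<sigma>) (t0 + h) u \<partial>\<mu>) \<le> f0 * (\<sigma>\<^sup>2 / 2 + \<sigma> * h) + (1 + \<kappa>) * D * \<sigma> ^ 3 / 6"
proof -
  define P where "P u = f0 * (u - t0 + \<sigma>)\<^sup>2 / 2 - (1 + \<kappa>) * D * ((u - t0) ^ 3 / 3 + \<sigma> * (u - t0)\<^sup>2 / 2)" for u
  have P: "(P has_real_derivative (u - t0 + \<sigma>) * (f0 - (1 + \<kappa>) * D * (u - t0))) (at u)" for u
    unfolding P_def by (auto intro!: derivative_eq_intros simp: power2_eq_square field_simps)
  have int1: "integrable lborel (\<lambda>u. indicator {t0 - \<sigma><..t0} u * ((u - (t0 - \<sigma>)) * f u))"
  proof -
    have "integrable lborel (\<lambda>u. (indicator {t0 - \<sigma><..t0} u * (u - (t0 - \<sigma>))) * f u)"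
      by (rule integrable_bounded_mult[where b = \<sigma>]) (use s in \<open>auto simp: indicator_def\<close>)
    then show ?thesis by (simp only: mult.assoc)
  qed
  have le1: "(\<integral>u. indicator {t0 - \<sigma><..t0} u * ((u - (t0 - \<sigma>)) * f u) \<partial>lborel) \<le> P t0 - P (t0 - \<sigma>)"
  proof (rule integral_le_primitive[OF _ P _ int1])
    fix u assume u: "t0 - \<sigma> < u" "u \<le> t0"
    then have "f (t0 + (u - t0)) \<le> f0 - D * (u - t0) + \<kappa> * D * \<bar>u - t0\<bar>"
      using s by (intro expandsD[OF e]) auto
    then have "f u \<le> f0 - (1 + \<kappa>) * D * (u - t0)" using u by (simp add: algebra_simps)
    then show "(u - (t0 - \<sigma>)) * f u \<le> (u - t0 + \<sigma>) * (f0 - (1 + \<kappa>) * D * (u - t0))"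
      using u by (intro mult_mono) (auto simp: nonneg)
    qed (use s in \<open>simp, intro continuous_intros\<close>)
  have le2: "cdf \<mu> (t0 + h) - cdf \<mu> t0 \<le> f0 * (t0 + h - t0)"
  proof (rule cdf_diff_le)
    show "f u \<le> f0" if "t0 < u" for u using antiD[of t0 u] that t0 f0 by auto
  qed (use T in auto)
  have eq: "(\<integral>u. ramp (t0 - \<sigma>) (t0 + h) u \<partial>\<mu>)
     = (\<integral>u. indicator {t0 - \<sigma><..t0} u * ((u - (t0 - \<sigma>)) * f u) + \<sigma> * (indicator {t0<..t0 + h} u * f u) \<partial>lborel)"
    by (subst expectation_eq) (auto simp: ramp_def algebra_simps intro!: Bochner_Integration.integral_cong)
  also have "\<dots> = (\<integral>u. indicator {t0 - \<sigma><..t0} u * ((u - (t0 - \<sigma>)) * f u) \<partial>lborel)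
      + \<sigma> * (cdf \<mu> (t0 + h) - cdf \<mu> t0)"
    using int1 integrable_indicator_f T by (simp add: cdf_diff)
  also have "\<dots> \<le> P t0 - P (t0 - \<sigma>) + \<sigma> * (f0 * (t0 + h - t0))"
    using le1 le2 s by (intro add_mono mult_left_mono) auto
  also have "\<dots> = f0 * (\<sigma>\<^sup>2 / 2 + \<sigma> * h) + (1 + \<kappa>) * D * \<sigma> ^ 3 / 6"
    by (simp add: P_def power2_eq_square power3_eq_cube field_simps)
  finally show ?thesis .
qed

text \<open>The factor \<open>\<sigma>^2 * (h + \<sigma> / 3)\<close> is the same as in the required
  deviation. For \<open>K\<close> near \<open>f0\<close> the ratio of deviation and variance is
  therefore about \<open>D / f0\<close> whatever \<open>h\<close> and \<open>\<sigma>\<close> are;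
  this is the exponential parameter used in \<open>dual_event\<close>.\<close>

lemma ramp_square_le:
  assumes s: "0 \<le> \<sigma>" "\<sigma> < t0" and K: "f (t0 - \<sigma>) \<le> K" and T: "0 \<le> h"
  shows "(\<integral>u. (ramp (t0 - \<sigma>) (t0 + h) u)\<^sup>2 \<partial>\<mu>) \<le> K * (\<sigma> ^ 3 / 3 + \<sigma>\<^sup>2 * h)"
proof -
  define P where "P u = K * (u - t0 + \<sigma>) ^ 3 / 3" for u
  have P: "(P has_real_derivative K * (u - t0 + \<sigma>)\<^sup>2) (at u)" for u
    unfolding P_def by (auto intro!: derivative_eq_intros simp: field_simps)
  have fK: "f u \<le> K" if "t0 - \<sigma> < u" for u using antiD[of "t0 - \<sigma>" u] that s K by auto
  have int1: "integrable lborel (\<lambda>u. indicator {t0 - \<sigma><..t0} u * ((u - (t0 - \<sigma>))\<^sup>2 * f u))"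
  proof -
    have "integrable lborel (\<lambda>u. (indicator {t0 - \<sigma><..t0} u * (u - (t0 - \<sigma>))\<^sup>2) * f u)"
      by (rule integrable_bounded_mult[where b = "\<sigma>\<^sup>2"]) (use s in \<open>auto simp: indicator_def intro!: power_mono\<close>)
    then show ?thesis by (simp only: mult.assoc)
  qed
  have le1: "(\<integral>u. indicator {t0 - \<sigma><..t0} u * ((u - (t0 - \<sigma>))\<^sup>2 * f u) \<partial>lborel) \<le> P t0 - P (t0 - \<sigma>)"
  proof (rule integral_le_primitive[OF _ P _ int1])
    fix u assume u: "t0 - \<sigma> < u" "u \<le> t0"
    have "(u - (t0 - \<sigma>))\<^sup>2 * f u \<le> (u - (t0 - \<sigma>))\<^sup>2 * K" by (intro mult_left_mono fK u) auto
    moreover have "u - (t0 - \<sigma>) = u - t0 + \<sigma>" by simp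
    ultimately show "(u - (t0 - \<sigma>))\<^sup>2 * f u \<le> K * (u - t0 + \<sigma>)\<^sup>2" by (simp only: mult.commute)
  qed (use s in \<open>simp, intro continuous_intros\<close>)
  have le2: "cdf \<mu> (t0 + h) - cdf \<mu> t0 \<le> K * (t0 + h - t0)"
  proof (rule cdf_diff_le)
    show "f u \<le> K" if "t0 < u" for u using that s by (intro fK) auto
  qed (use T in simp)
  have sq: "(ramp (t0 - \<sigma>) (t0 + h) u)\<^sup>2 * f u
      = indicator {t0 - \<sigma><..t0} u * ((u - (t0 - \<sigma>))\<^sup>2 * f u) + \<sigma>\<^sup>2 * (indicator {t0<..t0 + h} u * f u)" for u
    by (auto simp: ramp_def indicator_def)
  have "(\<integral>u. (ramp (t0 - \<sigma>) (t0 + h) u)\<^sup>2 \<partial>\<mu>) = (\<integral>u. (ramp (t0 - \<sigma>) (t0 + h) u)\<^sup>2 * f u \<partial>lborel)"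
    by (subst expectation_eq) simp_all
  also have "\<dots> = (\<integral>u. indicator {t0 - \<sigma><..t0} u * ((u - (t0 - \<sigma>))\<^sup>2 * f u) \<partial>lborel)
      + \<sigma>\<^sup>2 * (cdf \<mu> (t0 + h) - cdf \<mu> t0)"
    unfolding sq using int1 integrable_indicator_f T by (simp add: cdf_diff)
  also have "\<dots> \<le> P t0 - P (t0 - \<sigma>) + \<sigma>\<^sup>2 * (K * (t0 + h - t0))"
    using le1 le2 s by (intro add_mono mult_left_mono) auto
  also have "\<dots> = K * (\<sigma> ^ 3 / 3 + \<sigma>\<^sup>2 * h)"
    by (simp add: P_def algebra_simps)
  finally show ?thesis .
qed

lemma ramp_tail:
  fixes \<sigma> h Y \<kappa> :: real
  defines "g \<equiv> \<lambda>u. ramp (t0 - \<sigma>) (t0 + h) u - (\<integral>u. ramp (t0 - \<sigma>) (t0 + h) u \<partial>\<mu>)"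
  assumes s: "0 < \<sigma>" "\<sigma> < t0" and K: "f (t0 - \<sigma>) \<le> K" and T: "0 \<le> h" and Y: "0 < Y" and \<theta>: "0 < \<theta>"
  shows "{x\<in>space (sample {..<N}). \<exists>n\<le>N. Y \<le> (\<Sum>i<n. g (x i))} \<in> sets (sample {..<N})"
    and "measure (sample {..<N}) {x\<in>space (sample {..<N}). \<exists>n\<le>N. Y \<le> (\<Sum>i<n. g (x i))}
      \<le> exp (- \<theta> * Y + real N * (\<theta>\<^sup>2 * (K * (\<sigma> ^ 3 / 3 + \<sigma>\<^sup>2 * h)) / 2 * exp (\<theta> * \<sigma>)))"
proof -
  define e where "e = (\<integral>u. ramp (t0 - \<sigma>) (t0 + h) u \<partial>\<mu>)"
  have r: "0 \<le> ramp (t0 - \<sigma>) (t0 + h) u" "ramp (t0 - \<sigma>) (t0 + h) u \<le> \<sigma>" for u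
    using ramp_bounds[of "t0 - \<sigma>" "t0 + h" u] s by auto
  have ir: "integrable \<mu> (ramp (t0 - \<sigma>) (t0 + h))"
    by (rule integrable_const_bound[where B = \<sigma>]) (use r in \<open>auto simp: abs_le_iff\<close>)
  have ir2: "integrable \<mu> (\<lambda>u. (ramp (t0 - \<sigma>) (t0 + h) u)\<^sup>2)"
    by (rule integrable_const_bound[where B = "\<sigma>\<^sup>2"]) (use r in \<open>auto intro!: power_mono\<close>)
  have e0: "0 \<le> e" unfolding e_def using r by (intro integral_nonneg_AE) auto
  have "e \<le> (\<integral>u. \<sigma> \<partial>\<mu>)" unfolding e_def using r ir by (intro integral_mono) auto
  also have "\<dots> = \<sigma>" using prob_space by simp
  finally have e1: "e \<le> \<sigma>" .
  have g: "g = (\<lambda>u. ramp (t0 - \<sigma>) (t0 + h) u - e)" by (simp add: g_def e_def)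
  have gm: "g \<in> borel_measurable borel" unfolding g by measurable
  have b: "\<bar>g u\<bar> \<le> \<sigma>" for u using r[of u] e0 e1 by (auto simp: g abs_le_iff)
  have z: "(\<integral>u. g u \<partial>\<mu>) = 0" unfolding g using ir prob_space by (simp add: e_def)
  have "(\<integral>u. (g u)\<^sup>2 \<partial>\<mu>) = (\<integral>u. (ramp (t0 - \<sigma>) (t0 + h) u)\<^sup>2 - 2 * e * ramp (t0 - \<sigma>) (t0 + h) u + e\<^sup>2 \<partial>\<mu>)"
    by (intro Bochner_Integration.integral_cong refl) (simp add: g power2_diff algebra_simps)
  also have "\<dots> = (\<integral>u. (ramp (t0 - \<sigma>) (t0 + h) u)\<^sup>2 \<partial>\<mu>) - e\<^sup>2"
    using ir ir2 prob_space by (simp add: e_def[symmetric] power2_eq_square)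
  also have "\<dots> \<le> K * (\<sigma> ^ 3 / 3 + \<sigma>\<^sup>2 * h)"
    using ramp_square_le[of \<sigma> K h] s K T zero_le_power2[of e] by linarith
  finally have v: "(\<integral>u. (g u)\<^sup>2 \<partial>\<mu>) \<le> K * (\<sigma> ^ 3 / 3 + \<sigma>\<^sup>2 * h)" .
  show "{x\<in>space (sample {..<N}). \<exists>n\<le>N. Y \<le> (\<Sum>i<n. g (x i))} \<in> sets (sample {..<N})"
    and "measure (sample {..<N}) {x\<in>space (sample {..<N}). \<exists>n\<le>N. Y \<le> (\<Sum>i<n. g (x i))}
      \<le> exp (- \<theta> * Y + real N * (\<theta>\<^sup>2 * (K * (\<sigma> ^ 3 / 3 + \<sigma>\<^sup>2 * h)) / 2 * exp (\<theta> * \<sigma>)))"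
    by (rule maximal_bernstein[OF gm b z v \<theta> Y])+
qed

end

section \<open>From the exceptional events to a bound for the estimator\<close>

context decreasing_density
begin

text \<open>The exceptional events of one block: \<open>far\<close> controls large \<open>t\<close>, \<open>peel\<close> the range between
  \<open>t0 + R * \<sigma>\<close> and a fixed neighbourhood, \<open>cell\<close> and \<open>dual\<close> the critical range.\<close>

lemma grenander_le_deterministic:
  fixes x :: "nat \<Rightarrow> real" and \<sigma> \<kappa> \<eta> L z R d w q :: real and N n :: nat
  assumes e: "expands \<kappa> \<eta>" and \<kappa>: "0 < \<kappa>" "\<kappa> \<le> 1/2" and L: "0 < L" "L / 2 \<le> \<eta>"
    and q: "1 < q" "q \<le> 2" and n: "0 < n" "n \<le> N" "real N \<le> q * real n"
    and s: "0 < \<sigma>" "\<sigma> \<le> R * \<sigma>" "R * \<sigma> \<le> L / 2" "\<sigma> \<le> \<eta>" and w: "0 < w"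
    and z: "z = D / 128" and d: "2 * d + 8 * z * (R * \<sigma>)\<^sup>2 + D * \<sigma>\<^sup>2 < D * L\<^sup>2 / 16" and l: "1 \<le> f0 * l" "L \<le> l"
    and far: "\<And>n t. n \<le> N \<Longrightarrow> t0 \<le> t \<Longrightarrow> t \<le> t0 + l \<Longrightarrow> \<bar>dev x n t - dev x n t0\<bar> \<le> d * real N"
    and peel: "\<And>n t. n \<le> N \<Longrightarrow> \<bar>t - t0\<bar> \<le> L / 2 \<Longrightarrow>
        \<bar>dev x n t - dev x n t0\<bar> \<le> 4 * (z * real N) * (max (R * \<sigma>) \<bar>t - t0\<bar>)\<^sup>2"
    and cell: "\<And>j n t. real j * w < R * \<sigma> \<Longrightarrow> n \<le> N \<Longrightarrow> t0 + real j * w \<le> t \<Longrightarrow> t \<le> t0 + real j * w + w \<Longrightarrow>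
        \<bar>dev x n t - dev x n (t0 + real j * w)\<bar> \<le> \<kappa> / 6 * D * real N * \<sigma>\<^sup>2"
    and dual: "\<And>j n. real j * w < R * \<sigma> \<Longrightarrow> n \<le> N \<Longrightarrow>
        (\<Sum>i<n. ramp (t0 - \<sigma>) (t0 + real j * w) (x i) - (\<integral>u. ramp (t0 - \<sigma>) (t0 + real j * w) u \<partial>\<mu>))
        < real N * D * \<sigma>\<^sup>2 * ((real j * w + \<sigma> / 3) * ((1 - \<kappa> / 2) / q - \<kappa> / 2))"
  shows "grenander x n t0 \<le> f0 + D * \<sigma>"
proof (rule ccontr)
  define a where "a = f0 + D * \<sigma>"
  have a: "f0 \<le> a" "0 \<le> a" using s D f0 by (auto simp: a_def)
  have \<sigma>t0: "\<sigma> < t0" using s e t0 by (auto simp: expands_def)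
  have N: "real N \<le> 2 * real n"
    using n mult_right_mono[OF q(2), of "real n"] by linarith
  assume "\<not> grenander x n t0 \<le> f0 + D * \<sigma>"
  then have "a < grenander x n t0" by (simp add: a_def)
  from grenander_gt_cnt[OF t0 a(2) this n(1)] obtain t where t: "t0 \<le> t"
    and W: "\<forall>s. 0 \<le> s \<longrightarrow> s < t0 \<longrightarrow> real n * a * (t - s) \<le> cnt x n t - cnt x n s" by blast
  define h where "h = t - t0"
  have h: "0 \<le> h" "t = t0 + h" using t by (auto simp: h_def)
  define P where "P = real n * a * (h + \<sigma>)"
  have W0: "P \<le> cnt x n t - cnt x n (t0 - \<sigma>)"
    using W[rule_format, of "t0 - \<sigma>"] \<sigma>t0 s by (simp add: P_def h)
  have P_ge: "real n * (f0 * h + f0 * \<sigma> + D * \<sigma>\<^sup>2) \<le> P"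
  proof -
    have "0 \<le> real n * (D * \<sigma> * h)" using D s h by simp
    then show ?thesis by (simp add: P_def a_def algebra_simps power2_eq_square)
  qed
  have peel0: "\<bar>dev x n (t0 - \<sigma>) - dev x n t0\<bar> \<le> 4 * (z * real N) * (R * \<sigma>)\<^sup>2"
  proof -
    have m: "max (R * \<sigma>) \<bar>t0 - \<sigma> - t0\<bar> = R * \<sigma>" using s by (intro max_absorb1) auto
    have "\<bar>t0 - \<sigma> - t0\<bar> = \<sigma>" using s(1) by simp
    with s have "\<bar>t0 - \<sigma> - t0\<bar> \<le> L / 2" by linarith
    from peel[OF n(2) this] show ?thesis unfolding m .
  qed
  have left: "cdf \<mu> t0 - cdf \<mu> (t0 - \<sigma>) \<le> f0 * \<sigma> + D * \<sigma>\<^sup>2"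
  proof -
    have "cdf \<mu> t0 - cdf \<mu> (t0 - \<sigma>) \<le> f0 * \<sigma> + (1 + \<kappa>) * D * \<sigma>\<^sup>2 / 2"
      using s by (intro cdf_left[OF e]) auto
    moreover have "(1 + \<kappa>) * (D * \<sigma>\<^sup>2) \<le> 2 * (D * \<sigma>\<^sup>2)" using \<kappa> D by (intro mult_right_mono) auto
    then have "(1 + \<kappa>) * D * \<sigma>\<^sup>2 / 2 \<le> D * \<sigma>\<^sup>2" by (simp add: mult.assoc)
    ultimately show ?thesis by linarith
  qed
  have z0: "0 \<le> z * real N" using D by (simp add: z)
  have f_le: "f u \<le> f0" if "t0 \<le> u" for u using antiD[of t0 u] that t0 f0 by simp
  have cnt_eq: "cnt x n b - cnt x n c = (dev x n b - dev x n c) + real n * (cdf \<mu> b - cdf \<mu> c)" for b c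
    by (simp add: dev_eq_cnt algebra_simps)
  have split: "real n * (cdf \<mu> t - cdf \<mu> (t0 - \<sigma>)) \<le> real n * (cdf \<mu> t - cdf \<mu> t0) + real n * (f0 * \<sigma> + D * \<sigma>\<^sup>2)"
    using mult_left_mono[OF left, of "real n"] by (simp add: algebra_simps)
  consider (a) "l < h" | (b) "L / 2 < h" "h \<le> l" | (c) "R * \<sigma> \<le> h" "h \<le> L / 2" | (d) "h < R * \<sigma>" by linarith
  then show False
  proof cases
    case a
    have "1 < f0 * (h + \<sigma>)" 
    proof -
      have "f0 * l < f0 * (h + \<sigma>)" using a f0 s by (intro mult_strict_left_mono) auto
      with l show ?thesis by linarith
    qed
    also have "\<dots> \<le> a * (h + \<sigma>)" using \<open>f0 \<le> a\<close> h s by (intro mult_right_mono) auto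
    finally have "real n * 1 < real n * (a * (h + \<sigma>))" using n by (intro mult_strict_left_mono) auto
    with W0 have "real n < cnt x n t - cnt x n (t0 - \<sigma>)" by (simp add: P_def mult.assoc)
    with cnt_le[of x n t] cnt_nonneg[of x n "t0 - \<sigma>"] show False by linarith
  next
    case b
    have "cdf \<mu> t - cdf \<mu> (t0 + L / 2) \<le> f0 * (t - (t0 + L / 2))"
      using b h L by (intro cdf_diff_le f_le) auto
    moreover have "cdf \<mu> (t0 + L / 2) - cdf \<mu> t0 \<le> f0 * (L / 2) - (1 - \<kappa>) * D * (L / 2)\<^sup>2 / 2"
      using L by (intro cdf_right[OF e]) auto
    moreover have "(1 / 2) * (D * L\<^sup>2) \<le> (1 - \<kappa>) * (D * L\<^sup>2)" using \<kappa> D by (intro mult_right_mono) auto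
    then have "D * L\<^sup>2 / 16 \<le> (1 - \<kappa>) * D * (L / 2)\<^sup>2 / 2" by (simp add: power_divide mult.assoc)
    moreover have "f0 * (t - (t0 + L / 2)) = f0 * h - f0 * (L / 2)" by (simp add: h right_diff_distrib)
    ultimately have "cdf \<mu> t - cdf \<mu> t0 \<le> f0 * h - D * L\<^sup>2 / 16" by linarith
    from mult_left_mono[OF this, of "real n"]
    have "real n * (cdf \<mu> t - cdf \<mu> t0) \<le> real n * (f0 * h) - real n * (D * L\<^sup>2 / 16)"
      by (simp add: right_diff_distrib)
    moreover have "\<bar>dev x n t - dev x n t0\<bar> \<le> d * real N" using b h by (intro far n) auto
    moreover have "real n * (f0 * h + f0 * \<sigma> + D * \<sigma>\<^sup>2) = real n * (f0 * h) + real n * (f0 * \<sigma> + D * \<sigma>\<^sup>2)"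
      by (simp add: algebra_simps)
    ultimately have "real n * (D * L\<^sup>2 / 16) \<le> d * real N + 4 * (z * real N) * (R * \<sigma>)\<^sup>2"
      using W0 P_ge peel0 split cnt_eq[of t "t0 - \<sigma>"] by linarith
    also have "\<dots> = (d + 4 * z * (R * \<sigma>)\<^sup>2) * real N" by (simp add: algebra_simps)
    also have "\<dots> \<le> (d + 4 * z * (R * \<sigma>)\<^sup>2) * (2 * real n)"
    proof (rule mult_left_mono[OF N])
      \<comment> \<open>\<open>far\<close> at \<open>n = 0\<close> and \<open>t = t0\<close> bounds
        the absolute value of 0, which yields the sign of \<open>d\<close>.\<close>
      have "0 \<le> d * real N" using far[of 0 t0] l L by (simp add: dev_def) 
      then have "0 \<le> d" using n by (simp add: zero_le_mult_iff)
      then show "0 \<le> d + 4 * z * (R * \<sigma>)\<^sup>2" using D by (simp add: z)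
    qed
    also have "\<dots> = real n * (2 * d + 8 * z * (R * \<sigma>)\<^sup>2)" by (simp add: algebra_simps)
    finally have "D * L\<^sup>2 / 16 \<le> 2 * d + 8 * z * (R * \<sigma>)\<^sup>2" using n by simp
    moreover have "0 \<le> D * \<sigma>\<^sup>2" using D by simp
    ultimately show False using d by linarith
  next
    case c
    have h0: "0 < h" using c s by linarith
    have "cdf \<mu> t - cdf \<mu> t0 \<le> f0 * h - (1 - \<kappa>) * D * h\<^sup>2 / 2"
      unfolding h(2) using c h L by (intro cdf_right[OF e]) auto
    moreover have "(1 / 2) * (D * h\<^sup>2) \<le> (1 - \<kappa>) * (D * h\<^sup>2)" using \<kappa> D by (intro mult_right_mono) auto
    then have "D * h\<^sup>2 / 4 \<le> (1 - \<kappa>) * D * h\<^sup>2 / 2" by (simp add: mult.assoc)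
    ultimately have "cdf \<mu> t - cdf \<mu> t0 \<le> f0 * h - D * h\<^sup>2 / 4" by linarith
    from mult_left_mono[OF this, of "real n"]
    have "real n * (cdf \<mu> t - cdf \<mu> t0) \<le> real n * (f0 * h) - real n * (D * h\<^sup>2 / 4)"
      by (simp add: right_diff_distrib)
    moreover have "\<bar>dev x n t - dev x n t0\<bar> \<le> 4 * (z * real N) * h\<^sup>2"
    proof -
      have m: "max (R * \<sigma>) \<bar>t - t0\<bar> = h" using c h by (subst max_absorb2) auto
      have "\<bar>t - t0\<bar> \<le> L / 2" using c h by simp
      from peel[OF n(2) this] show ?thesis unfolding m .
    qed
    moreover have "(R * \<sigma>)\<^sup>2 \<le> h\<^sup>2" using c s by (intro power_mono) auto
    then have "4 * (z * real N) * (R * \<sigma>)\<^sup>2 \<le> 4 * (z * real N) * h\<^sup>2" using z0 by (intro mult_left_mono) auto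
    moreover have "real n * (f0 * h + f0 * \<sigma> + D * \<sigma>\<^sup>2) = real n * (f0 * h) + real n * (f0 * \<sigma> + D * \<sigma>\<^sup>2)"
      by (simp add: algebra_simps)
    ultimately have "real n * (D * h\<^sup>2 / 4) \<le> 8 * (z * real N) * h\<^sup>2"
      using W0 P_ge peel0 split cnt_eq[of t "t0 - \<sigma>"] by linarith
    \<comment> \<open>With \<open>z = D / 128\<close>, twice the peeling bound amounts to half of
      the quadratic loss, even after using \<open>real N <= 2 * real n\<close>.\<close>
    also have "\<dots> = (D * h\<^sup>2 / 16) * real N" by (simp add: z)
    also have "\<dots> \<le> (D * h\<^sup>2 / 16) * (2 * real n)" using N D by (intro mult_left_mono) auto
    also have "\<dots> = real n * (D * h\<^sup>2 / 8)" by simp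
    finally have "D * h\<^sup>2 / 4 \<le> D * h\<^sup>2 / 8" using n by (simp only: mult_le_cancel_left_pos of_nat_0_less_iff)
    moreover have "0 < D * h\<^sup>2" using D h0 by simp
    ultimately show False by linarith
  next
    case d
    \<comment> \<open>\<open>k = real j * w\<close> is the grid point at or below \<open>h\<close>.
      Between \<open>t0 + k\<close> and the witness the distribution function grows with slope at
      most \<open>f0 <= a\<close>, so shifting the witness to \<open>t0 + k\<close> loses only the
      oscillation \<open>Y\<close> of the cell.\<close>
    define j where "j = nat \<lfloor>h / w\<rfloor>"
    have "0 \<le> h / w" using h w by simp
    then have "real j \<le> h / w" "h / w < real j + 1" unfolding j_def by linarith+
    then have j: "real j * w \<le> h" "h \<le> real j * w + w" using w by (auto simp: field_simps)
    then have jR: "real j * w < R * \<sigma>" using d by linarith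
    define k where "k = real j * w"
    have k: "0 \<le> k" "k \<le> h" "h \<le> k + w" using j w by (auto simp: k_def)
    define Y where "Y = \<kappa> / 6 * D * real N * \<sigma>\<^sup>2"
    have osc: "\<bar>dev x n t - dev x n (t0 + k)\<bar> \<le> Y"
      unfolding k_def Y_def using jR n j by (intro cell) (auto simp: h)
    have step: "cnt x n t - cnt x n (t0 + k) \<le> Y + real n * a * (h - k)"
    proof -
      have "cdf \<mu> t - cdf \<mu> (t0 + k) \<le> f0 * (t - (t0 + k))"
        using k h by (intro cdf_diff_le f_le) auto
      also have "\<dots> \<le> a * (h - k)" unfolding h(2) using a k by (simp add: mult_right_mono)
      finally have "real n * (cdf \<mu> t - cdf \<mu> (t0 + k)) \<le> real n * (a * (h - k))" by (intro mult_left_mono) auto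
      with osc cnt_eq[of t "t0 + k"] show ?thesis by (simp add: mult.assoc)
    qed
    have inc: "real n * a * (t0 + k - s) - Y \<le> cnt x n (t0 + k) - cnt x n s" if "t0 - \<sigma> \<le> s" "s < t0" for s
    proof -
      have "real n * a * (t - s) \<le> cnt x n t - cnt x n s" using W that \<sigma>t0 by auto
      moreover have "real n * a * (t - s) = real n * a * (t0 + k - s) + real n * a * (h - k)"
        by (simp add: h algebra_simps)
      ultimately show ?thesis using step by linarith
    qed
    have dist: "real N * D * \<sigma>\<^sup>2 * (K * (p / q - \<kappa> / 2))
        = real N / q * (D * \<sigma>\<^sup>2 * (K * p)) - \<kappa> / 2 * (real N * D * \<sigma>\<^sup>2 * K)" for K p
      by (simp add: algebra_simps)
    have Nq: "real N / q \<le> real n" using n q by (simp add: divide_le_eq mult.commute)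
    have "real n * a * (\<sigma> * k + \<sigma>\<^sup>2 / 2) - \<sigma> * Y \<le> (\<Sum>i<n. ramp (t0 - \<sigma>) (t0 + k) (x i))"
      using sum_ramp_ge[of "t0 - \<sigma>" "t0 + k" "real n * a" Y x n] inc k s by simp
    moreover define e1 where "e1 = (\<integral>u. ramp (t0 - \<sigma>) (t0 + k) u \<partial>\<mu>)"
    moreover have "e1 \<le> f0 * (\<sigma>\<^sup>2 / 2 + \<sigma> * k) + (1 + \<kappa>) * D * \<sigma> ^ 3 / 6"
      unfolding e1_def using s k by (intro ramp_expectation_le[OF e]) auto
    then have "real n * e1 \<le> real n * (f0 * (\<sigma>\<^sup>2 / 2 + \<sigma> * k) + (1 + \<kappa>) * D * \<sigma> ^ 3 / 6)"
      by (intro mult_left_mono) auto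
    moreover have "real n * a * (\<sigma> * k + \<sigma>\<^sup>2 / 2) - real n * (f0 * (\<sigma>\<^sup>2 / 2 + \<sigma> * k) + (1 + \<kappa>) * D * \<sigma> ^ 3 / 6)
        = real n * (D * \<sigma>\<^sup>2 * (k + \<sigma> / 3 - \<kappa> * \<sigma> / 6))"
      by (simp add: a_def power2_eq_square power3_eq_cube field_simps)
    ultimately have "real n * (D * \<sigma>\<^sup>2 * (k + \<sigma> / 3 - \<kappa> * \<sigma> / 6)) - \<sigma> * Y
        \<le> (\<Sum>i<n. ramp (t0 - \<sigma>) (t0 + k) (x i)) - real n * e1" by linarith
    also have "\<dots> = (\<Sum>i<n. ramp (t0 - \<sigma>) (t0 + k) (x i) - e1)" by (simp add: sum_subtractf)
    \<comment> \<open>The subtracted \<open>\<kappa> / 2\<close> will pay for the oscillation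
      \<open>Y\<close>, the factor \<open>1 - \<kappa> / 2\<close> for the error of the expansion,
      and the division by \<open>q\<close> for comparing \<open>n\<close> with the block end
      \<open>N\<close>.\<close>
    also have "\<dots> < real N * D * \<sigma>\<^sup>2 * ((k + \<sigma> / 3) * ((1 - \<kappa> / 2) / q - \<kappa> / 2))"
      unfolding e1_def k_def by (rule dual[OF jR n(2)])
    also have "\<dots> = (real N / q) * (D * \<sigma>\<^sup>2 * ((k + \<sigma> / 3) * (1 - \<kappa> / 2))) - \<kappa> / 2 * (real N * D * \<sigma>\<^sup>2 * (k + \<sigma> / 3))"
      by (rule dist)
    also have "\<dots> \<le> real n * (D * \<sigma>\<^sup>2 * ((k + \<sigma> / 3) * (1 - \<kappa> / 2))) - \<sigma> * Y"
    proof (rule diff_mono)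
      show "real N / q * (D * \<sigma>\<^sup>2 * ((k + \<sigma> / 3) * (1 - \<kappa> / 2))) \<le> real n * (D * \<sigma>\<^sup>2 * ((k + \<sigma> / 3) * (1 - \<kappa> / 2)))"
        using D k s \<kappa> by (intro mult_right_mono mult_nonneg_nonneg Nq) auto
      have "\<sigma> * Y = \<kappa> / 2 * (real N * D * \<sigma>\<^sup>2 * (\<sigma> / 3))" by (simp add: Y_def)
      also have "\<dots> \<le> \<kappa> / 2 * (real N * D * \<sigma>\<^sup>2 * (k + \<sigma> / 3))"
        using \<kappa> D k by (intro mult_left_mono) auto
      finally show "\<sigma> * Y \<le> \<kappa> / 2 * (real N * D * \<sigma>\<^sup>2 * (k + \<sigma> / 3))" .
    qed
    finally have "real n * (D * \<sigma>\<^sup>2 * (k + \<sigma> / 3 - \<kappa> * \<sigma> / 6)) < real n * (D * \<sigma>\<^sup>2 * ((k + \<sigma> / 3) * (1 - \<kappa> / 2)))"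
      by linarith
    moreover have "(k + \<sigma> / 3) * (1 - \<kappa> / 2) \<le> k + \<sigma> / 3 - \<kappa> * \<sigma> / 6"
      using \<kappa> k by (simp add: algebra_simps)
    then have "real n * (D * \<sigma>\<^sup>2 * ((k + \<sigma> / 3) * (1 - \<kappa> / 2))) \<le> real n * (D * \<sigma>\<^sup>2 * (k + \<sigma> / 3 - \<kappa> * \<sigma> / 6))"
      using D by (intro mult_left_mono) auto
    ultimately show False by linarith
  qed
qed

end

section \<open>The rate and its asymptotics\<close>

definition rate :: "nat \<Rightarrow> real" where
  "rate n = (2 * ln (ln (real n)) / real n) powr (1/3)"

lemma rate_cube:
  assumes "0 < ln (ln (real n))" "0 < n"
  shows "real n * rate n ^ 3 = 2 * ln (ln (real n))"
proof -
  have p: "0 < 2 * ln (ln (real n)) / real n" using assms by simp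
  then have "rate n ^ 3 = rate n powr 3" by (simp add: rate_def powr_numeral)
  also have "\<dots> = 2 * ln (ln (real n)) / real n" using p assms by (simp add: rate_def powr_powr)
  finally show ?thesis using assms by simp
qed

lemma rate_pos: "0 < ln (ln (real n)) \<Longrightarrow> 0 < n \<Longrightarrow> 0 < rate n"
  by (simp add: rate_def)

lemma rate_tendsto_0: "rate \<longlonglongrightarrow> 0"
  unfolding rate_def by real_asymp

lemma lnln_at_top: "filterlim (\<lambda>n. ln (ln (real n))) at_top sequentially"
  by real_asymp

lemma eventually_lnln_ge: "eventually (\<lambda>n. b \<le> ln (ln (real n))) sequentially"
  using lnln_at_top by (auto simp: filterlim_at_top)

lemma eventually_lnln_le_linear:
  assumes "0 < b"
  shows "eventually (\<lambda>n. ln (ln (real n)) \<le> b * real n) sequentially"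
proof -
  have "(\<lambda>n. ln (ln (real n)) / real n) \<longlonglongrightarrow> 0" by real_asymp
  from order_tendstoD(2)[OF this assms] show ?thesis
    using eventually_gt_at_top[of 0] by eventually_elim (simp add: field_simps)
qed

text \<open>Smallness conditions are stated for a real scale tending to 0 from the right and
  transported to multiples of \<open>rate n\<close> by this lemma.\<close>

lemma eventually_rate:
  assumes "eventually P (at_right 0)" "0 < k"
  shows "eventually (\<lambda>n. P (k * rate n)) sequentially"
proof -
  have "filterlim (\<lambda>n. k * rate n) (at_right 0) sequentially"
    unfolding filterlim_at
  proof
    show "(\<lambda>n. k * rate n) \<longlonglongrightarrow> 0" using tendsto_mult_left[OF rate_tendsto_0, of k] by simp
    show "eventually (\<lambda>n. k * rate n \<in> {0<..} \<and> k * rate n \<noteq> 0) sequentially"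
      using eventually_lnln_ge[of 1] eventually_gt_at_top[of 0]
    proof eventually_elim
      case (elim n)
      then show ?case using rate_pos[of n] assms(2) by auto
    qed
  qed
  then show ?thesis by (rule eventually_compose_filterlim[OF assms(1)])
qed

lemma eventually_less_of_tendsto:
  fixes m :: real
  assumes "(g \<longlongrightarrow> m) F" "m < b"
  shows "eventually (\<lambda>s. g s < b) F"
  using order_tendstoD(2)[OF assms] .

section \<open>Constants and probabilities for the upper bound\<close>

context decreasing_density
begin

text \<open>At \<open>\<kappa> = 0\<close> the bracket equals \<open>1 - 1/2\<close>, the full gain
  minus the Gaussian variance term at the optimal parameter. So the expression tends to
  \<open>r\<close> and stays above 1 for small \<open>\<kappa>\<close>. The block ratio will be
  \<open>1 + \<kappa>\<close>, and \<open>(1 + \<kappa>)^2 / 2\<close> collects the errors of the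
  density and of the exponential factor in the variance term.\<close>

lemma upper_constants:
  assumes c: "1 < r"
  obtains \<kappa> :: real where "0 < \<kappa>" "\<kappa> \<le> 1/2"
    and "1 < 2 * r * ((1 - \<kappa> / 2) / (1 + \<kappa>) - \<kappa> / 2 - (1 + \<kappa>)\<^sup>2 / 2)"
proof -
  have "((\<lambda>\<kappa>::real. 2 * r * ((1 - \<kappa> / 2) / (1 + \<kappa>) - \<kappa> / 2 - (1 + \<kappa>)\<^sup>2 / 2))
      \<longlongrightarrow> 2 * r * ((1 - 0 / 2) / (1 + 0) - 0 / 2 - (1 + 0)\<^sup>2 / 2)) (at_right 0)"
    by (intro tendsto_intros) auto
  then have "((\<lambda>\<kappa>::real. 2 * r * ((1 - \<kappa> / 2) / (1 + \<kappa>) - \<kappa> / 2 - (1 + \<kappa>)\<^sup>2 / 2)) \<longlongrightarrow> r) (at_right 0)"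
    by simp
  from order_tendstoD(1)[OF this c]
  have ev: "eventually (\<lambda>\<kappa>::real. 1 < 2 * r * ((1 - \<kappa> / 2) / (1 + \<kappa>) - \<kappa> / 2 - (1 + \<kappa>)\<^sup>2 / 2)) (at_right 0)" .
  have "eventually (\<lambda>\<kappa>::real. \<kappa> \<in> {0<..<1/2}) (at_right 0)" by (rule eventually_at_rightI[of 0 "1/2"]) auto
  with ev have "eventually (\<lambda>\<kappa>::real. 1 < 2 * r * ((1 - \<kappa> / 2) / (1 + \<kappa>) - \<kappa> / 2 - (1 + \<kappa>)\<^sup>2 / 2) \<and> \<kappa> \<in> {0<..<1/2}) (at_right 0)"
    by (rule eventually_conj)
  then obtain \<kappa> where "1 < 2 * r * ((1 - \<kappa> / 2) / (1 + \<kappa>) - \<kappa> / 2 - (1 + \<kappa>)\<^sup>2 / 2)" "\<kappa> \<in> {0<..<1/2}"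
    using eventually_happens'[OF trivial_limit_at_right_real] by blast
  then show ?thesis by (intro that[of \<kappa>]) auto
qed

text \<open>With the parameter \<open>D / f0\<close> the decay rate is proportional to
  \<open>k + \<sigma> / 3\<close>, hence smallest at \<open>k = 0\<close>. The bound obtained there
  serves every position \<open>k\<close> of the witness.\<close>

lemma dual_event:
  assumes e: "0 < \<kappa>" "\<kappa> \<le> 1/2" and q: "0 < q"
    and B: "0 \<le> (1 - \<kappa> / 2) / q - \<kappa> / 2 - (1 + \<kappa>)\<^sup>2 / 2"
    and N: "0 < N" and s: "0 < \<sigma>" "\<sigma> < t0" and fs: "f (t0 - \<sigma>) \<le> (1 + \<kappa>) * f0"
    and ex: "exp (D / f0 * \<sigma>) \<le> 1 + \<kappa>" and k: "0 \<le> k"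
  obtains A where "A \<in> sets (sample {..<N})"
    and "measure (sample {..<N}) A
      \<le> exp (- (real N * D\<^sup>2 * \<sigma> ^ 3 / (3 * f0)) * ((1 - \<kappa> / 2) / q - \<kappa> / 2 - (1 + \<kappa>)\<^sup>2 / 2))"
    and "\<forall>x\<in>space (sample {..<N}) - A. \<forall>n\<le>N.
       (\<Sum>i<n. ramp (t0 - \<sigma>) (t0 + k) (x i) - (\<integral>u. ramp (t0 - \<sigma>) (t0 + k) u \<partial>\<mu>))
        < real N * D * \<sigma>\<^sup>2 * ((k + \<sigma> / 3) * ((1 - \<kappa> / 2) / q - \<kappa> / 2))"
proof -
  define b where "b = (1 - \<kappa> / 2) / q - \<kappa> / 2"
  define Y where "Y = real N * D * \<sigma>\<^sup>2 * ((k + \<sigma> / 3) * b)"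
  have Bb: "0 \<le> b - (1 + \<kappa>)\<^sup>2 / 2" using B by (simp add: b_def)
  moreover have "0 < (1 + \<kappa>)\<^sup>2" using e by simp
  ultimately have b: "0 < b" by linarith
  have Y0: "0 < Y" using N D s k b by (simp add: Y_def add_nonneg_pos)
  have th: "0 < D / f0" using D f0 by simp
  note T = ramp_tail[OF s fs k Y0 th, of N]
  show ?thesis
  proof (rule that[OF T(1)])
    define V where "V = real N * D\<^sup>2 * \<sigma>\<^sup>2 * (k + \<sigma> / 3) / f0"
    have V: "0 \<le> V" using f0 k s by (simp add: V_def)
    have "real N * ((D / f0)\<^sup>2 * ((1 + \<kappa>) * f0 * (\<sigma> ^ 3 / 3 + \<sigma>\<^sup>2 * k)) / 2 * exp (D / f0 * \<sigma>))
       = V * ((1 + \<kappa>) / 2) * exp (D / f0 * \<sigma>)"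
      using f0 by (simp add: V_def power_divide power2_eq_square power3_eq_cube field_simps)
    also have "\<dots> \<le> V * ((1 + \<kappa>) / 2) * (1 + \<kappa>)" using ex V e by (intro mult_left_mono) auto
    finally have "- (D / f0) * Y + real N * ((D / f0)\<^sup>2 * ((1 + \<kappa>) * f0 * (\<sigma> ^ 3 / 3 + \<sigma>\<^sup>2 * k)) / 2 * exp (D / f0 * \<sigma>))
      \<le> - (D / f0) * Y + V * ((1 + \<kappa>) / 2) * (1 + \<kappa>)" by simp
    also have "\<dots> = - (V * (b - (1 + \<kappa>)\<^sup>2 / 2))"
    proof -
      have "(D / f0) * Y = V * b" by (simp add: V_def Y_def power2_eq_square)
      then show ?thesis by (simp add: right_diff_distrib power2_eq_square)
    qed
    also have "\<dots> \<le> - ((real N * D\<^sup>2 * \<sigma> ^ 3 / (3 * f0)) * (b - (1 + \<kappa>)\<^sup>2 / 2))"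
    proof -
      have "real N * D\<^sup>2 * \<sigma>\<^sup>2 * (\<sigma> / 3) \<le> real N * D\<^sup>2 * \<sigma>\<^sup>2 * (k + \<sigma> / 3)" using k by (intro mult_left_mono) auto
      then have "real N * D\<^sup>2 * \<sigma>\<^sup>2 * (\<sigma> / 3) / f0 \<le> V" unfolding V_def using f0 by (intro divide_right_mono) auto
      moreover have "real N * D\<^sup>2 * \<sigma>\<^sup>2 * (\<sigma> / 3) / f0 = real N * D\<^sup>2 * \<sigma> ^ 3 / (3 * f0)"
        by (simp add: power2_eq_square power3_eq_cube)
      ultimately have "real N * D\<^sup>2 * \<sigma> ^ 3 / (3 * f0) \<le> V" by (simp only:)
      from mult_right_mono[OF this Bb] show ?thesis by (simp only: neg_le_iff_le)
    qed
    finally have "exp (- (D / f0) * Y + real N * ((D / f0)\<^sup>2 * ((1 + \<kappa>) * f0 * (\<sigma> ^ 3 / 3 + \<sigma>\<^sup>2 * k)) / 2 * exp (D / f0 * \<sigma>)))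
      \<le> exp (- (real N * D\<^sup>2 * \<sigma> ^ 3 / (3 * f0)) * (b - (1 + \<kappa>)\<^sup>2 / 2))" by simp
    with T(2) show "measure (sample {..<N}) {x \<in> space (sample {..<N}). \<exists>n\<le>N. Y \<le> (\<Sum>i<n. ramp (t0 - \<sigma>) (t0 + k) (x i) - (\<integral>u. ramp (t0 - \<sigma>) (t0 + k) u \<partial>\<mu>))}
      \<le> exp (- (real N * D\<^sup>2 * \<sigma> ^ 3 / (3 * f0)) * ((1 - \<kappa> / 2) / q - \<kappa> / 2 - (1 + \<kappa>)\<^sup>2 / 2))"
      unfolding b_def by (rule order_trans)
  qed (auto simp: Y_def b_def not_le)
qed

text \<open>The dual events have a probability with exponent at least \<open>2 * r * B > 1\<close>
  times \<open>ln (ln N)\<close>. The other constants give all auxiliary events an exponent of at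
  least 2, and the number of events does not grow with \<open>N\<close>.\<close>

lemma upper_block:
  assumes c: "0 < c" "3 * f0 * D < c ^ 3"
  obtains q \<epsilon> C where "1 < q" "0 < \<epsilon>"
    and "eventually (\<lambda>N. \<exists>A. A \<in> sets (sample {..<N})
        \<and> measure (sample {..<N}) A \<le> C * exp (- ((1 + \<epsilon>) * ln (ln (real N))))
        \<and> (\<forall>x\<in>space (sample {..<N}) - A. \<forall>n. 0 < n \<longrightarrow> n \<le> N \<longrightarrow> real N \<le> q * real n
              \<longrightarrow> grenander x n t0 \<le> f0 + c * rate N)) sequentially"
proof -
  define r where "r = c ^ 3 / (3 * f0 * D)"
  have fD: "0 < 3 * f0 * D" using f0 D by simp
  have r: "1 < r" using c fD by (simp add: r_def)
  obtain \<kappa> :: real where \<kappa>: "0 < \<kappa>" "\<kappa> \<le> 1/2"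
    and B1: "1 < 2 * r * ((1 - \<kappa> / 2) / (1 + \<kappa>) - \<kappa> / 2 - (1 + \<kappa>)\<^sup>2 / 2)"
    by (rule upper_constants[OF r]) (rule that)
  define q where "q = 1 + \<kappa>"
  define B where "B = (1 - \<kappa> / 2) / q - \<kappa> / 2 - (1 + \<kappa>)\<^sup>2 / 2"
  have rB: "1 < 2 * r * B" using B1 by (simp add: B_def q_def)
  have B0: "0 \<le> B" using rB r by (smt (verit) mult_nonneg_nonpos)
  have q: "1 < q" "q \<le> 2" using \<kappa> by (auto simp: q_def)
  \<comment> \<open>Capped at 1, so that the exponent 2 of the auxiliary events is at least
    \<open>1 + \<epsilon>\<close>.\<close>
  define \<epsilon> where "\<epsilon> = min 1 (2 * r * B - 1)"
  have \<epsilon>: "0 < \<epsilon>" "\<epsilon> \<le> 1" "1 + \<epsilon> \<le> 2 * r * B" using rB by (auto simp: \<epsilon>_def)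
  obtain \<eta> where e: "expands \<kappa> \<eta>" using ex_expands[OF \<kappa>(1)] .
  have \<eta>: "0 < \<eta>" "\<eta> \<le> t0 / 2" using e by (auto simp: expands_def)
  define L where "L = min \<eta> (f0 / D)"
  have L: "0 < L" "L \<le> \<eta>" "D * L \<le> f0"
  proof -
    show "0 < L" "L \<le> \<eta>" using \<eta> f0 D by (auto simp: L_def)
    have "L \<le> f0 / D" by (simp add: L_def)
    then show "D * L \<le> f0" using D by (simp add: field_simps)
  qed
  define K where "K = f (t0 - L)"
  have tL: "0 < t0 - L" using L \<eta> t0 by linarith
  have K: "f0 \<le> K" using antiD[OF tL] L f0 by (simp add: K_def)
  have K0: "0 < K" using K f0 by linarith
  have lipK: "cdf_lipschitz K (t0 - L) (t0 + L)" using tL by (intro cdf_lipschitzI) (simp_all add: K_def)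
  have lipf: "cdf_lipschitz f0 u v" if "t0 \<le> u" for u v
  proof (rule cdf_lipschitzI)
    show "0 < u" "f u \<le> f0" using that t0 f0 antiD[of t0 u] by auto
  qed
  define z where "z = D / 128"
  have z0: "0 < z" using D by (simp add: z_def)
  have zL: "z * L \<le> 4 * K" using L K f0 by (simp add: z_def)
  define cD where "cD = c ^ 3 / D ^ 3"
  have cD: "0 < cD" using c D by (simp add: cD_def)
  \<comment> \<open>Makes the peeling exponent at radius \<open>R * \<sigma>\<close> at least
    \<open>2 * ln (ln N)\<close>.\<close>
  define R where "R = max 1 (4096 * K / (z\<^sup>2 * cD))"
  have R1: "1 \<le> R" by (simp add: R_def)
  have R3: "4096 * K \<le> z\<^sup>2 * cD * R ^ 3"
  proof -
    have "4096 * K / (z\<^sup>2 * cD) \<le> R" by (simp add: R_def)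
    also have "R \<le> R ^ 3" using power_increasing[of 1 3 R] R1 by simp
    finally show ?thesis using z0 cD by (simp add: divide_le_eq mult.commute)
  qed
  \<comment> \<open>The cell width, in units of \<open>\<sigma>\<close>, for which the oscillation
    exponent is exactly \<open>2 * ln (ln N)\<close>.\<close>
  define w1 where "w1 = \<kappa>\<^sup>2 * D\<^sup>2 * cD / (18432 * f0)"
  have w1: "0 < w1" using \<kappa> D cD f0 by (simp add: w1_def)
  define J where "J = nat \<lceil>R / w1\<rceil>"
  \<comment> \<open>The summand \<open>1 / f0\<close> gives \<open>1 <= f0 * l\<close>, which rules
    out witnesses beyond \<open>t0 + l\<close>.\<close>
  define l where "l = 1 / f0 + L"
  have l: "1 \<le> f0 * l" "L \<le> l" "0 < l"
    using f0(2) L by (simp_all add: l_def distrib_left add_pos_pos)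
  define d where "d = min (f0 * l) (D * L\<^sup>2 / 64)"
  have d: "0 < d" "d \<le> f0 * l" "d \<le> D * L\<^sup>2 / 64" using f0 l D L by (auto simp: d_def)
  \<comment> \<open>4 for the far range, 8 for peeling, and for each of the \<open>J\<close> cells 4
    for its oscillation plus 1 for its dual event.\<close>
  define C :: real where "C = 4 + 8 + 5 * real J"
  define \<sigma> where "\<sigma> N = (c / D) * rate N" for N
  have small: "eventually (\<lambda>s. R * s < L / 2 \<and> s < \<eta> \<and> (1 + \<kappa>) * D * s < \<kappa> * f0 \<and> exp (D / f0 * s) < 1 + \<kappa>
      \<and> \<kappa> / 6 * D * s < f0 * w1 \<and> 8 * z * (R * s)\<^sup>2 + D * s\<^sup>2 < D * L\<^sup>2 / 32) (at_right 0)"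
  proof (intro eventually_conj)
    show "eventually (\<lambda>s. R * s < L / 2) (at_right 0)"
      by (rule eventually_less_of_tendsto[where m = "R * 0"], (intro tendsto_intros)[1]) (use L in simp)
    show "eventually (\<lambda>s. s < \<eta>) (at_right 0)"
      by (rule eventually_less_of_tendsto[where m = 0], (intro tendsto_intros)[1]) (use \<eta> in simp)
    show "eventually (\<lambda>s. (1 + \<kappa>) * D * s < \<kappa> * f0) (at_right 0)"
      by (rule eventually_less_of_tendsto[where m = "(1 + \<kappa>) * D * 0"], (intro tendsto_intros)[1]) (use \<kappa> f0 in simp)
    show "eventually (\<lambda>s. exp (D / f0 * s) < 1 + \<kappa>) (at_right 0)"
      by (rule eventually_less_of_tendsto[where m = "exp (D / f0 * 0)"], (intro tendsto_intros)[1]) (use \<kappa> in simp)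
    show "eventually (\<lambda>s. \<kappa> / 6 * D * s < f0 * w1) (at_right 0)"
      by (rule eventually_less_of_tendsto[where m = "\<kappa> / 6 * D * 0"], (intro tendsto_intros)[1]) (use f0 w1 in simp)
    show "eventually (\<lambda>s. 8 * z * (R * s)\<^sup>2 + D * s\<^sup>2 < D * L\<^sup>2 / 32) (at_right 0)"
      by (rule eventually_less_of_tendsto[where m = "8 * z * (R * 0)\<^sup>2 + D * 0\<^sup>2"], (intro tendsto_intros)[1]) (use D L in simp)
  qed
  have dpos: "0 < d\<^sup>2 / (1024 * f0 * l)" using d f0(2) l by simp
  have "eventually (\<lambda>N. \<exists>A. A \<in> sets (sample {..<N})
        \<and> measure (sample {..<N}) A \<le> C * exp (- ((1 + \<epsilon>) * ln (ln (real N))))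
        \<and> (\<forall>x\<in>space (sample {..<N}) - A. \<forall>n. 0 < n \<longrightarrow> n \<le> N \<longrightarrow> real N \<le> q * real n
              \<longrightarrow> grenander x n t0 \<le> f0 + c * rate N)) sequentially"
    using eventually_lnln_ge[of 8] eventually_gt_at_top[of 0] eventually_rate[OF small divide_pos_pos[OF c(1) D(1)]]
      eventually_lnln_le_linear[OF dpos]
  proof eventually_elim
    case elim: (elim N)
    define s where "s = \<sigma> N"
    define \<Lambda> where "\<Lambda> = ln (ln (real N))"
    have \<Lambda>: "8 \<le> \<Lambda>" using elim by (simp add: \<Lambda>_def)
    have s0: "0 < s" using rate_pos[of N] elim c D by (simp add: s_def \<sigma>_def)
    have sc: "D * s = c * rate N" using D by (simp add: s_def \<sigma>_def)
    have Ns: "real N * s ^ 3 = cD * (2 * \<Lambda>)"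
      using rate_cube[of N] elim by (simp add: s_def \<sigma>_def cD_def \<Lambda>_def power_mult_distrib power_divide)
    have sm: "R * s < L / 2" "s < \<eta>" "(1 + \<kappa>) * D * s < \<kappa> * f0" "exp (D / f0 * s) < 1 + \<kappa>"
      "\<kappa> / 6 * D * s < f0 * w1" "8 * z * (R * s)\<^sup>2 + D * s\<^sup>2 < D * L\<^sup>2 / 32"
      using elim by (auto simp: s_def \<sigma>_def)
    have sR: "s \<le> R * s" using R1 s0 by simp
    have N: "0 < N" using elim by simp
    define E where "E = exp (- ((1 + \<epsilon>) * \<Lambda>))"
    have E0: "0 \<le> E" by (simp add: E_def)
    have E2: "exp (- y) \<le> E" if "2 * \<Lambda> \<le> y" for y
    proof -
      have "(1 + \<epsilon>) * \<Lambda> \<le> 2 * \<Lambda>" using \<epsilon> \<Lambda> by (intro mult_right_mono) auto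
      then show ?thesis using that by (simp add: E_def)
    qed
    define yf where "yf = d * real N"
    have yf2: "yf\<^sup>2 / (512 * (real N * (f0 * l))) = d\<^sup>2 / (1024 * f0 * l) * real N * 2"
      using N f0 l by (simp add: yf_def power2_eq_square field_simps)
    have yfl: "2 * \<Lambda> \<le> yf\<^sup>2 / (512 * (real N * (f0 * l)))"
    proof -
      have "\<Lambda> \<le> d\<^sup>2 / (1024 * f0 * l) * real N" using elim by (simp only: \<Lambda>_def)
      then show ?thesis unfolding yf2 by linarith
    qed
    have Nfl: "0 < real N * (f0 * l)" using N f0 l by simp
    have "16 \<le> yf\<^sup>2 / (512 * (real N * (f0 * l)))" using yfl \<Lambda> by linarith
    then have "16 * (512 * (real N * (f0 * l))) \<le> yf\<^sup>2" using Nfl by (simp add: le_divide_eq)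
    then have yf3: "8192 * (real N * (f0 * l)) \<le> yf\<^sup>2" by simp
    have yf1: "0 < yf" "yf \<le> real N * (f0 * l)" 
      using d N mult_left_mono[OF d(2), of "real N"] by (auto simp: yf_def mult.commute)
    obtain AF where AF: "AF \<in> sets (sample {..<N})"
      "measure (sample {..<N}) AF \<le> 4 * exp (- yf\<^sup>2 / (512 * (real N * (f0 * l))))"
      "\<forall>x\<in>space (sample {..<N}) - AF. \<forall>n\<le>N. \<forall>t. t0 \<le> t \<longrightarrow> t \<le> t0 + l \<longrightarrow> \<bar>dev x n t - dev x n t0\<bar> \<le> yf"
      by (rule oscillation[OF lipf[OF order_refl] l(3) yf1 yf3]) (rule that)
    have AFE: "measure (sample {..<N}) AF \<le> 4 * E" using AF(2) E2[OF yfl] by (simp add: order_trans)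
    have a2: "2 * \<Lambda> \<le> z\<^sup>2 * (real N * (R * s) ^ 3) / (4096 * K)"
    proof -
      have "z\<^sup>2 * (real N * (R * s) ^ 3) = z\<^sup>2 * R ^ 3 * (real N * s ^ 3)" by (simp add: power_mult_distrib)
      also have "\<dots> = z\<^sup>2 * cD * R ^ 3 * (2 * \<Lambda>)" unfolding Ns by simp
      finally have eq: "z\<^sup>2 * (real N * (R * s) ^ 3) = z\<^sup>2 * cD * R ^ 3 * (2 * \<Lambda>)" .
      have "4096 * K * (2 * \<Lambda>) \<le> z\<^sup>2 * (real N * (R * s) ^ 3)"
        unfolding eq using \<Lambda> by (intro mult_right_mono R3) simp
      moreover have p: "0 < 4096 * K" using K0 by simp
      ultimately show ?thesis unfolding pos_le_divide_eq[OF p] by (simp only: mult.commute)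
    qed
    have a16: "16 \<le> z\<^sup>2 * (real N * (R * s) ^ 3) / (4096 * K)" using a2 \<Lambda> by linarith
    have Rs: "0 < R * s" "R * s \<le> L" using R1 s0 sm L by auto
    obtain AP where AP: "AP \<in> sets (sample {..<N})"
      "measure (sample {..<N}) AP \<le> 8 * exp (- (z\<^sup>2 * (real N * (R * s) ^ 3) / (4096 * K)))"
      "\<forall>x\<in>space (sample {..<N}) - AP. \<forall>n\<le>N. \<forall>t. \<bar>t - t0\<bar> \<le> L / 2 \<longrightarrow>
          \<bar>dev x n t - dev x n t0\<bar> \<le> 4 * (z * real N) * (max (R * s) \<bar>t - t0\<bar>)\<^sup>2"
      by (rule oscillation_peeling[OF lipK Rs K0 z0 zL refl a16]) (rule that)
    have APE: "measure (sample {..<N}) AP \<le> 8 * E" using AP(2) E2[OF a2] by linarith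
    define w where "w = w1 * s"
    have w: "0 < w" using w1 s0 by (simp add: w_def)
    define yc where "yc = \<kappa> / 6 * D * real N * s\<^sup>2"
    have yc2: "yc\<^sup>2 / (512 * (real N * (f0 * w))) = 2 * \<Lambda>"
    proof -
      have "yc\<^sup>2 = (\<kappa>\<^sup>2 * D\<^sup>2 / 36) * (real N * s) * (real N * s ^ 3)"
        by (simp add: yc_def power2_eq_square power3_eq_cube)
      also have "\<dots> = (\<kappa>\<^sup>2 * D\<^sup>2 * cD / 36) * (real N * s) * (2 * \<Lambda>)" unfolding Ns by simp
      also have "\<kappa>\<^sup>2 * D\<^sup>2 * cD / 36 = 512 * f0 * w1" using f0 by (simp add: w1_def)
      finally have "yc\<^sup>2 = (512 * (real N * (f0 * w))) * (2 * \<Lambda>)" by (simp add: w_def)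
      moreover have "512 * (real N * (f0 * w)) \<noteq> 0" using N f0 w by simp
      ultimately show ?thesis by (metis nonzero_mult_div_cancel_left)
    qed
    have Nfw: "0 < real N * (f0 * w)" using N f0 w by simp
    have "16 \<le> yc\<^sup>2 / (512 * (real N * (f0 * w)))" using yc2 \<Lambda> by linarith
    then have "16 * (512 * (real N * (f0 * w))) \<le> yc\<^sup>2" using Nfw by (simp add: le_divide_eq)
    then have yc3: "8192 * (real N * (f0 * w)) \<le> yc\<^sup>2" by simp
    have yc1: "0 < yc" using \<kappa> D N s0 by (simp add: yc_def)
    have "(\<kappa> / 6 * D * s) * (real N * s) \<le> (f0 * w1) * (real N * s)" using sm s0 by (intro mult_right_mono) auto
    then have yc0: "yc \<le> real N * (f0 * w)" by (simp add: yc_def w_def power2_eq_square mult_ac)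
    have fs: "f (t0 - s) \<le> (1 + \<kappa>) * f0"
    proof -
      have "f (t0 + (- s)) \<le> f0 - D * (- s) + \<kappa> * D * \<bar>- s\<bar>" using sm s0 by (intro expandsD[OF e]) auto
      also have "\<dots> = f0 + (1 + \<kappa>) * D * s" using s0 by (simp add: algebra_simps)
      also have "\<dots> \<le> (1 + \<kappa>) * f0" using sm by (simp add: algebra_simps)
      finally show ?thesis by simp
    qed
    have st0: "s < t0" using sm \<eta> t0 by linarith
    have "\<exists>A. A \<in> sets (sample {..<N}) \<and> measure (sample {..<N}) A \<le> 5 * E
       \<and> (\<forall>x\<in>space (sample {..<N}) - A. \<forall>n\<le>N.
         (\<forall>t. t0 + real j * w \<le> t \<longrightarrow> t \<le> t0 + real j * w + w \<longrightarrow> \<bar>dev x n t - dev x n (t0 + real j * w)\<bar> \<le> yc)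
         \<and> (\<Sum>i<n. ramp (t0 - s) (t0 + real j * w) (x i) - (\<integral>u. ramp (t0 - s) (t0 + real j * w) u \<partial>\<mu>))
        < real N * D * s\<^sup>2 * ((real j * w + s / 3) * ((1 - \<kappa> / 2) / q - \<kappa> / 2)))" for j
    proof -
      have k0: "0 \<le> real j * w" using w by simp
      then have tk: "t0 \<le> t0 + real j * w" by simp
      obtain A1 where A1: "A1 \<in> sets (sample {..<N})"
        "measure (sample {..<N}) A1 \<le> 4 * exp (- yc\<^sup>2 / (512 * (real N * (f0 * w))))"
        "\<forall>x\<in>space (sample {..<N}) - A1. \<forall>n\<le>N. \<forall>t. t0 + real j * w \<le> t \<longrightarrow> t \<le> t0 + real j * w + w \<longrightarrow>
           \<bar>dev x n t - dev x n (t0 + real j * w)\<bar> \<le> yc"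
        by (rule oscillation[OF lipf[OF tk] w yc1 yc0 yc3]) (rule that)
      have qp: "0 < q" using q by simp
      obtain A2 where A2: "A2 \<in> sets (sample {..<N})"
        "measure (sample {..<N}) A2 \<le> exp (- (real N * D\<^sup>2 * s ^ 3 / (3 * f0)) * ((1 - \<kappa> / 2) / q - \<kappa> / 2 - (1 + \<kappa>)\<^sup>2 / 2))"
        "\<forall>x\<in>space (sample {..<N}) - A2. \<forall>n\<le>N.
          (\<Sum>i<n. ramp (t0 - s) (t0 + real j * w) (x i) - (\<integral>u. ramp (t0 - s) (t0 + real j * w) u \<partial>\<mu>))
          < real N * D * s\<^sup>2 * ((real j * w + s / 3) * ((1 - \<kappa> / 2) / q - \<kappa> / 2))"
        by (rule dual_event[OF \<kappa> qp B0[unfolded B_def] N s0 st0 fs less_imp_le[OF sm(4)] k0]) (rule that)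
      have "measure (sample {..<N}) A1 \<le> 4 * E" using A1(2) E2[of "2 * \<Lambda>"] yc2 by simp
      moreover have "measure (sample {..<N}) A2 \<le> E"
      proof -
        have "real N * D\<^sup>2 * s ^ 3 / (3 * f0) = D\<^sup>2 / (3 * f0) * (real N * s ^ 3)" by simp
        also have "\<dots> = 2 * r * \<Lambda>" unfolding Ns using D f0
          by (simp add: cD_def r_def power2_eq_square power3_eq_cube)
        finally have eqB: "- (real N * D\<^sup>2 * s ^ 3 / (3 * f0)) * B = - (2 * r * B * \<Lambda>)" by simp
        have "(1 + \<epsilon>) * \<Lambda> \<le> 2 * r * B * \<Lambda>" using \<epsilon> \<Lambda> by (intro mult_right_mono) auto
        then have "exp (- (2 * r * B * \<Lambda>)) \<le> E" unfolding E_def by simp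
        moreover have "measure (sample {..<N}) A2 \<le> exp (- (real N * D\<^sup>2 * s ^ 3 / (3 * f0)) * B)"
          using A2(2) unfolding B_def .
        ultimately show ?thesis unfolding eqB by linarith
      qed
      moreover have "measure (sample {..<N}) (A1 \<union> A2) \<le> measure (sample {..<N}) A1 + measure (sample {..<N}) A2"
        by (rule measure_Un_le[OF A1(1) A2(1)])
      ultimately have "measure (sample {..<N}) (A1 \<union> A2) \<le> 5 * E" by linarith
      then show ?thesis using A1(1,3) A2(1,3) by (intro exI[of _ "A1 \<union> A2"]) auto
    qed
    then obtain AC where AC: "\<And>j. AC j \<in> sets (sample {..<N})" "\<And>j. measure (sample {..<N}) (AC j) \<le> 5 * E"
      and AC3: "\<And>j. \<forall>x\<in>space (sample {..<N}) - AC j. \<forall>n\<le>N.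
         (\<forall>t. t0 + real j * w \<le> t \<longrightarrow> t \<le> t0 + real j * w + w \<longrightarrow> \<bar>dev x n t - dev x n (t0 + real j * w)\<bar> \<le> yc)
         \<and> (\<Sum>i<n. ramp (t0 - s) (t0 + real j * w) (x i) - (\<integral>u. ramp (t0 - s) (t0 + real j * w) u \<partial>\<mu>))
        < real N * D * s\<^sup>2 * ((real j * w + s / 3) * ((1 - \<kappa> / 2) / q - \<kappa> / 2))"
      by metis
    define U where "U = (\<Union>j\<in>{..<J}. AC j)"
    have U: "U \<in> sets (sample {..<N})" using AC(1) by (auto simp: U_def)
    have "measure (sample {..<N}) U \<le> (\<Sum>j\<in>{..<J}. measure (sample {..<N}) (AC j))"
      unfolding U_def using AC(1) by (intro measure_UNION_le) auto
    also have "\<dots> \<le> (\<Sum>j\<in>{..<J}. 5 * E)" by (intro sum_mono AC(2))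
    finally have UE: "measure (sample {..<N}) U \<le> real J * (5 * E)" by simp
    define A where "A = AF \<union> AP \<union> U"
    have A: "A \<in> sets (sample {..<N})" using AF(1) AP(1) U by (simp add: A_def)
    have "measure (sample {..<N}) A \<le> measure (sample {..<N}) (AF \<union> AP) + measure (sample {..<N}) U"
      unfolding A_def using AF(1) AP(1) U by (intro measure_Un_le) auto
    also have "measure (sample {..<N}) (AF \<union> AP) \<le> measure (sample {..<N}) AF + measure (sample {..<N}) AP"
      by (rule measure_Un_le[OF AF(1) AP(1)])
    finally have AE: "measure (sample {..<N}) A \<le> C * E" using AFE APE UE by (simp add: C_def algebra_simps)
    have "grenander x n t0 \<le> f0 + c * rate N"
      if x: "x \<in> space (sample {..<N}) - A" and n: "0 < n" "n \<le> N" "real N \<le> q * real n" for x n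
    proof -
      have xF: "x \<in> space (sample {..<N}) - AF" and xP: "x \<in> space (sample {..<N}) - AP" and xU: "\<And>j. j < J \<Longrightarrow> x \<in> space (sample {..<N}) - AC j"
        using x by (auto simp: A_def U_def)
      have jJ: "j < J" if "real j * w < R * s" for j
      proof -
        have "real j * w1 < R" using that s0 by (simp add: w_def)
        then have "real j < R / w1" using w1 by (simp add: less_divide_eq)
        then show ?thesis unfolding J_def by linarith
      qed
      have dd: "2 * d + 8 * z * (R * s)\<^sup>2 + D * s\<^sup>2 < D * L\<^sup>2 / 16" using d(3) sm(6) by linarith
      have "grenander x n t0 \<le> f0 + D * s"
      proof (rule grenander_le_deterministic[OF e \<kappa> L(1) _ q n s0 sR _ _ w z_def dd l(1,2)])
        show "L / 2 \<le> \<eta>" "R * s \<le> L / 2" "s \<le> \<eta>" using L sm by auto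
        show "\<bar>dev x n t - dev x n t0\<bar> \<le> d * real N" if "n \<le> N" "t0 \<le> t" "t \<le> t0 + l" for n t
          using AF(3) xF that by (auto simp: yf_def)
        show "\<bar>dev x n t - dev x n t0\<bar> \<le> 4 * (z * real N) * (max (R * s) \<bar>t - t0\<bar>)\<^sup>2"
          if "n \<le> N" "\<bar>t - t0\<bar> \<le> L / 2" for n t
          using AP(3) xP that by blast
        show "\<bar>dev x n t - dev x n (t0 + real j * w)\<bar> \<le> \<kappa> / 6 * D * real N * s\<^sup>2"
          if "real j * w < R * s" "n \<le> N" "t0 + real j * w \<le> t" "t \<le> t0 + real j * w + w" for j n t
          using AC3[of j] xU[OF jJ] that unfolding yc_def by blast
        show "(\<Sum>i<n. ramp (t0 - s) (t0 + real j * w) (x i) - (\<integral>u. ramp (t0 - s) (t0 + real j * w) u \<partial>\<mu>))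
            < real N * D * s\<^sup>2 * ((real j * w + s / 3) * ((1 - \<kappa> / 2) / q - \<kappa> / 2))"
          if "real j * w < R * s" "n \<le> N" for j n
          using AC3[of j] xU[OF jJ] that by blast
      qed
      then show ?thesis by (simp add: sc)
    qed
    with A AE show ?case unfolding E_def \<Lambda>_def by blast
  qed
  with q(1) \<epsilon>(1) show ?thesis by (rule that)
qed

end

section \<open>The lower bound by change of measure\<close>

text \<open>The right side minus the left side is convex for
  \<open>- \<gamma> / (1 + 2 * \<gamma>) < v < 1\<close>, and its value and slope vanish at 0. The
  left end is where \<open>(1 + v) powr (- 1)\<close> equals
  \<open>(1 + 2 * \<gamma>) / (1 + \<gamma>)\<close>, which bounds the second derivative of the
  power by that of the parabola. Divided by \<open>\<gamma>\<close>, the quadratic coefficient tends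
  to 1/2, as for relative entropy.\<close>

lemma powr_le_quadratic:
  fixes \<gamma> v :: real
  assumes \<gamma>: "0 < \<gamma>" "\<gamma> \<le> 1" and v: "\<bar>v\<bar> \<le> \<gamma> / (1 + 2 * \<gamma>) / 2"
  shows "(1 + v) powr (1 + \<gamma>) \<le> 1 + (1 + \<gamma>) * v + \<gamma> * (1/2 + \<gamma>) * v\<^sup>2"
proof -
  define v0 where "v0 = \<gamma> / (1 + 2 * \<gamma>)"
  have v0: "0 < v0" "v0 < 1" using \<gamma> by (auto simp: v0_def field_simps)
  define C where "C = {- v0<..<1}"
  define g where "g v = 1 + (1 + \<gamma>) * v + \<gamma> * (1/2 + \<gamma>) * v\<^sup>2 - (1 + v) powr (1 + \<gamma>)" for v
  define g' where "g' v = (1 + \<gamma>) + \<gamma> * (1 + 2 * \<gamma>) * v - (1 + \<gamma>) * (1 + v) powr \<gamma>" for v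
  define g'' where "g'' v = \<gamma> * (1 + 2 * \<gamma>) - (1 + \<gamma>) * (\<gamma> * (1 + v) powr (\<gamma> - 1))" for v
  have d1: "(g has_real_derivative g' x) (at x)" if "x \<in> C" for x
  proof -
    have "0 < 1 + x" using that v0 by (simp add: C_def)
    then have p: "((\<lambda>v. (1 + v) powr (1 + \<gamma>)) has_real_derivative (1 + \<gamma>) * (1 + x) powr \<gamma>) (at x)"
      by (auto intro!: derivative_eq_intros)
    show ?thesis unfolding g_def g'_def
      by (rule derivative_eq_intros p refl | simp add: power2_eq_square algebra_simps)+
  qed
  have d2: "(g' has_real_derivative g'' x) (at x)" if "x \<in> C" for x
  proof -
    have "0 < 1 + x" using that v0 by (simp add: C_def)
    then have p: "((\<lambda>v. (1 + v) powr \<gamma>) has_real_derivative \<gamma> * (1 + x) powr (\<gamma> - 1)) (at x)"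
      by (auto intro!: derivative_eq_intros)
    show ?thesis unfolding g'_def g''_def
      by (rule derivative_eq_intros p refl | simp)+
  qed
  have d3: "0 \<le> g'' x" if "x \<in> C" for x
  proof -
    have x: "1 - v0 < 1 + x" using that by (simp add: C_def)
    have "(1 + x) powr (\<gamma> - 1) \<le> (1 - v0) powr (\<gamma> - 1)"
      using x v0 \<gamma> by (intro powr_mono2') auto
    also have "\<dots> \<le> (1 - v0) powr (- 1)" using v0 \<gamma> by (intro powr_mono') auto
    also have "\<dots> = (1 + 2 * \<gamma>) / (1 + \<gamma>)"
    proof -
      have "1 - v0 = (1 + \<gamma>) / (1 + 2 * \<gamma>)" using \<gamma> by (simp add: v0_def field_simps)
      then show ?thesis using v0 \<gamma> by (simp add: powr_minus_divide)
    qed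
    finally have "(1 + \<gamma>) * (1 + x) powr (\<gamma> - 1) \<le> 1 + 2 * \<gamma>" using \<gamma> by (simp add: field_simps)
    then have "\<gamma> * ((1 + \<gamma>) * (1 + x) powr (\<gamma> - 1)) \<le> \<gamma> * (1 + 2 * \<gamma>)" using \<gamma> by (intro mult_left_mono) auto
    then show ?thesis by (simp add: g''_def mult_ac)
  qed
  have conv: "convex_on C g" by (rule f''_ge0_imp_convex[OF _ d1 d2 d3]) (auto simp: C_def)
  have "\<bar>v\<bar> < v0" using v[folded v0_def] v0 by linarith
  then have vC: "v \<in> C" using v0 by (auto simp: C_def)
  have "0 \<in> interior C" using v0 by (simp add: C_def interior_open)
  moreover have "(g has_real_derivative g' 0) (at 0 within C)"
    by (rule has_field_derivative_at_within, rule d1) (use v0 in \<open>simp add: C_def\<close>)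
  ultimately have "g' 0 * (v - 0) \<le> g v - g 0"
    using vC by (intro convex_on_imp_above_tangent[OF conv]) (auto simp: C_def)
  then show ?thesis by (simp add: g_def g'_def)
qed

lemma powr_prod_nonneg:
  fixes w :: "'b \<Rightarrow> real"
  assumes "finite I" "\<And>i. i \<in> I \<Longrightarrow> 0 \<le> w i"
  shows "(\<Prod>i\<in>I. w i) powr a = (\<Prod>i\<in>I. w i powr a)"
  using assms by (induction I) (auto simp: powr_mult prod_nonneg)

section \<open>Change of measure for product laws\<close>

context real_distribution
begin

lemma density_real_distribution:
  fixes w :: "real \<Rightarrow> real"
  assumes [measurable]: "w \<in> borel_measurable borel" and "(\<integral>\<^sup>+x. ennreal (w x) \<partial>M) = 1"
  shows "real_distribution (density M (\<lambda>x. ennreal (w x)))"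
proof (rule real_distribution.intro)
  show "prob_space (density M (\<lambda>x. ennreal (w x)))"
    by (rule prob_spaceI) (use assms(2) in \<open>simp add: emeasure_density nn_integral_indicator_finite\<close>)
  show "real_distribution_axioms (density M (\<lambda>x. ennreal (w x)))"
    by (rule real_distribution_axioms.intro) simp
qed

lemma sample_density:
  fixes w :: "real \<Rightarrow> real"
  assumes [measurable]: "w \<in> borel_measurable borel" and w: "\<And>x. 0 \<le> w x" and w1: "(\<integral>\<^sup>+x. ennreal (w x) \<partial>M) = 1"
    and I: "finite I"
  shows "Pi\<^sub>M I (\<lambda>_. density M (\<lambda>x. ennreal (w x))) = density (sample I) (\<lambda>x. ennreal (\<Prod>i\<in>I. w (x i)))"
proof -
  let ?N = "density M (\<lambda>x. ennreal (w x))"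
  interpret N: real_distribution ?N by (rule density_real_distribution[OF assms(1) w1])
  interpret NP: product_prob_space "\<lambda>_::nat. ?N" by (rule N.product_prob_space_sample)
  interpret MP: product_prob_space "\<lambda>_::nat. M" by (rule product_prob_space_sample)
  have coord: "(\<lambda>x. w (x i)) \<in> borel_measurable (sample I)" if "i \<in> I" for i using that by measurable
  have meas: "(\<lambda>x. ennreal (\<Prod>i\<in>I. w (x i))) \<in> borel_measurable (sample I)"
    by (intro measurable_compose[OF _ measurable_ennreal] borel_measurable_prod coord)
  show ?thesis
  proof (rule NP.PiM_eqI[OF I, symmetric])
    show "sets (density (sample I) (\<lambda>x. ennreal (\<Prod>i\<in>I. w (x i)))) = sets (Pi\<^sub>M I (\<lambda>_. ?N))"
      by (simp only: sets_density) (intro sets_PiM_cong, auto)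
    fix A assume A: "\<And>i. i \<in> I \<Longrightarrow> A i \<in> sets ?N"
    then have A': "\<And>i. i \<in> I \<Longrightarrow> A i \<in> sets borel" by simp
    have PA: "Pi\<^sub>E I A \<in> sets (sample I)" using A' I by (intro sets_PiM_I_finite) auto
    have "emeasure (density (sample I) (\<lambda>x. ennreal (\<Prod>i\<in>I. w (x i)))) (Pi\<^sub>E I A)
       = (\<integral>\<^sup>+x. ennreal (\<Prod>i\<in>I. w (x i)) * indicator (Pi\<^sub>E I A) x \<partial>sample I)"
      by (rule emeasure_density[OF meas PA])
    also have "\<dots> = (\<integral>\<^sup>+x. (\<Prod>i\<in>I. ennreal (w (x i)) * indicator (A i) (x i)) \<partial>sample I)"
    proof (rule nn_integral_cong)
      fix x assume "x \<in> space (sample I)"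
      then have "x \<in> extensional I" by (auto simp: space_PiM PiE_def)
      then have "indicator (Pi\<^sub>E I A) x = (\<Prod>i\<in>I. indicator (A i) (x i) :: ennreal)"
        using I by (auto simp: indicator_def PiE_def Pi_def intro!: prod.neutral[symmetric])
      then show "ennreal (\<Prod>i\<in>I. w (x i)) * indicator (Pi\<^sub>E I A) x
         = (\<Prod>i\<in>I. ennreal (w (x i)) * indicator (A i) (x i))"
        using w by (simp add: prod_ennreal[symmetric] prod.distrib)
    qed
    also have "\<dots> = (\<Prod>i\<in>I. (\<integral>\<^sup>+x. ennreal (w x) * indicator (A i) x \<partial>M))"
      using A' by (intro MP.product_nn_integral_prod I) auto
    also have "\<dots> = (\<Prod>i\<in>I. emeasure ?N (A i))"
      using A' by (intro prod.cong refl emeasure_density[symmetric]) auto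
    finally show "emeasure (density (sample I) (\<lambda>x. ennreal (\<Prod>i\<in>I. w (x i)))) (Pi\<^sub>E I A)
       = (\<Prod>i\<in>I. emeasure ?N (A i))" .
  qed
qed

text \<open>A likelihood ratio larger than \<open>exp \<Lambda>\<close> is paid for with its moment of order \<open>1 + \<gamma>\<close>.\<close>

lemma change_of_measure:
  fixes w :: "real \<Rightarrow> real"
  assumes [measurable]: "w \<in> borel_measurable borel" and w: "\<And>x. 0 \<le> w x" and w1: "(\<integral>\<^sup>+x. ennreal (w x) \<partial>M) = 1"
    and \<gamma>: "0 < \<gamma>" and \<psi>: "(\<integral>\<^sup>+x. ennreal (w x powr (1 + \<gamma>)) \<partial>M) \<le> ennreal \<psi>" "0 \<le> \<psi>"
    and B: "B \<in> sets (sample {..<n})"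
  shows "measure (Pi\<^sub>M {..<n} (\<lambda>_. density M (\<lambda>x. ennreal (w x)))) B
    \<le> exp \<Lambda> * measure (sample {..<n}) B + exp (- \<gamma> * \<Lambda>) * \<psi> ^ n"
proof -
  let ?N = "density M (\<lambda>x. ennreal (w x))"
  interpret N: real_distribution ?N by (rule density_real_distribution[OF assms(1) w1])
  interpret MP: product_prob_space "\<lambda>_::nat. M" by (rule product_prob_space_sample)
  interpret S: prob_space "sample {..<n}" by (rule prob_space_sample)
  interpret NS: prob_space "Pi\<^sub>M {..<n} (\<lambda>_. ?N)" by (rule N.prob_space_sample)
  define W where "W x = (\<Prod>i\<in>{..<n}. w (x i))" for x :: "nat \<Rightarrow> real"
  have W0: "0 \<le> W x" for x using w by (simp add: W_def prod_nonneg)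
  have coord: "(\<lambda>x. w (x i)) \<in> borel_measurable (sample {..<n})" if "i \<in> {..<n}" for i using that by measurable
  have meas[measurable]: "W \<in> borel_measurable (sample {..<n})"
    unfolding W_def by (intro borel_measurable_prod coord)
  have pw: "W x * indicator B x \<le> exp \<Lambda> * indicator B x + exp (- \<gamma> * \<Lambda>) * W x powr (1 + \<gamma>)" for x
  proof (cases "W x \<le> exp \<Lambda>")
    case True
    then show ?thesis by (auto simp: indicator_def intro!: add_increasing2)
  next
    case False
    then have pos: "0 < W x" using exp_gt_zero[of \<Lambda>] by linarith
    have "exp \<Lambda> powr \<gamma> \<le> W x powr \<gamma>" using False \<gamma> by (intro powr_mono2) auto
    then have "exp (\<gamma> * \<Lambda>) \<le> W x powr \<gamma>" by (simp add: powr_def)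
    then have "exp (- \<gamma> * \<Lambda>) * exp (\<gamma> * \<Lambda>) \<le> exp (- \<gamma> * \<Lambda>) * W x powr \<gamma>" by (intro mult_left_mono) auto
    then have "1 \<le> exp (- \<gamma> * \<Lambda>) * W x powr \<gamma>" by (simp add: exp_add[symmetric])
    from mult_left_mono[OF this W0[of x]]
    have "W x \<le> exp (- \<gamma> * \<Lambda>) * W x powr (1 + \<gamma>)" using pos by (simp add: powr_add mult_ac)
    moreover have "W x * indicator B x \<le> W x" using W0[of x] by (auto simp: indicator_def)
    moreover have "0 \<le> exp \<Lambda> * (indicator B x :: real)" by simp
    ultimately show ?thesis by linarith
  qed
  have "emeasure (Pi\<^sub>M {..<n} (\<lambda>_. ?N)) B = emeasure (density (sample {..<n}) (\<lambda>x. ennreal (W x))) B"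
    unfolding W_def by (subst sample_density[OF assms(1) w w1]) auto
  also have "\<dots> = (\<integral>\<^sup>+x. ennreal (W x) * indicator B x \<partial>sample {..<n})"
    by (rule emeasure_density[OF _ B]) measurable
  also have "\<dots> \<le> (\<integral>\<^sup>+x. ennreal (exp \<Lambda>) * indicator B x + ennreal (exp (- \<gamma> * \<Lambda>)) * ennreal (W x powr (1 + \<gamma>)) \<partial>sample {..<n})"
  proof (rule nn_integral_mono)
    fix x
    have "ennreal (W x) * indicator B x = ennreal (W x * indicator B x)" by (auto simp: indicator_def)
    also have "\<dots> \<le> ennreal (exp \<Lambda> * indicator B x + exp (- \<gamma> * \<Lambda>) * W x powr (1 + \<gamma>))"
      by (rule ennreal_leI[OF pw])
    also have "\<dots> = ennreal (exp \<Lambda>) * indicator B x + ennreal (exp (- \<gamma> * \<Lambda>)) * ennreal (W x powr (1 + \<gamma>))"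
      by (auto simp: indicator_def ennreal_mult ennreal_plus)
    finally show "ennreal (W x) * indicator B x
       \<le> ennreal (exp \<Lambda>) * indicator B x + ennreal (exp (- \<gamma> * \<Lambda>)) * ennreal (W x powr (1 + \<gamma>))" .
  qed
  also have "\<dots> = ennreal (exp \<Lambda>) * emeasure (sample {..<n}) B
      + ennreal (exp (- \<gamma> * \<Lambda>)) * (\<integral>\<^sup>+x. ennreal (W x powr (1 + \<gamma>)) \<partial>sample {..<n})"
    using B by (simp add: nn_integral_add nn_integral_cmult nn_integral_cmult_indicator)
  also have "(\<integral>\<^sup>+x. ennreal (W x powr (1 + \<gamma>)) \<partial>sample {..<n})
      = (\<integral>\<^sup>+x. (\<Prod>i\<in>{..<n}. ennreal (w (x i) powr (1 + \<gamma>))) \<partial>sample {..<n})"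
    unfolding W_def using w by (intro nn_integral_cong) (simp add: powr_prod_nonneg prod_ennreal)
  also have "\<dots> = (\<Prod>i\<in>{..<n}. (\<integral>\<^sup>+x. ennreal (w x powr (1 + \<gamma>)) \<partial>M))"
    by (intro MP.product_nn_integral_prod) auto
  also have "\<dots> \<le> (\<Prod>i\<in>{..<n}. ennreal \<psi>)" by (intro prod_mono_ennreal \<psi>)
  also have "\<dots> = ennreal (\<psi> ^ n)" using \<psi> by (simp add: ennreal_power)
  finally have "ennreal (NS.prob B) \<le> ennreal (exp \<Lambda>) * ennreal (S.prob B) + ennreal (exp (- \<gamma> * \<Lambda>)) * ennreal (\<psi> ^ n)"
    by (simp add: NS.emeasure_eq_measure S.emeasure_eq_measure add_left_mono mult_left_mono)
  also have "\<dots> = ennreal (exp \<Lambda> * S.prob B + exp (- \<gamma> * \<Lambda>) * \<psi> ^ n)"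
    using \<psi> by (simp add: ennreal_mult ennreal_plus)
  finally show ?thesis using \<psi> by (subst (asm) ennreal_le_iff) auto
qed

end

section \<open>The tilted law\<close>

context decreasing_density
begin

text \<open>The tilt adds to the density, on \<open>{t0 - \<sigma><..t0 + \<tau>}\<close>, the linear excess that turns the local
  slope of the distribution function into the constant \<open>f0 + D * \<sigma>\<close>.\<close>

definition tilt :: "real \<Rightarrow> real \<Rightarrow> real \<Rightarrow> real" where
  "tilt \<sigma> \<tau> u = indicator {t0 - \<sigma><..t0 + \<tau>} u * (D / f0 * (u - t0 + \<sigma>))"

definition tilt_mean :: "real \<Rightarrow> real \<Rightarrow> real" where
  "tilt_mean \<sigma> \<tau> = (\<integral>u. tilt \<sigma> \<tau> u \<partial>\<mu>)"

text \<open>Centring restores total mass 1. It is harmless because the mean is of second order in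
  \<open>\<sigma> + \<tau>\<close>, while the tilt is of first order.\<close>

definition tilted :: "real \<Rightarrow> real \<Rightarrow> real \<Rightarrow> real" where
  "tilted \<sigma> \<tau> u = 1 + (tilt \<sigma> \<tau> u - tilt_mean \<sigma> \<tau>)"

lemma tilt_measurable[measurable]: "tilt \<sigma> \<tau> \<in> borel_measurable borel"
  unfolding tilt_def by measurable

lemma tilted_measurable[measurable]: "tilted \<sigma> \<tau> \<in> borel_measurable borel"
  unfolding tilted_def by measurable

lemma tilt_bounds:
  assumes "0 \<le> \<sigma>" "0 \<le> \<tau>"
  shows "0 \<le> tilt \<sigma> \<tau> u" "tilt \<sigma> \<tau> u \<le> D / f0 * (\<sigma> + \<tau>)"
proof -
  have p: "0 \<le> D / f0" using D f0(2) by simp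
  show "0 \<le> tilt \<sigma> \<tau> u"
  proof (cases "u \<in> {t0 - \<sigma><..t0 + \<tau>}")
    case True
    then have "0 \<le> D / f0 * (u - t0 + \<sigma>)" by (intro mult_nonneg_nonneg p) auto
    with True show ?thesis by (simp add: tilt_def)
  qed (simp add: tilt_def)
  show "tilt \<sigma> \<tau> u \<le> D / f0 * (\<sigma> + \<tau>)"
  proof (cases "u \<in> {t0 - \<sigma><..t0 + \<tau>}")
    case True
    then have "D / f0 * (u - t0 + \<sigma>) \<le> D / f0 * (\<sigma> + \<tau>)" by (intro mult_left_mono p) auto
    with True show ?thesis by (simp add: tilt_def)
  next
    case False
    have "0 \<le> D / f0 * (\<sigma> + \<tau>)" using p assms by (intro mult_nonneg_nonneg) auto
    with False show ?thesis by (simp add: tilt_def)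
  qed
qed

lemma integrable_tilt:
  assumes "0 \<le> \<sigma>" "0 \<le> \<tau>"
  shows "integrable \<mu> (tilt \<sigma> \<tau>)" "integrable \<mu> (\<lambda>u. (tilt \<sigma> \<tau> u)\<^sup>2)"
proof -
  note b = tilt_bounds[OF assms]
  show "integrable \<mu> (tilt \<sigma> \<tau>)"
    by (rule integrable_const_bound[where B = "D / f0 * (\<sigma> + \<tau>)"]) (use b in \<open>simp_all add: abs_of_nonneg\<close>)
  show "integrable \<mu> (\<lambda>u. (tilt \<sigma> \<tau> u)\<^sup>2)"
  proof (rule integrable_const_bound[where B = "(D / f0 * (\<sigma> + \<tau>))\<^sup>2"])
    show "AE u in \<mu>. norm ((tilt \<sigma> \<tau> u)\<^sup>2) \<le> (D / f0 * (\<sigma> + \<tau>))\<^sup>2"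
      by (rule AE_I2) (use b in \<open>simp add: power_mono\<close>)
  qed simp
qed

lemma tilt_mean_bounds:
  assumes s: "0 \<le> \<sigma>" "0 \<le> \<tau>" "\<sigma> < t0" and K: "f (t0 - \<sigma>) \<le> 2 * f0"
  shows "0 \<le> tilt_mean \<sigma> \<tau>" "tilt_mean \<sigma> \<tau> \<le> D * (\<sigma> + \<tau>)\<^sup>2"
proof -
  show "0 \<le> tilt_mean \<sigma> \<tau>" unfolding tilt_mean_def
    using tilt_bounds[OF s(1,2)] by (intro integral_nonneg_AE) auto
  define P where "P u = D * (u - t0 + \<sigma>)\<^sup>2" for u
  have P: "(P has_real_derivative 2 * D * (u - t0 + \<sigma>)) (at u)" for u
    unfolding P_def by (auto intro!: derivative_eq_intros)
  have p: "0 \<le> D / f0" using D f0(2) by simp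
  have int: "integrable lborel (\<lambda>u. indicator {t0 - \<sigma><..t0 + \<tau>} u * (D / f0 * (u - t0 + \<sigma>) * f u))"
  proof -
    have "integrable lborel (\<lambda>u. tilt \<sigma> \<tau> u * f u)"
      by (rule integrable_bounded_mult) (use tilt_bounds[OF s(1,2)] in \<open>simp_all add: abs_of_nonneg\<close>)
    then show ?thesis by (simp add: tilt_def mult.assoc)
  qed
  have "tilt_mean \<sigma> \<tau> = (\<integral>u. indicator {t0 - \<sigma><..t0 + \<tau>} u * (D / f0 * (u - t0 + \<sigma>) * f u) \<partial>lborel)"
    unfolding tilt_mean_def by (subst expectation_eq) (simp_all add: tilt_def mult.assoc)
  also have "\<dots> \<le> P (t0 + \<tau>) - P (t0 - \<sigma>)"
  proof (rule integral_le_primitive[OF _ P _ int])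
    fix u assume u: "t0 - \<sigma> < u" "u \<le> t0 + \<tau>"
    have "f u \<le> 2 * f0" using antiD[of "t0 - \<sigma>" u] u s K by auto
    then have "D / f0 * (u - t0 + \<sigma>) * f u \<le> D / f0 * (u - t0 + \<sigma>) * (2 * f0)"
      using u p by (intro mult_left_mono mult_nonneg_nonneg) auto
    also have "\<dots> = 2 * D * (u - t0 + \<sigma>)" using f0(2) by simp
    finally show "D / f0 * (u - t0 + \<sigma>) * f u \<le> 2 * D * (u - t0 + \<sigma>)" .
  qed (use s in \<open>simp, intro continuous_intros\<close>)
  also have "\<dots> = D * (\<sigma> + \<tau>)\<^sup>2" by (simp add: P_def add.commute)
  finally show "tilt_mean \<sigma> \<tau> \<le> D * (\<sigma> + \<tau>)\<^sup>2" .
qed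

text \<open>Up to the factor 1/2 this second moment is the price of the tilt per observation. For
  \<open>\<tau> = 0\<close> its leading term is \<open>D^2 * \<sigma>^3 / (3 * f0)\<close>, the
  quantity that also governs \<open>dual_event\<close>.\<close>

lemma tilt_square_le:
  assumes s: "0 \<le> \<sigma>" "0 \<le> \<tau>" "\<sigma> < t0" and \<kappa>: "0 \<le> \<kappa>" "f (t0 - \<sigma>) \<le> (1 + \<kappa>) * f0"
  shows "(\<integral>u. (tilt \<sigma> \<tau> u)\<^sup>2 \<partial>\<mu>) \<le> (1 + \<kappa>) * D\<^sup>2 * (\<sigma> + \<tau>) ^ 3 / (3 * f0)"
proof -
  define P where "P u = (1 + \<kappa>) * D\<^sup>2 / f0 * (u - t0 + \<sigma>) ^ 3 / 3" for u
  have P: "(P has_real_derivative (1 + \<kappa>) * D\<^sup>2 / f0 * (u - t0 + \<sigma>)\<^sup>2) (at u)" for u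
    using f0(2) unfolding P_def by (auto intro!: derivative_eq_intros)
  have int: "integrable lborel (\<lambda>u. indicator {t0 - \<sigma><..t0 + \<tau>} u * ((D / f0 * (u - t0 + \<sigma>))\<^sup>2 * f u))"
  proof -
    have "integrable lborel (\<lambda>u. (tilt \<sigma> \<tau> u)\<^sup>2 * f u)"
    proof (rule integrable_bounded_mult)
      show "\<bar>(tilt \<sigma> \<tau> u)\<^sup>2\<bar> \<le> (D / f0 * (\<sigma> + \<tau>))\<^sup>2" for u
        using tilt_bounds[OF s(1,2)] by (simp add: power_mono)
    qed simp
    moreover have "(tilt \<sigma> \<tau> u)\<^sup>2 * f u = indicator {t0 - \<sigma><..t0 + \<tau>} u * ((D / f0 * (u - t0 + \<sigma>))\<^sup>2 * f u)" for u
      by (simp add: tilt_def indicator_def)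
    ultimately show ?thesis by simp
  qed
  have "(\<integral>u. (tilt \<sigma> \<tau> u)\<^sup>2 \<partial>\<mu>) = (\<integral>u. (tilt \<sigma> \<tau> u)\<^sup>2 * f u \<partial>lborel)"
    by (rule expectation_eq) simp
  also have "\<dots> = (\<integral>u. indicator {t0 - \<sigma><..t0 + \<tau>} u * ((D / f0 * (u - t0 + \<sigma>))\<^sup>2 * f u) \<partial>lborel)"
    by (rule Bochner_Integration.integral_cong) (simp_all add: tilt_def indicator_def)
  also have "\<dots> \<le> P (t0 + \<tau>) - P (t0 - \<sigma>)"
  proof (rule integral_le_primitive[OF _ P _ int])
    fix u assume u: "t0 - \<sigma> < u" "u \<le> t0 + \<tau>"
    have "f u \<le> (1 + \<kappa>) * f0" using antiD[of "t0 - \<sigma>" u] u s \<kappa> by auto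
    then have "(D / f0 * (u - t0 + \<sigma>))\<^sup>2 * f u \<le> (D / f0 * (u - t0 + \<sigma>))\<^sup>2 * ((1 + \<kappa>) * f0)"
      by (intro mult_left_mono) auto
    also have "\<dots> = (1 + \<kappa>) * D\<^sup>2 / f0 * (u - t0 + \<sigma>)\<^sup>2"
      using f0(2) by (simp add: power_mult_distrib power_divide) (simp add: power2_eq_square)
    finally show "(D / f0 * (u - t0 + \<sigma>))\<^sup>2 * f u \<le> (1 + \<kappa>) * D\<^sup>2 / f0 * (u - t0 + \<sigma>)\<^sup>2" .
  qed (use s in \<open>simp, intro continuous_intros\<close>)
  also have "\<dots> = (1 + \<kappa>) * D\<^sup>2 * (\<sigma> + \<tau>) ^ 3 / (3 * f0)" by (simp add: P_def add.commute)
  finally show ?thesis .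
qed

lemma integral_tilted:
  assumes s: "0 \<le> \<sigma>" "0 \<le> \<tau>"
  shows "(\<integral>u. tilt \<sigma> \<tau> u - tilt_mean \<sigma> \<tau> \<partial>\<mu>) = 0"
    and "(\<integral>u. (tilt \<sigma> \<tau> u - tilt_mean \<sigma> \<tau>)\<^sup>2 \<partial>\<mu>) \<le> (\<integral>u. (tilt \<sigma> \<tau> u)\<^sup>2 \<partial>\<mu>)"
    and "integrable \<mu> (\<lambda>u. (tilt \<sigma> \<tau> u - tilt_mean \<sigma> \<tau>)\<^sup>2)"
proof -
  note i = integrable_tilt[OF s]
  show "(\<integral>u. tilt \<sigma> \<tau> u - tilt_mean \<sigma> \<tau> \<partial>\<mu>) = 0"
    using i prob_space by (simp add: tilt_mean_def)
  have eq: "(tilt \<sigma> \<tau> u - tilt_mean \<sigma> \<tau>)\<^sup>2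
     = (tilt \<sigma> \<tau> u)\<^sup>2 - 2 * tilt_mean \<sigma> \<tau> * tilt \<sigma> \<tau> u + (tilt_mean \<sigma> \<tau>)\<^sup>2" for u
    by (simp add: power2_diff algebra_simps)
  show "integrable \<mu> (\<lambda>u. (tilt \<sigma> \<tau> u - tilt_mean \<sigma> \<tau>)\<^sup>2)"
    unfolding eq using i by simp
  have "(\<integral>u. (tilt \<sigma> \<tau> u - tilt_mean \<sigma> \<tau>)\<^sup>2 \<partial>\<mu>) = (\<integral>u. (tilt \<sigma> \<tau> u)\<^sup>2 \<partial>\<mu>) - (tilt_mean \<sigma> \<tau>)\<^sup>2"
    unfolding eq using i prob_space by (simp add: tilt_mean_def[symmetric] power2_eq_square)
  then show "(\<integral>u. (tilt \<sigma> \<tau> u - tilt_mean \<sigma> \<tau>)\<^sup>2 \<partial>\<mu>) \<le> (\<integral>u. (tilt \<sigma> \<tau> u)\<^sup>2 \<partial>\<mu>)" by simp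
qed

lemma tilted_bounds:
  assumes s: "0 \<le> \<sigma>" "0 \<le> \<tau>" "\<sigma> < t0" "f (t0 - \<sigma>) \<le> 2 * f0"
    and b: "D / f0 * (\<sigma> + \<tau>) \<le> b" "D * (\<sigma> + \<tau>)\<^sup>2 \<le> b"
  shows "\<bar>tilt \<sigma> \<tau> u - tilt_mean \<sigma> \<tau>\<bar> \<le> b" "1 - b \<le> tilted \<sigma> \<tau> u" "tilted \<sigma> \<tau> u \<le> 1 + b"
proof -
  have *: "0 \<le> tilt \<sigma> \<tau> u" "tilt \<sigma> \<tau> u \<le> b" "0 \<le> tilt_mean \<sigma> \<tau>" "tilt_mean \<sigma> \<tau> \<le> b"
    using tilt_bounds[OF s(1,2), of u] tilt_mean_bounds[OF s] b by linarith+
  then show "\<bar>tilt \<sigma> \<tau> u - tilt_mean \<sigma> \<tau>\<bar> \<le> b" by linarith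
  show "1 - b \<le> tilted \<sigma> \<tau> u" "tilted \<sigma> \<tau> u \<le> 1 + b" unfolding tilted_def using * by linarith+
qed

lemma nn_integral_tilted:
  assumes s: "0 \<le> \<sigma>" "0 \<le> \<tau>" and nn: "\<And>u. 0 \<le> tilted \<sigma> \<tau> u"
  shows "(\<integral>\<^sup>+u. ennreal (tilted \<sigma> \<tau> u) \<partial>\<mu>) = 1"
proof -
  have i: "integrable \<mu> (tilted \<sigma> \<tau>)" unfolding tilted_def[abs_def] using integrable_tilt[OF s] by simp
  have "(\<integral>\<^sup>+u. ennreal (tilted \<sigma> \<tau> u) \<partial>\<mu>) = ennreal (\<integral>u. tilted \<sigma> \<tau> u \<partial>\<mu>)"
    by (rule nn_integral_eq_integral[OF i]) (simp add: nn)
  also have "(\<integral>u. tilted \<sigma> \<tau> u \<partial>\<mu>) = 1"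
    unfolding tilted_def using integrable_tilt[OF s] prob_space by (simp add: tilt_mean_def)
  finally show ?thesis by simp
qed

lemma nn_integral_tilted_powr:
  assumes s: "0 \<le> \<sigma>" "0 \<le> \<tau>" and \<gamma>: "0 < \<gamma>" "\<gamma> \<le> 1"
    and b: "\<And>u. \<bar>tilt \<sigma> \<tau> u - tilt_mean \<sigma> \<tau>\<bar> \<le> \<gamma> / (1 + 2 * \<gamma>) / 2"
    and V: "(\<integral>u. (tilt \<sigma> \<tau> u)\<^sup>2 \<partial>\<mu>) \<le> V"
  shows "(\<integral>\<^sup>+u. ennreal (tilted \<sigma> \<tau> u powr (1 + \<gamma>)) \<partial>\<mu>) \<le> ennreal (exp (\<gamma> * (1/2 + \<gamma>) * V))"
proof -
  define v where "v u = tilt \<sigma> \<tau> u - tilt_mean \<sigma> \<tau>" for u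
  have iv: "integrable \<mu> v" unfolding v_def[abs_def] using integrable_tilt[OF s] by simp
  have iv2: "integrable \<mu> (\<lambda>u. (v u)\<^sup>2)" unfolding v_def by (rule integral_tilted(3)[OF s])
  have le: "tilted \<sigma> \<tau> u powr (1 + \<gamma>) \<le> 1 + (1 + \<gamma>) * v u + \<gamma> * (1/2 + \<gamma>) * (v u)\<^sup>2" for u
    unfolding tilted_def v_def by (rule powr_le_quadratic[OF \<gamma> b])
  have "(\<integral>\<^sup>+u. ennreal (tilted \<sigma> \<tau> u powr (1 + \<gamma>)) \<partial>\<mu>)
      \<le> (\<integral>\<^sup>+u. ennreal (1 + (1 + \<gamma>) * v u + \<gamma> * (1/2 + \<gamma>) * (v u)\<^sup>2) \<partial>\<mu>)"
    by (intro nn_integral_mono ennreal_leI le)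
  also have "\<dots> = ennreal (\<integral>u. 1 + (1 + \<gamma>) * v u + \<gamma> * (1/2 + \<gamma>) * (v u)\<^sup>2 \<partial>\<mu>)"
  proof (rule nn_integral_eq_integral)
    show "integrable \<mu> (\<lambda>u. 1 + (1 + \<gamma>) * v u + \<gamma> * (1/2 + \<gamma>) * (v u)\<^sup>2)" using iv iv2 by simp
    show "AE u in \<mu>. 0 \<le> 1 + (1 + \<gamma>) * v u + \<gamma> * (1/2 + \<gamma>) * (v u)\<^sup>2"
      by (rule AE_I2) (rule order_trans[OF powr_ge_zero le])
  qed
  also have "(\<integral>u. 1 + (1 + \<gamma>) * v u + \<gamma> * (1/2 + \<gamma>) * (v u)\<^sup>2 \<partial>\<mu>)
      = 1 + \<gamma> * (1/2 + \<gamma>) * (\<integral>u. (v u)\<^sup>2 \<partial>\<mu>)"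
  proof -
    have "(\<integral>u. v u \<partial>\<mu>) = 0" unfolding v_def by (rule integral_tilted(1)[OF s])
    then show ?thesis using iv iv2 prob_space by simp
  qed
  also have "\<dots> \<le> 1 + \<gamma> * (1/2 + \<gamma>) * V"
  proof -
    have "(\<integral>u. (v u)\<^sup>2 \<partial>\<mu>) \<le> V" unfolding v_def by (rule order_trans[OF integral_tilted(2)[OF s] V])
    then show ?thesis using \<gamma> by (intro add_left_mono mult_left_mono) auto
  qed
  also have "\<dots> \<le> exp (\<gamma> * (1/2 + \<gamma>) * V)" by (rule exp_ge_add_one_self)
  finally show ?thesis by (simp add: ennreal_leI)
qed

abbreviation tilted_law :: "real \<Rightarrow> real \<Rightarrow> real measure" where
  "tilted_law \<sigma> \<tau> \<equiv> density \<mu> (\<lambda>u. ennreal (tilted \<sigma> \<tau> u))"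

lemma tilted_law_Ioc:
  assumes s: "0 \<le> \<sigma>" "0 \<le> \<tau>" and nn: "\<And>u. 0 \<le> tilted \<sigma> \<tau> u" and ab: "a \<le> b"
  shows "cdf (tilted_law \<sigma> \<tau>) b - cdf (tilted_law \<sigma> \<tau>) a
     = (1 - tilt_mean \<sigma> \<tau>) * (cdf \<mu> b - cdf \<mu> a) + (\<integral>u. indicator {a<..b} u * (tilt \<sigma> \<tau> u * f u) \<partial>lborel)"
proof -
  interpret N: real_distribution "tilted_law \<sigma> \<tau>"
    by (rule density_real_distribution[OF _ nn_integral_tilted[OF s nn]]) simp
  have it: "integrable lborel (\<lambda>u. indicator {a<..b} u * (tilt \<sigma> \<tau> u * f u))"
  proof -
    have "integrable lborel (\<lambda>u. (indicator {a<..b} u * tilt \<sigma> \<tau> u) * f u)"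
    proof (rule integrable_bounded_mult)
      show "\<bar>indicator {a<..b} u * tilt \<sigma> \<tau> u\<bar> \<le> D / f0 * (\<sigma> + \<tau>)" for u
        using tilt_bounds[OF s, of u] by (auto simp: indicator_def)
    qed simp
    then show ?thesis by (simp only: mult.assoc)
  qed
  have "cdf (tilted_law \<sigma> \<tau>) b - cdf (tilted_law \<sigma> \<tau>) a = measure (tilted_law \<sigma> \<tau>) {a<..b}"
    using ab by (cases "a = b") (auto simp: N.cdf_diff_eq)
  also have "\<dots> = (\<integral>u. indicator {a<..b} u \<partial>tilted_law \<sigma> \<tau>)" by simp
  also have "\<dots> = (\<integral>u. tilted \<sigma> \<tau> u *\<^sub>R indicator {a<..b} u \<partial>\<mu>)"
    by (rule integral_density) (simp_all add: nn)
  also have "\<dots> = (\<integral>u. (tilted \<sigma> \<tau> u *\<^sub>R indicator {a<..b} u) * f u \<partial>lborel)"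
    by (rule expectation_eq) simp
  also have "\<dots> = (\<integral>u. (1 - tilt_mean \<sigma> \<tau>) * (indicator {a<..b} u * f u) + indicator {a<..b} u * (tilt \<sigma> \<tau> u * f u) \<partial>lborel)"
    by (rule Bochner_Integration.integral_cong) (simp_all add: tilted_def algebra_simps)
  also have "\<dots> = (1 - tilt_mean \<sigma> \<tau>) * (cdf \<mu> b - cdf \<mu> a) + (\<integral>u. indicator {a<..b} u * (tilt \<sigma> \<tau> u * f u) \<partial>lborel)"
    using it integrable_indicator_f ab by (simp add: cdf_diff)
  finally show ?thesis .
qed

lemma tilted_law_lipschitz:
  assumes s: "0 \<le> \<sigma>" "0 \<le> \<tau>" and nn: "\<And>u. 0 \<le> tilted \<sigma> \<tau> u" and le: "\<And>u. tilted \<sigma> \<tau> u \<le> 2"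
    and K: "0 < c" "f c \<le> K"
  shows "real_distribution.cdf_lipschitz (tilted_law \<sigma> \<tau>) (2 * K) c d"
proof -
  interpret N: real_distribution "tilted_law \<sigma> \<tau>"
    by (rule density_real_distribution[OF _ nn_integral_tilted[OF s nn]]) simp
  show ?thesis unfolding N.cdf_lipschitz_def
  proof (intro allI impI)
    fix a b assume ab: "c \<le> a" "a \<le> b" "b \<le> d"
    have "cdf (tilted_law \<sigma> \<tau>) b - cdf (tilted_law \<sigma> \<tau>) a = measure (tilted_law \<sigma> \<tau>) {a<..b}"
      using ab by (cases "a = b") (auto simp: N.cdf_diff_eq)
    also have "\<dots> = (\<integral>u. indicator {a<..b} u \<partial>tilted_law \<sigma> \<tau>)" by simp
    also have "\<dots> = (\<integral>u. tilted \<sigma> \<tau> u *\<^sub>R indicator {a<..b} u \<partial>\<mu>)"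
      by (rule integral_density) (simp_all add: nn)
    also have "\<dots> \<le> (\<integral>u. 2 * indicator {a<..b} u \<partial>\<mu>)"
    proof (rule integral_mono)
      show "integrable \<mu> (\<lambda>u. tilted \<sigma> \<tau> u *\<^sub>R (indicator {a<..b} u :: real))"
        by (rule integrable_const_bound[where B = 2]) (use nn le in \<open>auto simp: indicator_def\<close>)
      show "integrable \<mu> (\<lambda>u. 2 * indicator {a<..b} u :: real)"
        by (rule integrable_const_bound[where B = 2]) (auto simp: indicator_def)
      show "tilted \<sigma> \<tau> u *\<^sub>R indicator {a<..b} u \<le> (2 * indicator {a<..b} u :: real)" for u
        using le[of u] by (simp add: indicator_def)
    qed
    also have "\<dots> = 2 * (\<integral>u. indicator {a<..b} u * f u \<partial>lborel)"
      by (subst expectation_eq) (simp_all add: mult.assoc)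
    also have "\<dots> = 2 * (cdf \<mu> b - cdf \<mu> a)" using ab by (simp add: cdf_diff)
    also have "cdf \<mu> b - cdf \<mu> a \<le> K * (b - a)"
    proof (rule cdf_diff_le[OF ab(2)])
      fix u assume "a < u"
      then show "f u \<le> K" using antiD[of c u] K ab by linarith
    qed
    finally show "cdf (tilted_law \<sigma> \<tau>) b - cdf (tilted_law \<sigma> \<tau>) a \<le> 2 * K * (b - a)" by (simp add: mult.assoc)
  qed
qed

text \<open>The tilted density is close to \<open>f0 + D * \<sigma>\<close> on
  \<open>{t0 - \<sigma><..t0 + \<tau>}\<close>, and further left \<open>f\<close> itself is about
  that large or larger. So the mass of \<open>{t0 - h<..t0 + \<tau>}\<close> is at least about
  \<open>(f0 + D * \<sigma>) * (\<tau> + h)\<close>; the subtracted terms come from the expansion of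
  \<open>f\<close> and from centring the tilt.\<close>

lemma tilted_law_ge:
  assumes e: "expands \<kappa> \<eta>" and \<kappa>: "0 < \<kappa>" "\<kappa> \<le> 1" and s: "0 \<le> \<sigma>" "0 \<le> \<tau>" "\<sigma> \<le> \<eta>" "\<tau> \<le> \<eta>"
    and nn: "\<And>u. 0 \<le> tilted \<sigma> \<tau> u" and f2: "f (t0 - \<eta>) \<le> 2 * f0"
    and sm: "(1 + \<kappa>) * D * \<tau> \<le> \<kappa> * f0" and h: "0 \<le> h" "h \<le> \<eta>"
  shows "f0 * (\<tau> + h) + D * \<sigma> * (\<tau> + h) - \<kappa> * D / 2 * (h\<^sup>2 + \<tau>\<^sup>2 + (\<sigma> + \<tau>)\<^sup>2)
      - D * (\<sigma> + \<tau>)\<^sup>2 * (2 * f0 * (\<tau> + h))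
    \<le> cdf (tilted_law \<sigma> \<tau>) (t0 + \<tau>) - cdf (tilted_law \<sigma> \<tau>) (t0 - h)"
proof -
  have \<eta>: "0 < \<eta>" "\<eta> < t0" using e t0 by (auto simp: expands_def)
  \<comment> \<open>The tilt vanishes to the left of \<open>t0 - \<sigma>\<close>, so only this much
    of \<open>h\<close> is affected by it.\<close>
  define h' where "h' = min h \<sigma>"
  have h': "0 \<le> h'" "h' \<le> h" "h' \<le> \<sigma>" using h s by (auto simp: h'_def)
  define p where "p = cdf \<mu> (t0 + \<tau>) - cdf \<mu> (t0 - h)"
  have p1: "f0 * \<tau> - (1 + \<kappa>) * D * \<tau>\<^sup>2 / 2 + (f0 * h + (1 - \<kappa>) * D * h\<^sup>2 / 2) \<le> p"
    using cdf_right(2)[OF e s(2,4)] cdf_left(2)[OF e h] unfolding p_def by linarith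
  have p2: "p \<le> 2 * f0 * (\<tau> + h)"
  proof -
    have "p \<le> 2 * f0 * (t0 + \<tau> - (t0 - h))" unfolding p_def
    proof (rule cdf_diff_le)
      fix u assume "t0 - h < u"
      then show "f u \<le> 2 * f0" using antiD[of "t0 - \<eta>" u] f2 \<eta> h by linarith
    qed (use s h in simp)
    then show ?thesis by (simp add: add.commute)
  qed
  have p0: "0 \<le> p" unfolding p_def using cdf_nondecreasing[of "t0 - h" "t0 + \<tau>"] s h by simp
  have fs: "f (t0 - \<sigma>) \<le> 2 * f0" using antiD[of "t0 - \<eta>" "t0 - \<sigma>"] f2 \<eta> s by linarith
  have "\<sigma> < t0" using s \<eta> by linarith
  note tm = tilt_mean_bounds[OF s(1,2) this fs]
  have fl: "(1 - \<kappa>) * f0 \<le> f u" if "0 < u" "u \<le> t0 + \<tau>" for u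
  proof -
    have "f0 - D * \<tau> - \<kappa> * D * \<bar>\<tau>\<bar> \<le> f (t0 + \<tau>)" using s by (intro expandsD[OF e]) auto
    moreover have "f0 - D * \<tau> - \<kappa> * D * \<bar>\<tau>\<bar> = f0 - (1 + \<kappa>) * D * \<tau>" using s by (simp add: algebra_simps)
    moreover have "(1 - \<kappa>) * f0 = f0 - \<kappa> * f0" by (simp add: algebra_simps)
    ultimately show ?thesis using antiD[OF that] sm by linarith
  qed
  define P where "P u = (1 - \<kappa>) * D * (u - t0 + \<sigma>)\<^sup>2 / 2" for u
  have P: "(P has_real_derivative (1 - \<kappa>) * D * (u - t0 + \<sigma>)) (at u)" for u
    unfolding P_def by (auto intro!: derivative_eq_intros)
  have it: "integrable lborel (\<lambda>u. indicator {a<..b} u * (tilt \<sigma> \<tau> u * f u))" for a b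
  proof -
    have "integrable lborel (\<lambda>u. (indicator {a<..b} u * tilt \<sigma> \<tau> u) * f u)"
    proof (rule integrable_bounded_mult)
      show "\<bar>indicator {a<..b} u * tilt \<sigma> \<tau> u\<bar> \<le> D / f0 * (\<sigma> + \<tau>)" for u
        using tilt_bounds[OF s(1,2), of u] by (auto simp: indicator_def)
    qed simp
    then show ?thesis by (simp only: mult.assoc)
  qed
  have "P (t0 + \<tau>) - P (t0 - h') \<le> (\<integral>u. indicator {t0 - h'<..t0 + \<tau>} u * (tilt \<sigma> \<tau> u * f u) \<partial>lborel)"
  proof (rule integral_ge_primitive[OF _ P _ it])
    fix u assume u: "t0 - h' < u" "u \<le> t0 + \<tau>"
    have "0 < u" using u h' s \<eta> by linarith
    have p: "0 \<le> D / f0 * (u - t0 + \<sigma>)" using D f0(2) u h' by (intro mult_nonneg_nonneg) auto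
    have "(1 - \<kappa>) * D * (u - t0 + \<sigma>) = D / f0 * (u - t0 + \<sigma>) * ((1 - \<kappa>) * f0)" using f0(2) by simp
    also have "\<dots> \<le> D / f0 * (u - t0 + \<sigma>) * f u" by (intro mult_left_mono fl p u \<open>0 < u\<close>)
    also have "D / f0 * (u - t0 + \<sigma>) = tilt \<sigma> \<tau> u" using u h' by (simp add: tilt_def)
    finally show "(1 - \<kappa>) * D * (u - t0 + \<sigma>) \<le> tilt \<sigma> \<tau> u * f u" .
  qed (use s h' in \<open>simp, intro continuous_intros\<close>)
  also have "\<dots> \<le> (\<integral>u. indicator {t0 - h<..t0 + \<tau>} u * (tilt \<sigma> \<tau> u * f u) \<partial>lborel)"
    using it h' tilt_bounds(1)[OF s(1,2)] nonneg by (intro integral_mono) (auto simp: indicator_def)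
  finally have T: "P (t0 + \<tau>) - P (t0 - h') \<le> (\<integral>u. indicator {t0 - h<..t0 + \<tau>} u * (tilt \<sigma> \<tau> u * f u) \<partial>lborel)" .
  define X where "X = (\<sigma> + \<tau>)\<^sup>2 - (\<sigma> - h')\<^sup>2"
  have PX: "P (t0 + \<tau>) - P (t0 - h') = (1 - \<kappa>) * (D / 2 * X)" by (simp add: P_def X_def algebra_simps)
  \<comment> \<open>For \<open>h <= \<sigma>\<close> both sides agree; beyond, they differ by
    \<open>(h - \<sigma>)^2\<close>, which reflects the growth of the untilted density.\<close>
  have key: "2 * \<sigma> * (\<tau> + h) \<le> X - \<tau>\<^sup>2 + h\<^sup>2"
  proof (cases "h \<le> \<sigma>")
    case True
    then have "h' = h" by (simp add: h'_def)
    then show ?thesis by (simp add: X_def power2_eq_square algebra_simps)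
  next
    case False
    then have "h' = \<sigma>" by (simp add: h'_def)
    have "0 \<le> (h - \<sigma>)\<^sup>2" by simp
    then show ?thesis using \<open>h' = \<sigma>\<close> by (simp add: X_def power2_eq_square algebra_simps)
  qed
  have X1: "X \<le> (\<sigma> + \<tau>)\<^sup>2" by (simp add: X_def)
  have "D / 2 * (2 * \<sigma> * (\<tau> + h)) \<le> D / 2 * (X - \<tau>\<^sup>2 + h\<^sup>2)" using D by (intro mult_left_mono key) auto
  moreover have "\<kappa> * D / 2 * X \<le> \<kappa> * D / 2 * (\<sigma> + \<tau>)\<^sup>2" using \<kappa> D X1 by (intro mult_left_mono) auto
  ultimately have A: "D * \<sigma> * (\<tau> + h) - \<kappa> * D / 2 * (h\<^sup>2 + \<tau>\<^sup>2 + (\<sigma> + \<tau>)\<^sup>2)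
      \<le> (1 - \<kappa>) * (D / 2 * X) - (1 + \<kappa>) * D * \<tau>\<^sup>2 / 2 + (1 - \<kappa>) * D * h\<^sup>2 / 2"
  proof -
    have "(1 - \<kappa>) * (D / 2 * X) - (1 + \<kappa>) * D * \<tau>\<^sup>2 / 2 + (1 - \<kappa>) * D * h\<^sup>2 / 2
        = D / 2 * (X - \<tau>\<^sup>2 + h\<^sup>2) - \<kappa> * D / 2 * X - \<kappa> * D / 2 * (\<tau>\<^sup>2 + h\<^sup>2)" for X
      by (simp add: field_simps)
    moreover have "D * \<sigma> * (\<tau> + h) - \<kappa> * D / 2 * (h\<^sup>2 + \<tau>\<^sup>2 + S)
        = D / 2 * (2 * \<sigma> * (\<tau> + h)) - \<kappa> * D / 2 * (\<tau>\<^sup>2 + h\<^sup>2) - \<kappa> * D / 2 * S" for S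
      by (simp add: field_simps)
    ultimately show ?thesis
      using \<open>D / 2 * (2 * \<sigma> * (\<tau> + h)) \<le> D / 2 * (X - \<tau>\<^sup>2 + h\<^sup>2)\<close>
        \<open>\<kappa> * D / 2 * X \<le> \<kappa> * D / 2 * (\<sigma> + \<tau>)\<^sup>2\<close> by (simp only:)
  qed
  have "tilt_mean \<sigma> \<tau> * p \<le> D * (\<sigma> + \<tau>)\<^sup>2 * (2 * f0 * (\<tau> + h))"
    using tm p0 p2 D by (intro mult_mono) auto
  moreover have "cdf (tilted_law \<sigma> \<tau>) (t0 + \<tau>) - cdf (tilted_law \<sigma> \<tau>) (t0 - h)
     = (1 - tilt_mean \<sigma> \<tau>) * p + (\<integral>u. indicator {t0 - h<..t0 + \<tau>} u * (tilt \<sigma> \<tau> u * f u) \<partial>lborel)"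
    unfolding p_def using s h by (intro tilted_law_Ioc nn) auto
  moreover have "(1 - tilt_mean \<sigma> \<tau>) * p = p - tilt_mean \<sigma> \<tau> * p" by (simp add: algebra_simps)
  moreover have "f0 * (\<tau> + h) = f0 * \<tau> + f0 * h" by (simp add: algebra_simps)
  ultimately show ?thesis using A T[unfolded PX] p1 by linarith
qed

end

section \<open>Splitting and truncating samples\<close>

lemma cnt_add: "cnt x (m + k) t = cnt x m t + cnt (\<lambda>i. x (m + i)) k t"
proof (induction k)
  case (Suc k)
  then show ?case by (simp add: cnt_def)
qed (simp add: cnt_def)

lemma cnt_restrict: "n \<le> N \<Longrightarrow> cnt (restrict x {..<N}) n t = cnt x n t"
  unfolding cnt_def by (intro sum.cong) auto

lemma grenander_restrict:
  assumes "n \<le> N" shows "grenander (restrict x {..<N}) n t = grenander x n t"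
proof -
  have "emp_cdf (restrict x {..<N}) n = emp_cdf x n"
    using cnt_restrict[OF assms] by (auto simp: emp_cdf_eq_cnt)
  then show ?thesis by (simp add: grenander_def)
qed

lemma (in real_distribution) dev_restrict: "n \<le> N \<Longrightarrow> dev (restrict x {..<N}) n t = dev x n t"
  unfolding dev_def by (intro sum.cong) auto

lemma (in real_distribution) restrict_space_sample: "restrict x I \<in> space (sample I)"
  by (auto simp: space_PiM)

context decreasing_density
begin

lemma expands_subset: "expands \<kappa> \<eta> \<Longrightarrow> 0 < L \<Longrightarrow> L \<le> \<eta> \<Longrightarrow> expands \<kappa> L"
  unfolding expands_def by (meson order_trans)

text \<open>The witness is \<open>t0 + \<tau>\<close>. Near \<open>t0\<close> the new observations
  follow \<open>\<nu>\<close>, whose surplus \<open>k * g\<close> pays for the deficit of the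
  \<open>m\<close> older ones and for four fluctuations of size \<open>Y\<close>. At larger distance
  the quadratic gain of the distribution function suffices. Close to 0 the density may be unbounded,
  so that chaining cannot start there; points below \<open>e0\<close> are compared with
  \<open>e0\<close> by monotonicity of the count, at a price within the reserve
  \<open>D * L^2 / 64\<close>.\<close>

lemma grenander_ge_deterministic:
  fixes x :: "nat \<Rightarrow> real" and \<sigma> s \<tau> \<kappa> L z R d e0 Y g :: real and N m k :: nat and \<nu> :: "real \<Rightarrow> real"
  assumes e: "expands \<kappa> L" and \<kappa>: "0 < \<kappa>" "\<kappa> \<le> 1/2"
    and N: "N = m + k" "0 < N"
    and s: "0 < s" "s \<le> \<sigma>" "0 \<le> \<tau>" "\<tau> \<le> \<sigma>" "16 \<le> R" "R * \<sigma> \<le> L / 2"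
    and z: "z = D / 512"
    and e0: "0 < e0" "e0 \<le> t0 - L / 2" "(f0 + D * s) * e0 \<le> D * L\<^sup>2 / 64"
    and small: "f0 * \<tau> + D * \<sigma> * (\<tau> + t0) + 4 * z * (R * \<sigma>)\<^sup>2 + 2 * d \<le> 3 / 64 * (D * L\<^sup>2)"
    and margin: "4 * Y + real m * (D * (\<tau>\<^sup>2 + \<sigma> * (\<tau> + R * \<sigma>))) \<le> real k * g"
    and drift: "\<And>h. 0 \<le> h \<Longrightarrow> h \<le> R * \<sigma> \<Longrightarrow> (f0 + D * s) * (\<tau> + h) + g \<le> \<nu> (t0 + \<tau>) - \<nu> (t0 - h)"
    and new: "\<And>t. \<bar>t - t0\<bar> \<le> R * \<sigma> \<Longrightarrow>
       \<bar>(cnt (\<lambda>i. x (m + i)) k t - real k * \<nu> t) - (cnt (\<lambda>i. x (m + i)) k t0 - real k * \<nu> t0)\<bar> \<le> Y"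
    and old: "\<And>t. \<bar>t - t0\<bar> \<le> R * \<sigma> \<Longrightarrow> \<bar>dev x m t - dev x m t0\<bar> \<le> Y"
    and peel: "\<And>t. \<bar>t - t0\<bar> \<le> L / 2 \<Longrightarrow>
        \<bar>dev x N t - dev x N t0\<bar> \<le> 4 * (z * real N) * (max (R * \<sigma>) \<bar>t - t0\<bar>)\<^sup>2"
    and far: "\<And>t. e0 \<le> t \<Longrightarrow> t \<le> t0 \<Longrightarrow> \<bar>dev x N t - dev x N e0\<bar> \<le> d * real N"
  shows "f0 + D * s \<le> grenander x N t0"
proof -
  define a where "a = f0 + D * s"
  have a0: "0 \<le> a" using f0(2) D s by (simp add: a_def add_nonneg_nonneg)
  have L: "0 < L" "L \<le> t0 / 2" using e by (auto simp: expands_def)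
  have \<sigma>: "0 < \<sigma>" "\<tau> \<le> R * \<sigma>" "16 * \<sigma> \<le> R * \<sigma>"
  proof -
    show "0 < \<sigma>" using s by linarith
    then show "16 * \<sigma> \<le> R * \<sigma>" using s by (intro mult_right_mono) auto
    then show "\<tau> \<le> R * \<sigma>" using s \<open>0 < \<sigma>\<close> by linarith
  qed
  have \<tau>L: "\<tau> \<le> L" using \<sigma> s L by linarith
  have z0: "0 \<le> z * real N" using D by (simp add: z)
  have f_ge: "f0 \<le> f u" if "0 < u" "u \<le> t0" for u using antiD[OF that] f0 by simp
  have cnt_eq: "cnt x n b - cnt x n c = (dev x n b - dev x n c) + real n * (cdf \<mu> b - cdf \<mu> c)" for n b c
    by (simp add: dev_eq_cnt algebra_simps)
  have right: "f0 * \<tau> - D * \<tau>\<^sup>2 \<le> cdf \<mu> (t0 + \<tau>) - cdf \<mu> t0"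
  proof -
    have "f0 * \<tau> - (1 + \<kappa>) * D * \<tau>\<^sup>2 / 2 \<le> cdf \<mu> (t0 + \<tau>) - cdf \<mu> t0"
      by (rule cdf_right(2)[OF e s(3) \<tau>L])
    moreover have "(1 + \<kappa>) * (D * \<tau>\<^sup>2) \<le> 2 * (D * \<tau>\<^sup>2)" using \<kappa> D by (intro mult_right_mono) auto
    then have "(1 + \<kappa>) * D * \<tau>\<^sup>2 / 2 \<le> D * \<tau>\<^sup>2" by (simp add: mult.assoc)
    ultimately show ?thesis by linarith
  qed
  have left: "f0 * h + D * h\<^sup>2 / 4 \<le> cdf \<mu> t0 - cdf \<mu> (t0 - h)" if "0 \<le> h" "h \<le> L" for h
  proof -
    have "f0 * h + (1 - \<kappa>) * D * h\<^sup>2 / 2 \<le> cdf \<mu> t0 - cdf \<mu> (t0 - h)"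
      by (rule cdf_left(2)[OF e that])
    moreover have "(1 / 2) * (D * h\<^sup>2) \<le> (1 - \<kappa>) * (D * h\<^sup>2)" using \<kappa> D by (intro mult_right_mono) auto
    then have "D * h\<^sup>2 / 4 \<le> (1 - \<kappa>) * D * h\<^sup>2 / 2" by (simp add: mult.assoc)
    ultimately show ?thesis by linarith
  qed
  have peel_\<tau>: "\<bar>dev x N (t0 + \<tau>) - dev x N t0\<bar> \<le> 4 * (z * real N) * (R * \<sigma>)\<^sup>2"
  proof -
    have m: "max (R * \<sigma>) \<bar>t0 + \<tau> - t0\<bar> = R * \<sigma>" using s(3) \<sigma>(2) by (intro max_absorb1) simp
    have "\<bar>t0 + \<tau> - t0\<bar> = \<tau>" using s(3) by simp
    with \<sigma>(2) s(6) have "\<bar>t0 + \<tau> - t0\<bar> \<le> L / 2" by linarith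
    from peel[OF this] show ?thesis unfolding m .
  qed
  have far_case: "real N * a * (t0 + \<tau> - u) + real N * (D * L\<^sup>2 / 64) \<le> cnt x N (t0 + \<tau>) - cnt x N u"
    if u: "e0 \<le> u" "u \<le> t0 - L / 2" for u
  proof -
    have "f0 * (t0 - L / 2 - u) \<le> cdf \<mu> (t0 - L / 2) - cdf \<mu> u"
      using u e0 L by (intro cdf_diff_ge f_ge) auto
    moreover have "f0 * (L / 2) + D * (L / 2)\<^sup>2 / 4 \<le> cdf \<mu> t0 - cdf \<mu> (t0 - L / 2)"
      using L by (intro left) auto
    moreover have "f0 * (t0 - L / 2 - u) + f0 * (L / 2) = f0 * (t0 - u)" by (simp add: algebra_simps)
    moreover have "D * (L / 2)\<^sup>2 / 4 = D * L\<^sup>2 / 16" by (simp add: power_divide)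
    moreover have "0 \<le> cdf \<mu> (t0 + \<tau>) - cdf \<mu> t0" using cdf_nondecreasing[of t0 "t0 + \<tau>"] s by simp
    ultimately have p: "f0 * (t0 - u) + D * L\<^sup>2 / 16 \<le> cdf \<mu> (t0 + \<tau>) - cdf \<mu> u" by linarith
    have "D * s * (t0 + \<tau> - u) \<le> D * \<sigma> * (\<tau> + t0)"
      using D s u e0 \<sigma> L t0 by (intro mult_mono) auto
    moreover have "a * (t0 + \<tau> - u) = f0 * (t0 - u) + f0 * \<tau> + D * s * (t0 + \<tau> - u)"
      by (simp add: a_def algebra_simps)
    ultimately have "a * (t0 + \<tau> - u) + D * L\<^sup>2 / 64 + (4 * z * (R * \<sigma>)\<^sup>2 + 2 * d) \<le> cdf \<mu> (t0 + \<tau>) - cdf \<mu> u"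
      using p small by linarith
    from mult_left_mono[OF this, of "real N"]
    have "real N * a * (t0 + \<tau> - u) + real N * (D * L\<^sup>2 / 64) + (4 * (z * real N) * (R * \<sigma>)\<^sup>2 + 2 * (d * real N))
        \<le> real N * (cdf \<mu> (t0 + \<tau>) - cdf \<mu> u)" by (simp add: algebra_simps)
    moreover have "\<bar>dev x N t0 - dev x N e0\<bar> \<le> d * real N" "\<bar>dev x N u - dev x N e0\<bar> \<le> d * real N"
      using u L e0 by (auto intro!: far)
    ultimately show ?thesis using peel_\<tau> cnt_eq[of N "t0 + \<tau>" u] by linarith
  qed
  have "a \<le> grenander x N t0"
  proof (rule grenander_ge_cnt[OF t0 _ N(2)])
    show "t0 \<le> t0 + \<tau>" using s by simp
    fix u assume u: "0 \<le> u" "u < t0"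
    define h where "h = t0 - u"
    have h: "0 < h" "u = t0 - h" using u by (auto simp: h_def)
    consider (a) "h \<le> R * \<sigma>" | (b) "R * \<sigma> < h" "h \<le> L / 2" | (c) "L / 2 < h" "e0 \<le> u" | (d) "u < e0" by linarith
    then show "real N * a * (t0 + \<tau> - u) \<le> cnt x N (t0 + \<tau>) - cnt x N u"
    proof cases
      case a
      define p where "p = cdf \<mu> (t0 + \<tau>) - cdf \<mu> u"
      have hL: "h \<le> L" using a s L by linarith
      define G where "G = D * (\<tau>\<^sup>2 + \<sigma> * (\<tau> + R * \<sigma>))"
      have "a * (\<tau> + h) - G \<le> p"
      proof -
        have "f0 * h \<le> cdf \<mu> t0 - cdf \<mu> u"
        proof -
          have "0 \<le> D * h\<^sup>2 / 4" using D by simp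
          with left[of h] h hL show ?thesis by simp
        qed
        moreover have "D * (s * (\<tau> + h)) \<le> D * (\<sigma> * (\<tau> + R * \<sigma>))"
          using D s h a \<sigma> by (intro mult_left_mono mult_mono) auto
        moreover have "a * (\<tau> + h) = f0 * \<tau> + f0 * h + D * (s * (\<tau> + h))" by (simp add: a_def algebra_simps)
        moreover have "G = D * \<tau>\<^sup>2 + D * (\<sigma> * (\<tau> + R * \<sigma>))" by (simp add: G_def algebra_simps)
        ultimately show ?thesis using right unfolding p_def by linarith
      qed
      from mult_left_mono[OF this, of "real m"]
      have P: "real m * (a * (\<tau> + h)) - real m * G \<le> real m * p" by (simp add: algebra_simps)
      have o: "\<bar>dev x m (t0 + \<tau>) - dev x m t0\<bar> \<le> Y" "\<bar>dev x m u - dev x m t0\<bar> \<le> Y"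
        using \<sigma>(2) s(3) h a by (auto intro!: old)
      define y where "y = (\<lambda>i. x (m + i))"
      have n: "\<bar>(cnt y k (t0 + \<tau>) - real k * \<nu> (t0 + \<tau>)) - (cnt y k t0 - real k * \<nu> t0)\<bar> \<le> Y"
        "\<bar>(cnt y k u - real k * \<nu> u) - (cnt y k t0 - real k * \<nu> t0)\<bar> \<le> Y"
        unfolding y_def using \<sigma>(2) s(3) h a by (auto intro!: new)
      have "a * (\<tau> + h) + g \<le> \<nu> (t0 + \<tau>) - \<nu> u" unfolding a_def h(2) using h a by (intro drift) auto
      from mult_left_mono[OF this, of "real k"]
      have Q: "real k * (a * (\<tau> + h)) + real k * g \<le> real k * \<nu> (t0 + \<tau>) - real k * \<nu> u" by (simp add: algebra_simps)
      have "cnt x N t = cnt x m t + cnt y k t" for t unfolding N(1) y_def by (rule cnt_add)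
      then have "cnt x N (t0 + \<tau>) - cnt x N u = (cnt x m (t0 + \<tau>) - cnt x m u) + (cnt y k (t0 + \<tau>) - cnt y k u)" by simp
      moreover have "cnt x m (t0 + \<tau>) - cnt x m u = (dev x m (t0 + \<tau>) - dev x m u) + real m * p"
        unfolding p_def by (rule cnt_eq)
      moreover have "real N * a * (t0 + \<tau> - u) = real m * (a * (\<tau> + h)) + real k * (a * (\<tau> + h))"
        by (simp add: N h algebra_simps)
      ultimately show ?thesis using P o n Q margin[folded G_def] by linarith
    next
      case b
      define p where "p = cdf \<mu> (t0 + \<tau>) - cdf \<mu> u"
      \<comment> \<open>With \<open>\<sigma> <= h / 16\<close> the raised level and the curvature on
        \<open>{t0..t0 + \<tau>}\<close> use up at most \<open>1/8 + 1/256\<close> of the gain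
        coefficient 1/4.\<close>
      have h16: "16 * \<sigma> \<le> h" using \<sigma> b by linarith
      have "f0 * h + D * h\<^sup>2 / 4 \<le> cdf \<mu> t0 - cdf \<mu> u"
        unfolding h(2) using h b L by (intro left) auto
      then have "f0 * \<tau> + f0 * h + D * h\<^sup>2 / 4 - D * \<tau>\<^sup>2 \<le> p" unfolding p_def using right by linarith
      moreover have "D * (s * (\<tau> + h)) \<le> D * (h / 16 * (2 * h))"
        using D s h h16 \<sigma> by (intro mult_left_mono mult_mono) auto
      moreover have "D * \<tau>\<^sup>2 \<le> D * (h / 16)\<^sup>2"
        using D s h16 by (intro mult_left_mono power_mono) auto
      moreover have "D * (h / 16 * (2 * h)) = D * h\<^sup>2 / 8" "D * (h / 16)\<^sup>2 = D * h\<^sup>2 / 256"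
        by (simp_all add: power2_eq_square)
      moreover have "a * (\<tau> + h) = f0 * \<tau> + f0 * h + D * (s * (\<tau> + h))" by (simp add: a_def algebra_simps)
      moreover have "0 \<le> D * h\<^sup>2" using D by simp
      ultimately have "a * (\<tau> + h) + D * h\<^sup>2 / 64 \<le> p" by linarith
      from mult_left_mono[OF this, of "real N"]
      have P: "real N * (a * (\<tau> + h)) + real N * (D * h\<^sup>2 / 64) \<le> real N * p" by (simp add: algebra_simps)
      have "\<bar>dev x N u - dev x N t0\<bar> \<le> 4 * (z * real N) * h\<^sup>2"
      proof -
        have ab: "\<bar>u - t0\<bar> = h" using h by simp
        have m: "max (R * \<sigma>) \<bar>u - t0\<bar> = h" unfolding ab using b by (intro max_absorb2) simp
        from peel[of u] show ?thesis unfolding m unfolding ab using b by simp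
      qed
      moreover have "(R * \<sigma>)\<^sup>2 \<le> h\<^sup>2" using b \<sigma> s by (intro power_mono) auto
      then have "4 * (z * real N) * (R * \<sigma>)\<^sup>2 \<le> 4 * (z * real N) * h\<^sup>2" using z0 by (intro mult_left_mono) auto
      moreover have "8 * (z * real N) * h\<^sup>2 = real N * (D * h\<^sup>2 / 64)" by (simp add: z)
      moreover have "cnt x N (t0 + \<tau>) - cnt x N u = (dev x N (t0 + \<tau>) - dev x N u) + real N * p"
        unfolding p_def by (rule cnt_eq)
      moreover have "real N * a * (t0 + \<tau> - u) = real N * (a * (\<tau> + h))" by (simp add: h algebra_simps)
      ultimately show ?thesis using P peel_\<tau> by linarith
    next
      case c
      have "0 \<le> real N * (D * L\<^sup>2 / 64)" using D by simp
      with far_case[of u] c h show ?thesis by simp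
    next
      case d
      have "real N * a * (t0 + \<tau> - e0) + real N * (D * L\<^sup>2 / 64) \<le> cnt x N (t0 + \<tau>) - cnt x N e0"
        using e0 by (intro far_case) auto
      moreover have "cnt x N u \<le> cnt x N e0" using d by (intro cnt_mono) auto
      moreover have "a * (e0 - u) \<le> a * e0" using a0 u by (intro mult_left_mono) auto
      then have "real N * (a * (e0 - u)) \<le> real N * (D * L\<^sup>2 / 64)"
        using e0(3) by (intro mult_left_mono) (auto simp: a_def)
      moreover have "real N * a * (t0 + \<tau> - u) = real N * a * (t0 + \<tau> - e0) + real N * (a * (e0 - u))"
        by (simp add: algebra_simps)
      ultimately show ?thesis by linarith
    qed
  qed
  then show ?thesis by (simp add: a_def)
qed

end

text \<open>Origin of the seven factors: three from aiming at \<open>(1 + \<rho>) * c\<close> in a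
  cube, three from extending the tilt to \<open>\<tau> = \<rho> * \<sigma>\<close> in a cube, and
  one from the bound \<open>(1 + \<kappa>) * f0\<close> for the density with
  \<open>\<kappa> <= \<rho>\<close>.\<close>

lemma lower_constants:
  fixes r :: real
  assumes "r < 1" "0 < r"
  obtains \<rho> :: real where "0 < \<rho>" "\<rho> \<le> 1/2" "(1 + \<rho>) ^ 7 * r < 1"
proof -
  have "((\<lambda>\<rho>::real. (1 + \<rho>) ^ 7 * r) \<longlongrightarrow> (1 + 0) ^ 7 * r) (at_right 0)" by (intro tendsto_intros)
  then have "((\<lambda>\<rho>::real. (1 + \<rho>) ^ 7 * r) \<longlongrightarrow> r) (at_right 0)" by simp
  from eventually_less_of_tendsto[OF this assms(1)]
  have ev: "eventually (\<lambda>\<rho>::real. (1 + \<rho>) ^ 7 * r < 1) (at_right 0)" .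
  have "eventually (\<lambda>\<rho>::real. \<rho> \<in> {0<..<1/2}) (at_right 0)" by (rule eventually_at_rightI[of 0 "1/2"]) auto
  with ev have "eventually (\<lambda>\<rho>::real. (1 + \<rho>) ^ 7 * r < 1 \<and> \<rho> \<in> {0<..<1/2}) (at_right 0)"
    by (rule eventually_conj)
  then obtain \<rho> where "(1 + \<rho>) ^ 7 * r < 1" "\<rho> \<in> {0<..<1/2}"
    using eventually_happens'[OF trivial_limit_at_right_real] by blast
  then show ?thesis by (intro that[of \<rho>]) auto
qed

section \<open>Probability of a favourable block\<close>

context decreasing_density
begin

lemma tilted_nonneg:
  assumes "0 \<le> \<sigma>" "0 \<le> \<tau>" "\<sigma> < t0" "f (t0 - \<sigma>) \<le> 2 * f0"
    and "b \<le> 1" "D / f0 * (\<sigma> + \<tau>) \<le> b" "D * (\<sigma> + \<tau>)\<^sup>2 \<le> b"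
  shows "0 \<le> tilted \<sigma> \<tau> u" "tilted \<sigma> \<tau> u \<le> 2"
  using tilted_bounds(2,3)[OF assms(1-4,6,7), of u] assms(5) by linarith+

text \<open>Under the tilted law the sample follows its own distribution function with probability
  at least 3/4. Changing back costs \<open>exp (- \<Lambda>)\<close>, where the entropy enters
  \<open>\<Lambda>\<close> with coefficient \<open>1/2 + \<gamma>\<close> instead of 1/2; the extra
  \<open>2 / \<gamma>\<close> brings the moment term down to
  \<open>exp (- 2) <= 1/4\<close>.\<close>

lemma tilted_block:
  assumes s: "0 < \<sigma>" "0 \<le> \<tau>" "\<sigma> < t0" and \<kappa>: "0 \<le> \<kappa>" "\<kappa> \<le> 1" "f (t0 - \<sigma>) \<le> (1 + \<kappa>) * f0"
    and \<gamma>: "0 < \<gamma>" "\<gamma> \<le> 1"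
    and b: "b \<le> 1" "b \<le> \<gamma> / (1 + 2 * \<gamma>) / 2" "D / f0 * (\<sigma> + \<tau>) \<le> b" "D * (\<sigma> + \<tau>)\<^sup>2 \<le> b"
    and l: "0 < l" "l < t0" "f (t0 - l) \<le> 2 * f0"
    and Y: "0 < Y" "Y \<le> 4 * (real k * (4 * f0 * l))" "16 * (4096 * (real k * (4 * f0 * l))) \<le> Y\<^sup>2"
    and \<Lambda>: "(1/2 + \<gamma>) * (real k * ((1 + \<kappa>) * D\<^sup>2 * (\<sigma> + \<tau>) ^ 3 / (3 * f0))) + 2 / \<gamma> \<le> \<Lambda>"
  obtains B where "B \<in> sets (sample {..<k})" "exp (- \<Lambda>) / 4 \<le> measure (sample {..<k}) B"
    and "\<forall>x\<in>B. \<forall>t. \<bar>t - t0\<bar> \<le> l \<longrightarrow>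
      \<bar>(cnt x k t - real k * cdf (tilted_law \<sigma> \<tau>) t) - (cnt x k t0 - real k * cdf (tilted_law \<sigma> \<tau>) t0)\<bar> \<le> Y"
proof -
  define V where "V = (1 + \<kappa>) * D\<^sup>2 * (\<sigma> + \<tau>) ^ 3 / (3 * f0)"
  have "(1 + \<kappa>) * f0 \<le> 2 * f0" using \<kappa> f0(2) by (intro mult_right_mono) auto
  then have f2: "f (t0 - \<sigma>) \<le> 2 * f0" using \<kappa> by linarith
  note s0 = less_imp_le[OF s(1)]
  note nn = tilted_nonneg[OF s0 s(2,3) f2 b(1,3,4)]
  have tb: "\<bar>tilt \<sigma> \<tau> u - tilt_mean \<sigma> \<tau>\<bar> \<le> \<gamma> / (1 + 2 * \<gamma>) / 2" for u
    using tilted_bounds(1)[OF s0 s(2,3) f2 b(3,4), of u] b(2) by linarith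
  interpret T: real_distribution "tilted_law \<sigma> \<tau>"
    by (rule density_real_distribution[OF _ nn_integral_tilted[OF s0 s(2) nn(1)]]) simp
  interpret TS: prob_space "T.sample {..<k}" by (rule T.prob_space_sample)
  have "0 < t0 - l" using l by simp
  from tilted_law_lipschitz[OF s0 s(2) nn this l(3), of "t0 + l"]
  have lip: "T.cdf_lipschitz (4 * f0) (t0 - l) (t0 + l)" by simp
  have kl: "0 < real k * (4 * f0 * l)" using Y by linarith
  have "65536 * (real k * (4 * f0 * l)) \<le> Y\<^sup>2" using Y(3) by simp
  then obtain A where A: "A \<in> sets (T.sample {..<k})"
    "measure (T.sample {..<k}) A \<le> 4 * exp (- Y\<^sup>2 / (4096 * (real k * (4 * f0 * l))))"
    "\<forall>x\<in>space (T.sample {..<k}) - A. \<forall>n\<le>k. \<forall>t. \<bar>t - t0\<bar> \<le> l \<longrightarrow> \<bar>T.dev x n t - T.dev x n t0\<bar> \<le> Y"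
    by (rule T.oscillation_two_sided[OF lip l(1) Y(1,2)]) (rule that)
  have "16 \<le> Y\<^sup>2 / (4096 * (real k * (4 * f0 * l)))" using Y(3) kl by (subst pos_le_divide_eq) auto
  then have "exp (- Y\<^sup>2 / (4096 * (real k * (4 * f0 * l)))) \<le> exp (- 2 + - 2)" by simp
  also have "\<dots> = exp (- 2) * exp (- 2 :: real)" by (rule exp_add)
  also have "\<dots> \<le> (1/4) * (1/4)" by (intro mult_mono exp_neg_two_le) auto
  finally have A4: "measure (T.sample {..<k}) A \<le> 1/4" using A(2) by linarith
  define B where "B = space (T.sample {..<k}) - A"
  have setsT: "sets (T.sample {..<k}) = sets (sample {..<k})"
    by (simp only: T.sets_sample sets_sample)
  have B: "B \<in> sets (sample {..<k})" unfolding setsT[symmetric] B_def using A(1) by auto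
  have "3/4 \<le> measure (T.sample {..<k}) B" using A4 TS.prob_compl[OF A(1)] by (simp add: B_def)
  also have "\<dots> \<le> exp \<Lambda> * measure (sample {..<k}) B + exp (- \<gamma> * \<Lambda>) * exp (\<gamma> * (1/2 + \<gamma>) * V) ^ k"
  proof (rule change_of_measure[OF _ nn(1) nn_integral_tilted[OF s0 s(2) nn(1)] \<gamma>(1) _ _ B])
    show "(\<integral>\<^sup>+u. ennreal (tilted \<sigma> \<tau> u powr (1 + \<gamma>)) \<partial>\<mu>) \<le> ennreal (exp (\<gamma> * (1/2 + \<gamma>) * V))"
      unfolding V_def by (rule nn_integral_tilted_powr[OF s0 s(2) \<gamma> tb tilt_square_le[OF s0 s(2,3) \<kappa>(1,3)]])
  qed simp_all
  also have "exp (- \<gamma> * \<Lambda>) * exp (\<gamma> * (1/2 + \<gamma>) * V) ^ k = exp (- \<gamma> * \<Lambda> + real k * (\<gamma> * (1/2 + \<gamma>) * V))"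
    by (simp only: exp_add exp_of_nat_mult)
  also have "\<dots> \<le> exp (- 2)"
  proof -
    have "\<gamma> * ((1/2 + \<gamma>) * (real k * V) + 2 / \<gamma>) \<le> \<gamma> * \<Lambda>" using \<Lambda> \<gamma> unfolding V_def by (intro mult_left_mono) auto
    moreover have "\<gamma> * ((1/2 + \<gamma>) * (real k * V) + 2 / \<gamma>) = real k * (\<gamma> * (1/2 + \<gamma>) * V) + 2"
      using \<gamma> by (simp add: algebra_simps)
    ultimately show ?thesis by simp
  qed
  also have "\<dots> \<le> 1/4" by (rule exp_neg_two_le)
  finally have "1/2 \<le> exp \<Lambda> * measure (sample {..<k}) B" by simp
  then have "exp (- \<Lambda>) * (1/2) \<le> exp (- \<Lambda>) * (exp \<Lambda> * measure (sample {..<k}) B)" by (intro mult_left_mono) auto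
  also have "\<dots> = measure (sample {..<k}) B" by (simp add: mult.assoc[symmetric] exp_add[symmetric])
  finally have "exp (- \<Lambda>) / 4 \<le> measure (sample {..<k}) B" using exp_gt_zero[of "- \<Lambda>"] by linarith
  moreover have "T.dev x n t = cnt x n t - real n * cdf (tilted_law \<sigma> \<tau>) t" for x n t
    by (simp add: T.dev_def cnt_def sum_subtractf)
  then have "\<forall>x\<in>B. \<forall>t. \<bar>t - t0\<bar> \<le> l \<longrightarrow>
      \<bar>(cnt x k t - real k * cdf (tilted_law \<sigma> \<tau>) t) - (cnt x k t0 - real k * cdf (tilted_law \<sigma> \<tau>) t0)\<bar> \<le> Y"
    using A(3) unfolding B_def by auto
  ultimately show ?thesis by (rule that[OF B])
qed

text \<open>The event \<open>B\<close> concerns the new observations only, so that it is independent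
  between blocks. \<open>A\<close> and \<open>A'\<close> are rare and keep the whole sample and its
  older part close to their means. The ratio \<open>q\<close> is large, so that the older
  observations weigh little against the surplus created by \<open>B\<close>.\<close>

lemma lower_block:
  assumes c: "0 < c" "c ^ 3 < 3 * f0 * D"
  obtains q :: nat and \<epsilon> C :: real where "2 \<le> q" "0 < \<epsilon>"
    and "eventually (\<lambda>m. \<exists>A A' B. A \<in> sets (sample {..<q * m})
        \<and> measure (sample {..<q * m}) A \<le> C * exp (- (2 * ln (ln (real (q * m)))))
        \<and> A' \<in> sets (sample {..<m})
        \<and> measure (sample {..<m}) A' \<le> C * exp (- (2 * ln (ln (real (q * m)))))
        \<and> B \<in> sets (sample {..<q * m - m})
        \<and> exp (- ((1 - \<epsilon>) * ln (ln (real (q * m))))) / 4 \<le> measure (sample {..<q * m - m}) B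
        \<and> (\<forall>x. restrict x {..<q * m} \<notin> A \<longrightarrow> restrict x {..<m} \<notin> A'
              \<longrightarrow> restrict (\<lambda>i. x (m + i)) {..<q * m - m} \<in> B
              \<longrightarrow> f0 + c * rate (q * m) \<le> grenander x (q * m) t0)) sequentially"
proof -
  define r where "r = c ^ 3 / (3 * f0 * D)"
  have fD: "0 < 3 * f0 * D" using f0(2) D by simp
  have r: "r < 1" "0 < r" using c fD by (simp_all add: r_def)
  obtain \<rho> :: real where \<rho>: "0 < \<rho>" "\<rho> \<le> 1/2" "(1 + \<rho>) ^ 7 * r < 1" by (rule lower_constants[OF r]) (rule that)
  define r1 where "r1 = (1 + \<rho>) ^ 7 * r"
  have r1: "r1 < 1" "0 < r1" using \<rho> r by (simp_all add: r1_def)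
  \<comment> \<open>With \<open>\<epsilon> = 4 * \<gamma>\<close> one has
    \<open>1 - \<epsilon> = r1 + 4 * \<gamma>\<close>: here \<open>r1 + 2 * \<gamma>\<close> covers
    the inflated entropy, and \<open>2 / \<gamma>\<close> is eventually below
    \<open>\<gamma> * \<Lambda>\<close>.\<close>
  define \<gamma> where "\<gamma> = (1 - r1) / 8"
  have \<gamma>: "0 < \<gamma>" "\<gamma> \<le> 1" using r1 by (auto simp: \<gamma>_def)
  define \<epsilon> where "\<epsilon> = (1 - r1) / 2"
  have \<epsilon>: "0 < \<epsilon>" using r1 by (simp add: \<epsilon>_def)
  \<comment> \<open>The tilt aims beyond \<open>c\<close>; the gap between the two levels is the
    source of the drift surplus.\<close>
  define c' where "c' = (1 + \<rho>) * c"
  have c': "0 < c'" using c \<rho> by (simp add: c'_def)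
  define cD where "cD = c' ^ 3 / D ^ 3"
  have cD: "0 < cD" using c' D by (simp add: cD_def)
  define z where "z = D / 512"
  have z0: "0 < z" using D by (simp add: z_def)
  define R where "R = max 16 (4096 * (2 * f0) / (z\<^sup>2 * cD))"
  have R: "16 \<le> R" by (simp add: R_def)
  have R3: "4096 * (2 * f0) \<le> z\<^sup>2 * cD * R ^ 3"
  proof -
    have "4096 * (2 * f0) / (z\<^sup>2 * cD) \<le> R" by (simp only: R_def max.cobounded2)
    also have "R \<le> R ^ 3" using power_increasing[of 1 3 R] R by simp
    finally show ?thesis using z0 cD by (simp add: divide_le_eq mult.commute)
  qed
  \<comment> \<open>The surplus in units of \<open>D * \<sigma>^2\<close>: the levels differ by at
    least \<open>D * \<rho> * \<sigma> / 2\<close>, over a stretch of length at least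
    \<open>\<tau> = \<rho> * \<sigma>\<close>.\<close>
  define g1 where "g1 = \<rho>\<^sup>2 / 2"
  have g1: "0 < g1" using \<rho> by (simp add: g1_def)
  \<comment> \<open>The second bound makes the expansion error for \<open>h <= R * \<sigma>\<close>
    at most a quarter of the surplus.\<close>
  define \<kappa> where "\<kappa> = min \<rho> (g1 / (2 * (R\<^sup>2 + 5)))"
  have R5: "0 < 2 * (R\<^sup>2 + 5)" by (simp add: add_nonneg_pos)
  have \<kappa>: "0 < \<kappa>" "\<kappa> \<le> 1/2" "\<kappa> \<le> \<rho>" "\<kappa> \<le> 1" "0 \<le> \<kappa>" 
  proof -
    show "\<kappa> \<le> \<rho>" by (simp only: \<kappa>_def min.cobounded1)
    show "0 < \<kappa>" using \<rho>(1) divide_pos_pos[OF g1 R5] by (simp only: \<kappa>_def min_less_iff_conj)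
    then show "\<kappa> \<le> 1/2" "\<kappa> \<le> 1" "0 \<le> \<kappa>" using \<rho>(2) \<open>\<kappa> \<le> \<rho>\<close> by linarith+
  qed
  have \<kappa>R: "\<kappa> / 2 * (R\<^sup>2 + 5) \<le> g1 / 4"
  proof -
    have "\<kappa> \<le> g1 / (2 * (R\<^sup>2 + 5))" by (simp only: \<kappa>_def min.cobounded2)
    then have "\<kappa> * (2 * (R\<^sup>2 + 5)) \<le> g1" using R5 by (simp only: pos_le_divide_eq)
    then show ?thesis by (simp add: algebra_simps)
  qed
  obtain \<eta> where e0: "expands \<kappa> \<eta>" using ex_expands[OF \<kappa>(1)] .
  define L where "L = min \<eta> (f0 / (2 * D))"
  have L0: "0 < L" "L \<le> \<eta>" "L \<le> f0 / (2 * D)" using e0 f0(2) D by (auto simp: L_def expands_def)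
  have e: "expands \<kappa> L" by (rule expands_subset[OF e0 L0(1,2)])
  have L: "0 < L" "L \<le> t0 / 2" "2 * D * L \<le> f0"
    using e L0(3) D by (auto simp: expands_def field_simps)
  have tL: "0 < t0 - L" using L t0 by linarith
  have fL: "f (t0 - L) \<le> 2 * f0"
  proof -
    have "f (t0 + (- L)) \<le> f0 - D * (- L) + \<kappa> * D * \<bar>- L\<bar>" using L by (intro expandsD[OF e]) auto
    moreover have "\<kappa> * (D * L) \<le> 1 * (D * L)" using \<kappa> D L by (intro mult_right_mono) auto
    ultimately show ?thesis using L by (simp add: mult.assoc)
  qed
  have lip2: "cdf_lipschitz (2 * f0) (t0 - L) (t0 + L)" by (rule cdf_lipschitzI[OF tL fL])
  have zL: "z * L \<le> 4 * (2 * f0)" using L f0(2) by (simp add: z_def)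
  define \<zeta> where "\<zeta> = D * g1 / 32"
  have \<zeta>: "0 < \<zeta>" using D g1 by (simp add: \<zeta>_def)
  \<comment> \<open>The first term makes the deficit of the older observations at most an eighth of
    \<open>N * D * \<sigma>^2 * g1\<close>; the second gives their oscillation event
    \<open>A'\<close> the exponent 2.\<close>
  define q where "q = nat \<lceil>8 * (2 + R) / g1\<rceil> + nat \<lceil>8192 * f0 * R / (\<zeta>\<^sup>2 * cD)\<rceil> + 2"
  have q2: "2 \<le> q" by (simp add: q_def)
  have q1: "8 * (2 + R) / g1 \<le> real q" "8192 * f0 * R / (\<zeta>\<^sup>2 * cD) \<le> real q"
    unfolding q_def by linarith+
  have qg: "8 * (2 + R) \<le> real q * g1" using q1(1) g1 by (simp add: pos_divide_le_eq)
  have q\<zeta>: "8192 * f0 * R \<le> real q * (\<zeta>\<^sup>2 * cD)" using q1(2) \<zeta> cD by (simp add: pos_divide_le_eq)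
  define dl where "dl = D * L\<^sup>2"
  have dl: "0 < dl" using D L by (simp add: dl_def)
  \<comment> \<open>\<open>f\<close> may blow up at 0, so chaining starts at \<open>u0\<close>; the
    second bound keeps the loss \<open>2 * f0 * u0\<close> within
    \<open>D * L^2 / 64\<close>.\<close>
  define u0 where "u0 = min (t0 / 4) (dl / (128 * f0))"
  have u0: "0 < u0" "u0 \<le> t0 / 4" "u0 \<le> dl / (128 * f0)" using t0 dl f0(2) by (auto simp: u0_def)
  have u0L: "u0 \<le> t0 - L / 2" using u0 L by linarith
  have u0f: "2 * f0 * u0 \<le> dl / 64" 
  proof -
    have "0 < 128 * f0" using f0(2) by simp
    from u0(3)[unfolded pos_le_divide_eq[OF this]] show ?thesis by (simp add: algebra_simps)
  qed
  define l where "l = t0 - u0"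
  define K0 where "K0 = f u0"
  have l: "0 < l" using u0 t0 by (simp add: l_def)
  have K0: "0 < K0" using antiD[of u0 t0] u0 t0 f0 by (simp add: K0_def)
  have lip0: "cdf_lipschitz K0 u0 (u0 + l)" by (rule cdf_lipschitzI) (simp_all add: u0 K0_def)
  define d where "d = min (K0 * l) (dl / 256)"
  have d: "0 < d" "d \<le> K0 * l" "d \<le> dl / 256" using K0 l dl by (auto simp: d_def)
  define b where "b = min 1 (\<gamma> / (1 + 2 * \<gamma>) / 2)"
  have b: "0 < b" "b \<le> 1" "b \<le> \<gamma> / (1 + 2 * \<gamma>) / 2"
  proof -
    have "0 < \<gamma> / (1 + 2 * \<gamma>) / 2" using \<gamma> by (intro divide_pos_pos) auto
    then show "0 < b" by (simp only: b_def min_less_iff_conj zero_less_one simp_thms)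
    show "b \<le> 1" "b \<le> \<gamma> / (1 + 2 * \<gamma>) / 2" by (simp_all only: b_def min.cobounded1 min.cobounded2)
  qed
  define C :: real where "C = 12"
  \<comment> \<open>Thresholds for \<open>ln (ln N)\<close>: 8 raises the exponents of
    \<open>A\<close> and \<open>A'\<close> to at least 16, the second term makes the new block
    concentrate under the tilt, and the third gives
    \<open>2 / \<gamma> <= \<gamma> * \<Lambda>\<close>.\<close>
  define b1 where "b1 = 8 + 16 * 16384 * f0 * R / (2 * \<zeta>\<^sup>2 * cD) + 2 / \<gamma> / \<gamma>"
  have small: "eventually (\<lambda>s. R * s < L / 2 \<and> f0 * (\<rho> * s) + D * s * (\<rho> * s + t0) + 4 * z * (R * s)\<^sup>2 < dl / 64
      \<and> D * s < f0 \<and> (1 + \<kappa>) * D * s < \<kappa> * f0 \<and> D / f0 * (s + \<rho> * s) < b \<and> D * (s + \<rho> * s)\<^sup>2 < b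
      \<and> \<zeta> * real q * s < 8 * f0 * R \<and> 8 * f0 * (1 + R) * s < g1 / 4) (at_right 0)"
  proof (intro eventually_conj)
    show "eventually (\<lambda>s. R * s < L / 2) (at_right 0)"
      by (rule eventually_less_of_tendsto[where m = "R * 0"], (intro tendsto_intros)[1]) (use L in simp)
    show "eventually (\<lambda>s. f0 * (\<rho> * s) + D * s * (\<rho> * s + t0) + 4 * z * (R * s)\<^sup>2 < dl / 64) (at_right 0)"
      by (rule eventually_less_of_tendsto[where m = "f0 * (\<rho> * 0) + D * 0 * (\<rho> * 0 + t0) + 4 * z * (R * 0)\<^sup>2"], (intro tendsto_intros)[1]) (use dl in simp)
    show "eventually (\<lambda>s. D * s < f0) (at_right 0)"
      by (rule eventually_less_of_tendsto[where m = "D * 0"], (intro tendsto_intros)[1]) (use f0(2) in simp)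
    show "eventually (\<lambda>s. (1 + \<kappa>) * D * s < \<kappa> * f0) (at_right 0)"
      by (rule eventually_less_of_tendsto[where m = "(1 + \<kappa>) * D * 0"], (intro tendsto_intros)[1]) (use f0(2) \<kappa>(1) in simp)
    show "eventually (\<lambda>s. D / f0 * (s + \<rho> * s) < b) (at_right 0)"
      by (rule eventually_less_of_tendsto[where m = "D / f0 * (0 + \<rho> * 0)"], (intro tendsto_intros)[1]) (use b in simp)
    show "eventually (\<lambda>s. D * (s + \<rho> * s)\<^sup>2 < b) (at_right 0)"
      by (rule eventually_less_of_tendsto[where m = "D * (0 + \<rho> * 0)\<^sup>2"], (intro tendsto_intros)[1]) (use b in simp)
    show "eventually (\<lambda>s. \<zeta> * real q * s < 8 * f0 * R) (at_right 0)"
      by (rule eventually_less_of_tendsto[where m = "\<zeta> * real q * 0"], (intro tendsto_intros)[1]) (use f0(2) R in simp)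
    show "eventually (\<lambda>s. 8 * f0 * (1 + R) * s < g1 / 4) (at_right 0)"
      by (rule eventually_less_of_tendsto[where m = "8 * f0 * (1 + R) * 0"], (intro tendsto_intros)[1]) (use g1 in simp)
  qed
  have dpos: "0 < d\<^sup>2 / (1024 * K0 * l)" using d K0 l by simp
  \<comment> \<open>The conditions concern the sample size \<open>N\<close>, whereas blocks are
    indexed by \<open>m\<close> with \<open>N = q * m\<close>. Bundling them allows a single passage
    to this subsequence.\<close>
  define P where "P N \<longleftrightarrow> b1 \<le> ln (ln (real N)) \<and> 0 < N
    \<and> (R * (c' / D * rate N) < L / 2 \<and> f0 * (\<rho> * (c' / D * rate N)) + D * (c' / D * rate N) * (\<rho> * (c' / D * rate N) + t0) + 4 * z * (R * (c' / D * rate N))\<^sup>2 < dl / 64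
      \<and> D * (c' / D * rate N) < f0 \<and> (1 + \<kappa>) * D * (c' / D * rate N) < \<kappa> * f0 \<and> D / f0 * ((c' / D * rate N) + \<rho> * (c' / D * rate N)) < b \<and> D * ((c' / D * rate N) + \<rho> * (c' / D * rate N))\<^sup>2 < b
      \<and> \<zeta> * real q * (c' / D * rate N) < 8 * f0 * R \<and> 8 * f0 * (1 + R) * (c' / D * rate N) < g1 / 4)
    \<and> ln (ln (real N)) \<le> d\<^sup>2 / (1024 * K0 * l) * real N" for N
  have "eventually P sequentially" unfolding P_def
    by (rule eventually_conj[OF eventually_lnln_ge eventually_conj[OF eventually_gt_at_top
          eventually_conj[OF eventually_rate[OF small divide_pos_pos[OF c' D(1)]] eventually_lnln_le_linear[OF dpos]]]])
  moreover have "filterlim (\<lambda>m. q * m) sequentially sequentially"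
    using q2 by (intro filterlim_subseq strict_monoI) auto
  ultimately have "eventually (\<lambda>m. P (q * m)) sequentially"
    by (rule eventually_compose_filterlim)
  then have "eventually (\<lambda>m. \<exists>A A' B. A \<in> sets (sample {..<q * m})
        \<and> measure (sample {..<q * m}) A \<le> C * exp (- (2 * ln (ln (real (q * m)))))
        \<and> A' \<in> sets (sample {..<m})
        \<and> measure (sample {..<m}) A' \<le> C * exp (- (2 * ln (ln (real (q * m)))))
        \<and> B \<in> sets (sample {..<q * m - m})
        \<and> exp (- ((1 - \<epsilon>) * ln (ln (real (q * m))))) / 4 \<le> measure (sample {..<q * m - m}) B
        \<and> (\<forall>x. restrict x {..<q * m} \<notin> A \<longrightarrow> restrict x {..<m} \<notin> A'
              \<longrightarrow> restrict (\<lambda>i. x (m + i)) {..<q * m - m} \<in> B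
              \<longrightarrow> f0 + c * rate (q * m) \<le> grenander x (q * m) t0)) sequentially"
  proof eventually_elim
    case elim: (elim m)
    define N where "N = q * m"
    have PN: "P N" using elim by (simp only: N_def)
    define \<Lambda> where "\<Lambda> = ln (ln (real N))"
    define \<sigma> where "\<sigma> = c' / D * rate N"
    define k where "k = N - m"
    have N: "0 < N" using PN by (simp add: P_def)
    then have m: "0 < m" by (simp add: N_def)
    have Nq: "real N = real q * real m" by (simp add: N_def)
    have mN: "2 * m \<le> N" unfolding N_def using q2 by (rule mult_right_mono) simp
    have nn: "N = m + k" "N \<le> 2 * k" "k \<le> N" using mN by (auto simp: k_def)
    have Nmk: "N = m + k" "real N \<le> 2 * real k" "real k \<le> real N"
      using nn(1) of_nat_mono[OF nn(2), where 'a = real] nn(3) by simp_all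
    have k0: "0 < real k" using Nmk N by linarith
    have sm: "R * \<sigma> < L / 2" "f0 * (\<rho> * \<sigma>) + D * \<sigma> * (\<rho> * \<sigma> + t0) + 4 * z * (R * \<sigma>)\<^sup>2 < dl / 64"
      "D * \<sigma> < f0" "(1 + \<kappa>) * D * \<sigma> < \<kappa> * f0" "D / f0 * (\<sigma> + \<rho> * \<sigma>) < b" "D * (\<sigma> + \<rho> * \<sigma>)\<^sup>2 < b"
      "\<zeta> * real q * \<sigma> < 8 * f0 * R" "8 * f0 * (1 + R) * \<sigma> < g1 / 4"
      and lin: "\<Lambda> \<le> d\<^sup>2 / (1024 * K0 * l) * real N" and \<Lambda>b: "b1 \<le> \<Lambda>"
      using PN unfolding P_def \<sigma>_def \<Lambda>_def by blast+
    have \<Lambda>8: "8 \<le> \<Lambda>" and \<Lambda>\<zeta>: "16 * 16384 * f0 * R / (2 * \<zeta>\<^sup>2 * cD) \<le> \<Lambda>" and \<Lambda>\<gamma>: "2 / \<gamma> / \<gamma> \<le> \<Lambda>"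
    proof -
      have "0 \<le> 16 * 16384 * f0 * R / (2 * \<zeta>\<^sup>2 * cD)" using f0(2) R cD by simp
      moreover have "0 \<le> 2 / \<gamma> / \<gamma>" using \<gamma> by simp
      ultimately show "8 \<le> \<Lambda>" "16 * 16384 * f0 * R / (2 * \<zeta>\<^sup>2 * cD) \<le> \<Lambda>" "2 / \<gamma> / \<gamma> \<le> \<Lambda>"
        using \<Lambda>b unfolding b1_def by linarith+
    qed
    have rp: "0 < rate N" using rate_pos[of N] \<Lambda>8 N by (simp add: \<Lambda>_def)
    have \<sigma>0: "0 < \<sigma>" using rp c' D by (simp add: \<sigma>_def)
    define s where "s = c / D * rate N"
    have s0: "0 < s" using rp c D by (simp add: s_def)
    have \<sigma>s: "\<sigma> = (1 + \<rho>) * s" by (simp add: \<sigma>_def s_def c'_def)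
    have s\<sigma>: "s \<le> \<sigma>" unfolding \<sigma>s using \<rho> s0 by simp
    have Ds: "D * s = c * rate N" using D by (simp add: s_def)
    have Ns: "real N * \<sigma> ^ 3 = cD * (2 * \<Lambda>)"
      using rate_cube[of N] \<Lambda>8 N by (simp add: \<sigma>_def cD_def \<Lambda>_def power_mult_distrib power_divide)
    define \<tau> where "\<tau> = \<rho> * \<sigma>"
    have \<tau>: "0 \<le> \<tau>" "\<tau> \<le> \<sigma>" using \<rho> \<sigma>0 by (auto simp: \<tau>_def)
    have R\<sigma>: "0 < R * \<sigma>" "R * \<sigma> \<le> L" "16 * \<sigma> \<le> R * \<sigma>" using R \<sigma>0 sm(1) L by (auto intro: mult_right_mono)
    have \<sigma>L: "\<sigma> \<le> L" using R\<sigma> \<sigma>0 by linarith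
    have \<sigma>t: "\<sigma> < t0" using \<sigma>L L t0 by linarith
    have fs: "f (t0 - \<sigma>) \<le> (1 + \<kappa>) * f0"
    proof -
      have "f (t0 + (- \<sigma>)) \<le> f0 - D * (- \<sigma>) + \<kappa> * D * \<bar>- \<sigma>\<bar>" using \<sigma>L \<sigma>0 by (intro expandsD[OF e]) auto
      also have "\<dots> = f0 + (1 + \<kappa>) * D * \<sigma>" using \<sigma>0 by (simp add: algebra_simps)
      also have "\<dots> \<le> (1 + \<kappa>) * f0" using sm(4) by (simp add: algebra_simps)
      finally show ?thesis by simp
    qed
    define E where "E = exp (- (2 * \<Lambda>))"
    have E2: "exp (- y) \<le> E" if "2 * \<Lambda> \<le> y" for y using that by (simp add: E_def)
    define yf where "yf = d * real N"
    have yf2: "yf\<^sup>2 / (512 * (real N * (K0 * l))) = d\<^sup>2 / (1024 * K0 * l) * real N * 2"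
      using N K0 l by (simp add: yf_def power2_eq_square field_simps)
    have yfl: "2 * \<Lambda> \<le> yf\<^sup>2 / (512 * (real N * (K0 * l)))" unfolding yf2 using lin by linarith
    have NKl: "0 < real N * (K0 * l)" using N K0 l by simp
    have "16 \<le> yf\<^sup>2 / (512 * (real N * (K0 * l)))" using yfl \<Lambda>8 by linarith
    then have "16 * (512 * (real N * (K0 * l))) \<le> yf\<^sup>2" using NKl by (simp add: le_divide_eq)
    then have yf3: "8192 * (real N * (K0 * l)) \<le> yf\<^sup>2" by simp
    have yf1: "0 < yf" "yf \<le> real N * (K0 * l)"
      using d N mult_left_mono[OF d(2), of "real N"] by (auto simp: yf_def mult.commute)
    obtain AF where AF: "AF \<in> sets (sample {..<N})"
      "measure (sample {..<N}) AF \<le> 4 * exp (- yf\<^sup>2 / (512 * (real N * (K0 * l))))"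
      "\<forall>x\<in>space (sample {..<N}) - AF. \<forall>n\<le>N. \<forall>t. u0 \<le> t \<longrightarrow> t \<le> u0 + l \<longrightarrow> \<bar>dev x n t - dev x n u0\<bar> \<le> yf"
      by (rule oscillation[OF lip0 l yf1 yf3]) (rule that)
    have AFE: "measure (sample {..<N}) AF \<le> 4 * E" using AF(2) E2[OF yfl] by (simp add: order_trans)
    have a2: "2 * \<Lambda> \<le> z\<^sup>2 * (real N * (R * \<sigma>) ^ 3) / (4096 * (2 * f0))"
    proof -
      have "z\<^sup>2 * (real N * (R * \<sigma>) ^ 3) = z\<^sup>2 * R ^ 3 * (real N * \<sigma> ^ 3)" by (simp add: power_mult_distrib)
      also have "\<dots> = z\<^sup>2 * cD * R ^ 3 * (2 * \<Lambda>)" unfolding Ns by simp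
      finally have eq: "z\<^sup>2 * (real N * (R * \<sigma>) ^ 3) = z\<^sup>2 * cD * R ^ 3 * (2 * \<Lambda>)" .
      have "4096 * (2 * f0) * (2 * \<Lambda>) \<le> z\<^sup>2 * (real N * (R * \<sigma>) ^ 3)"
        unfolding eq using \<Lambda>8 by (intro mult_right_mono R3) simp
      moreover have p: "0 < 4096 * (2 * f0)" using f0(2) by simp
      ultimately show ?thesis unfolding pos_le_divide_eq[OF p] by (simp only: mult.commute)
    qed
    have a16: "16 \<le> z\<^sup>2 * (real N * (R * \<sigma>) ^ 3) / (4096 * (2 * f0))" using a2 \<Lambda>8 by linarith
    have f02: "0 < 2 * f0" using f0(2) by simp
    obtain AP where AP: "AP \<in> sets (sample {..<N})"
      "measure (sample {..<N}) AP \<le> 8 * exp (- (z\<^sup>2 * (real N * (R * \<sigma>) ^ 3) / (4096 * (2 * f0))))"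
      "\<forall>x\<in>space (sample {..<N}) - AP. \<forall>n\<le>N. \<forall>t. \<bar>t - t0\<bar> \<le> L / 2 \<longrightarrow>
          \<bar>dev x n t - dev x n t0\<bar> \<le> 4 * (z * real N) * (max (R * \<sigma>) \<bar>t - t0\<bar>)\<^sup>2"
      by (rule oscillation_peeling[OF lip2 R\<sigma>(1,2) f02 z0 zL refl a16]) (rule that)
    have APE: "measure (sample {..<N}) AP \<le> 8 * E" using AP(2) E2[OF a2] by linarith
    define Y where "Y = \<zeta> * real N * \<sigma>\<^sup>2"
    have Y0: "0 < Y" using \<zeta> N \<sigma>0 by (simp add: Y_def)
    have YY: "Y\<^sup>2 = \<zeta>\<^sup>2 * cD * (2 * \<Lambda>) * (real N * \<sigma>)"
    proof -
      have "Y\<^sup>2 = \<zeta>\<^sup>2 * (real N * \<sigma> ^ 3) * (real N * \<sigma>)" by (simp add: Y_def power2_eq_square power3_eq_cube)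
      then show ?thesis unfolding Ns by simp
    qed
    define Wm where "Wm = real m * (2 * f0 * (R * \<sigma>))"
    have Wm0: "0 < Wm" using m f0(2) R\<sigma> by (simp add: Wm_def)
    have Ym: "2 * \<Lambda> \<le> Y\<^sup>2 / (4096 * Wm)"
    proof -
      have "(8192 * f0 * R) * ((2 * \<Lambda>) * (real m * \<sigma>)) \<le> (real q * (\<zeta>\<^sup>2 * cD)) * ((2 * \<Lambda>) * (real m * \<sigma>))"
        using \<Lambda>8 \<sigma>0 by (intro mult_right_mono q\<zeta>) simp
      moreover have "(8192 * f0 * R) * ((2 * \<Lambda>) * (real m * \<sigma>)) = 2 * \<Lambda> * (4096 * Wm)" by (simp add: Wm_def)
      moreover have "(real q * (\<zeta>\<^sup>2 * cD)) * ((2 * \<Lambda>) * (real m * \<sigma>)) = Y\<^sup>2" unfolding YY Nq by simp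
      ultimately have "2 * \<Lambda> * (4096 * Wm) \<le> Y\<^sup>2" by (simp only:)
      then show ?thesis using Wm0 by (simp add: le_divide_eq)
    qed
    have "16 \<le> Y\<^sup>2 / (4096 * Wm)" using Ym \<Lambda>8 by linarith
    then have "16 * (4096 * Wm) \<le> Y\<^sup>2" using Wm0 by (simp add: le_divide_eq)
    then have Ym3: "65536 * Wm \<le> Y\<^sup>2" by simp
    have "(\<zeta> * real q * \<sigma>) * (real m * \<sigma>) \<le> (8 * f0 * R) * (real m * \<sigma>)"
      using sm(7) \<sigma>0 by (intro mult_right_mono) auto
    then have Ym2: "Y \<le> 4 * Wm" by (simp add: Y_def Wm_def Nq power2_eq_square mult_ac)
    have lipm: "cdf_lipschitz (2 * f0) (t0 - R * \<sigma>) (t0 + R * \<sigma>)"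
      using R\<sigma> by (intro cdf_lipschitz_subset[OF lip2]) auto
    obtain A' where A': "A' \<in> sets (sample {..<m})"
      "measure (sample {..<m}) A' \<le> 4 * exp (- Y\<^sup>2 / (4096 * (real m * (2 * f0 * (R * \<sigma>)))))"
      "\<forall>x\<in>space (sample {..<m}) - A'. \<forall>n\<le>m. \<forall>t. \<bar>t - t0\<bar> \<le> R * \<sigma> \<longrightarrow> \<bar>dev x n t - dev x n t0\<bar> \<le> Y"
      by (rule oscillation_two_sided[OF lipm R\<sigma>(1) Y0 Ym2[unfolded Wm_def] Ym3[unfolded Wm_def]]) (rule that)
    have A'E: "measure (sample {..<m}) A' \<le> 4 * E" using A'(2) E2[OF Ym] by (simp add: Wm_def)
    define Wk where "Wk = real k * (4 * f0 * (R * \<sigma>))"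
    have NWk: "Wk \<le> real N * (4 * f0 * (R * \<sigma>))" unfolding Wk_def using Nmk f0(2) R\<sigma> by (intro mult_right_mono) auto
    have Yk2: "Y \<le> 4 * Wk"
    proof -
      have "real m * (2 * f0 * (R * \<sigma>)) \<le> real k * (4 * f0 * (R * \<sigma>))"
      proof (rule mult_mono)
        show "real m \<le> real k" using Nmk by linarith
      qed (use f0(2) R\<sigma> in auto)
      then show ?thesis using Ym2 unfolding Wm_def Wk_def by linarith
    qed
    have Yk3: "16 * (4096 * Wk) \<le> Y\<^sup>2"
    proof -
      have "16 * 16384 * f0 * R \<le> \<Lambda> * (2 * \<zeta>\<^sup>2 * cD)" using \<Lambda>\<zeta> \<zeta> cD by (simp add: pos_divide_le_eq)
      then have "16 * 16384 * f0 * R * (real N * \<sigma>) \<le> \<Lambda> * (2 * \<zeta>\<^sup>2 * cD) * (real N * \<sigma>)"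
        using \<sigma>0 by (intro mult_right_mono) auto
      also have "\<dots> = Y\<^sup>2" unfolding YY by simp
      also have "16 * 16384 * f0 * R * (real N * \<sigma>) = 16 * (4096 * (real N * (4 * f0 * (R * \<sigma>))))" by simp
      finally show ?thesis using NWk by linarith
    qed
    have \<Lambda>k: "(1/2 + \<gamma>) * (real k * ((1 + \<kappa>) * D\<^sup>2 * (\<sigma> + \<tau>) ^ 3 / (3 * f0))) + 2 / \<gamma> \<le> (1 - \<epsilon>) * \<Lambda>"
    proof -
      have "real k * ((1 + \<kappa>) * D\<^sup>2 * (\<sigma> + \<tau>) ^ 3 / (3 * f0)) \<le> real N * ((1 + \<rho>) * D\<^sup>2 * (\<sigma> + \<tau>) ^ 3 / (3 * f0))"
        using \<kappa> Nmk f0(2) \<sigma>0 \<tau> by (intro mult_mono divide_right_mono mult_right_mono) auto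
      also have "\<dots> = (1 + \<rho>) ^ 4 * D\<^sup>2 / (3 * f0) * (real N * \<sigma> ^ 3)"
      proof -
        have "\<sigma> + \<tau> = (1 + \<rho>) * \<sigma>" by (simp add: \<tau>_def algebra_simps)
        then show ?thesis by (simp add: power_mult_distrib power4_eq_xxxx power3_eq_cube)
      qed
      also have "\<dots> = 2 * r1 * \<Lambda>"
      proof -
        have "cD = (1 + \<rho>) ^ 3 * c ^ 3 / D ^ 3" by (simp add: cD_def c'_def power_mult_distrib)
        then have "D\<^sup>2 / (3 * f0) * cD = (1 + \<rho>) ^ 3 * r"
          using D f0(2) by (simp add: r_def power2_eq_square power3_eq_cube)
        then have eq: "(1 + \<rho>) ^ 4 * (D\<^sup>2 / (3 * f0) * cD) = r1"
          by (simp add: r1_def power_add[symmetric] mult.assoc[symmetric])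
        have "(1 + \<rho>) ^ 4 * D\<^sup>2 / (3 * f0) * (cD * (2 * \<Lambda>)) = ((1 + \<rho>) ^ 4 * (D\<^sup>2 / (3 * f0) * cD)) * (2 * \<Lambda>)"
          by simp
        then show ?thesis unfolding Ns eq by simp
      qed
      finally have "(1/2 + \<gamma>) * (real k * ((1 + \<kappa>) * D\<^sup>2 * (\<sigma> + \<tau>) ^ 3 / (3 * f0))) \<le> (1/2 + \<gamma>) * (2 * r1 * \<Lambda>)"
        using \<gamma> by (intro mult_left_mono) auto
      also have "\<dots> = (r1 + 2 * \<gamma> * r1) * \<Lambda>" by (simp add: algebra_simps)
      also have "\<dots> \<le> (r1 + 2 * \<gamma>) * \<Lambda>"
        using \<gamma> r1 \<Lambda>8 by (intro mult_right_mono) auto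
      finally have "(1/2 + \<gamma>) * (real k * ((1 + \<kappa>) * D\<^sup>2 * (\<sigma> + \<tau>) ^ 3 / (3 * f0))) \<le> (r1 + 2 * \<gamma>) * \<Lambda>" .
      moreover have "2 / \<gamma> \<le> \<gamma> * \<Lambda>" using \<Lambda>\<gamma> \<gamma> by (simp add: pos_divide_le_eq mult_ac)
      moreover have "0 \<le> \<gamma> * \<Lambda>" using \<gamma> \<Lambda>8 by simp
      moreover have "(1 - \<epsilon>) * \<Lambda> = (r1 + 2 * \<gamma>) * \<Lambda> + 2 * (\<gamma> * \<Lambda>)" by (simp add: \<epsilon>_def \<gamma>_def field_simps)
      ultimately show ?thesis by linarith
    qed
    have R\<sigma>t: "R * \<sigma> < t0" using R\<sigma> L t0 by linarith
    have fR: "f (t0 - R * \<sigma>) \<le> 2 * f0" using antiD[OF tL, of "t0 - R * \<sigma>"] R\<sigma> fL by linarith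
    have b5: "D / f0 * (\<sigma> + \<tau>) \<le> b" "D * (\<sigma> + \<tau>)\<^sup>2 \<le> b" using sm(5,6) by (simp_all only: \<tau>_def less_imp_le)
    obtain B where B: "B \<in> sets (sample {..<k})" "exp (- ((1 - \<epsilon>) * \<Lambda>)) / 4 \<le> measure (sample {..<k}) B"
      "\<forall>x\<in>B. \<forall>t. \<bar>t - t0\<bar> \<le> R * \<sigma> \<longrightarrow>
      \<bar>(cnt x k t - real k * cdf (tilted_law \<sigma> \<tau>) t) - (cnt x k t0 - real k * cdf (tilted_law \<sigma> \<tau>) t0)\<bar> \<le> Y"
      by (rule tilted_block[OF \<sigma>0 \<tau>(1) \<sigma>t \<kappa>(5,4) fs \<gamma> b(2,3) b5 R\<sigma>(1) R\<sigma>t fR Y0 Yk2[unfolded Wk_def] Yk3[unfolded Wk_def] \<Lambda>k]) (rule that)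
    define A where "A = AF \<union> AP"
    have A: "A \<in> sets (sample {..<N})" using AF(1) AP(1) by (simp add: A_def)
    have "measure (sample {..<N}) A \<le> measure (sample {..<N}) AF + measure (sample {..<N}) AP"
      unfolding A_def by (rule measure_Un_le[OF AF(1) AP(1)])
    then have AE: "measure (sample {..<N}) A \<le> C * E" using AFE APE by (simp add: C_def)
    have E0: "0 \<le> E" by (simp add: E_def)
    have A'C: "measure (sample {..<m}) A' \<le> C * E" using A'E E0 by (simp add: C_def)
    have "f0 + c * rate N \<le> grenander x N t0"
      if x: "restrict x {..<N} \<notin> A" "restrict x {..<m} \<notin> A'" "restrict (\<lambda>i. x (m + i)) {..<k} \<in> B" for x
    proof -
      define g where "g = D * \<sigma>\<^sup>2 * (g1 / 2)"
      have xF: "restrict x {..<N} \<in> space (sample {..<N}) - AF" and xP: "restrict x {..<N} \<in> space (sample {..<N}) - AP"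
        and xm: "restrict x {..<m} \<in> space (sample {..<m}) - A'"
        using x restrict_space_sample by (auto simp: A_def)
      have "f0 + D * s \<le> grenander x N t0"
      proof (rule grenander_ge_deterministic[OF e \<kappa>(1,2) Nmk(1) N s0 s\<sigma> \<tau> R _ z_def u0(1) u0L])
        show "R * \<sigma> \<le> L / 2" using sm(1) by simp
        have "(f0 + D * s) * u0 \<le> 2 * f0 * u0"
        proof (rule mult_right_mono)
          have "D * s \<le> D * \<sigma>" using s\<sigma> D by (intro mult_left_mono) auto
          then show "f0 + D * s \<le> 2 * f0" using sm(3) by linarith
        qed (use u0 in simp)
        then show "(f0 + D * s) * u0 \<le> D * L\<^sup>2 / 64" using u0f by (simp add: dl_def)
        show "f0 * \<tau> + D * \<sigma> * (\<tau> + t0) + 4 * z * (R * \<sigma>)\<^sup>2 + 2 * d \<le> 3 / 64 * (D * L\<^sup>2)"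
          using sm(2) d(3) dl unfolding \<tau>_def dl_def[symmetric] by linarith
        show "4 * Y + real m * (D * (\<tau>\<^sup>2 + \<sigma> * (\<tau> + R * \<sigma>))) \<le> real k * g"
        proof -
          have "\<tau>\<^sup>2 + \<sigma> * (\<tau> + R * \<sigma>) \<le> \<sigma>\<^sup>2 + \<sigma> * (\<sigma> + R * \<sigma>)"
            using \<tau> \<sigma>0 by (intro add_mono power_mono mult_left_mono order_refl) auto
          also have "\<dots> = \<sigma>\<^sup>2 * (2 + R)" by (simp add: power2_eq_square algebra_simps)
          finally have "real m * (D * (\<tau>\<^sup>2 + \<sigma> * (\<tau> + R * \<sigma>))) \<le> real m * (D * (\<sigma>\<^sup>2 * (2 + R)))"
            using D by (intro mult_left_mono) auto
          also have "\<dots> = (D * \<sigma>\<^sup>2 / 8) * real m * (8 * (2 + R))" by simp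
          also have "\<dots> \<le> (D * \<sigma>\<^sup>2 / 8) * real m * (real q * g1)"
            using D by (intro mult_left_mono qg) auto
          also have "\<dots> = D * \<sigma>\<^sup>2 * g1 * real N / 8" by (simp add: Nq)
          finally have "real m * (D * (\<tau>\<^sup>2 + \<sigma> * (\<tau> + R * \<sigma>))) \<le> D * \<sigma>\<^sup>2 * g1 * real N / 8" .
          moreover have "4 * Y = D * \<sigma>\<^sup>2 * g1 * real N / 8" by (simp add: Y_def \<zeta>_def)
          moreover have "(D * \<sigma>\<^sup>2 * g1 / 4) * real N \<le> (D * \<sigma>\<^sup>2 * g1 / 4) * (2 * real k)"
            using D g1 Nmk by (intro mult_left_mono) auto
          moreover have "(D * \<sigma>\<^sup>2 * g1 / 4) * real N = 2 * (D * \<sigma>\<^sup>2 * g1 * real N / 8)" by simp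
          moreover have "real k * g = (D * \<sigma>\<^sup>2 * g1 / 4) * (2 * real k)" by (simp add: g_def)
          ultimately show ?thesis by linarith
        qed
        show "(f0 + D * s) * (\<tau> + h) + g \<le> cdf (tilted_law \<sigma> \<tau>) (t0 + \<tau>) - cdf (tilted_law \<sigma> \<tau>) (t0 - h)"
          if h: "0 \<le> h" "h \<le> R * \<sigma>" for h
        proof -
          have f2: "f (t0 - \<sigma>) \<le> 2 * f0" using antiD[OF tL, of "t0 - \<sigma>"] \<sigma>L fL by linarith
          note nn = tilted_nonneg[OF less_imp_le[OF \<sigma>0] \<tau>(1) \<sigma>t f2 b(2) b5]
          have \<tau>L: "\<tau> \<le> L" using \<tau> \<sigma>L by linarith
          have sm4: "(1 + \<kappa>) * D * \<tau> \<le> \<kappa> * f0"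
          proof -
            have "(1 + \<kappa>) * D * \<tau> \<le> (1 + \<kappa>) * D * \<sigma>" using \<kappa> D \<tau> by (intro mult_left_mono) auto
            then show ?thesis using sm(4) by linarith
          qed
          have hL: "h \<le> L" using h R\<sigma> by linarith
          note G = tilted_law_ge[OF e \<kappa>(1,4) less_imp_le[OF \<sigma>0] \<tau>(1) \<sigma>L \<tau>L nn(1) fL sm4 h(1) hL]
          have sq2: "(\<sigma> + \<tau>)\<^sup>2 \<le> (2 * \<sigma>)\<^sup>2"
          proof (rule power_mono)
            show "\<sigma> + \<tau> \<le> 2 * \<sigma>" "0 \<le> \<sigma> + \<tau>" using \<tau> \<sigma>0 by linarith+
          qed
          have q1: "h\<^sup>2 + \<tau>\<^sup>2 + (\<sigma> + \<tau>)\<^sup>2 \<le> \<sigma>\<^sup>2 * (R\<^sup>2 + 5)"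
          proof -
            have "h\<^sup>2 \<le> (R * \<sigma>)\<^sup>2" by (rule power_mono[OF h(2,1)])
            moreover have "\<tau>\<^sup>2 \<le> \<sigma>\<^sup>2" by (rule power_mono[OF \<tau>(2,1)])
            ultimately show ?thesis using sq2 by (simp add: power_mult_distrib algebra_simps)
          qed
          have "\<kappa> * D / 2 * (h\<^sup>2 + \<tau>\<^sup>2 + (\<sigma> + \<tau>)\<^sup>2) \<le> \<kappa> * D / 2 * (\<sigma>\<^sup>2 * (R\<^sup>2 + 5))"
            using \<kappa> D by (intro mult_left_mono q1) auto
          also have "\<dots> = (D * \<sigma>\<^sup>2) * (\<kappa> / 2 * (R\<^sup>2 + 5))" by simp
          also have "\<dots> \<le> (D * \<sigma>\<^sup>2) * (g1 / 4)" using D by (intro mult_left_mono \<kappa>R) auto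
          finally have e1: "\<kappa> * D / 2 * (h\<^sup>2 + \<tau>\<^sup>2 + (\<sigma> + \<tau>)\<^sup>2) \<le> D * \<sigma>\<^sup>2 * (g1 / 4)" .
          have "D * (\<sigma> + \<tau>)\<^sup>2 * (2 * f0 * (\<tau> + h)) \<le> D * (2 * \<sigma>)\<^sup>2 * (2 * f0 * (\<sigma> + R * \<sigma>))"
          proof (rule mult_mono)
            show "D * (\<sigma> + \<tau>)\<^sup>2 \<le> D * (2 * \<sigma>)\<^sup>2" using D by (intro mult_left_mono sq2) auto
            have "\<tau> + h \<le> \<sigma> + R * \<sigma>" using \<tau> h by linarith
            then show "2 * f0 * (\<tau> + h) \<le> 2 * f0 * (\<sigma> + R * \<sigma>)" using f0(2) by (intro mult_left_mono) auto
            show "0 \<le> D * (2 * \<sigma>)\<^sup>2" "0 \<le> 2 * f0 * (\<tau> + h)" using D f0(2) \<tau> h by simp_all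
          qed
          also have "\<dots> = (D * \<sigma>\<^sup>2) * (8 * f0 * (1 + R) * \<sigma>)" by (simp add: power2_eq_square algebra_simps)
          also have "\<dots> \<le> (D * \<sigma>\<^sup>2) * (g1 / 4)" using D sm(8) by (intro mult_left_mono) auto
          finally have e2: "D * (\<sigma> + \<tau>)\<^sup>2 * (2 * f0 * (\<tau> + h)) \<le> D * \<sigma>\<^sup>2 * (g1 / 4)" .
          have e3: "D * s * (\<tau> + h) + D * \<sigma>\<^sup>2 * g1 \<le> D * \<sigma> * (\<tau> + h)"
          proof -
            have "\<sigma> / 2 * \<rho> \<le> \<sigma> - s"
            proof -
              have "\<sigma> - s = \<rho> * s" by (simp add: \<sigma>s algebra_simps)
              moreover have "\<sigma> \<le> 2 * s" unfolding \<sigma>s using \<rho> s0 by (intro mult_right_mono) auto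
              then have "\<rho> * \<sigma> \<le> \<rho> * (2 * s)" using \<rho> by (intro mult_left_mono) auto
              ultimately show ?thesis by (simp add: mult.commute)
            qed
            then have "(\<sigma> / 2 * \<rho>) * (\<rho> * \<sigma>) \<le> (\<sigma> - s) * (\<tau> + h)"
              using \<sigma>0 \<rho> s\<sigma> h by (intro mult_mono) (auto simp: \<tau>_def)
            then have "D * ((\<sigma> / 2 * \<rho>) * (\<rho> * \<sigma>)) \<le> D * ((\<sigma> - s) * (\<tau> + h))" using D by (intro mult_left_mono) auto
            moreover have "D * ((\<sigma> / 2 * \<rho>) * (\<rho> * \<sigma>)) = D * \<sigma>\<^sup>2 * g1" by (simp add: g1_def power2_eq_square)
            moreover have "D * ((\<sigma> - s) * (\<tau> + h)) = D * \<sigma> * (\<tau> + h) - D * s * (\<tau> + h)" by (simp add: algebra_simps)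
            ultimately show ?thesis by linarith
          qed
          have "(f0 + D * s) * (\<tau> + h) = f0 * (\<tau> + h) + D * s * (\<tau> + h)" by (simp add: algebra_simps)
          moreover have "g = D * \<sigma>\<^sup>2 * g1 - 2 * (D * \<sigma>\<^sup>2 * (g1 / 4))" by (simp add: g_def)
          ultimately show ?thesis using G e1 e2 e3 by linarith
        qed
        show "\<bar>(cnt (\<lambda>i. x (m + i)) k t - real k * cdf (tilted_law \<sigma> \<tau>) t)
            - (cnt (\<lambda>i. x (m + i)) k t0 - real k * cdf (tilted_law \<sigma> \<tau>) t0)\<bar> \<le> Y"
          if "\<bar>t - t0\<bar> \<le> R * \<sigma>" for t
          using B(3) x(3) that unfolding cnt_restrict[OF order_refl, symmetric, of "\<lambda>i. x (m + i)" k] by blast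
        show "\<bar>dev x m t - dev x m t0\<bar> \<le> Y" if "\<bar>t - t0\<bar> \<le> R * \<sigma>" for t
          using A'(3)[rule_format, OF xm order_refl that] unfolding dev_restrict[OF order_refl] .
        show "\<bar>dev x N t - dev x N t0\<bar> \<le> 4 * (z * real N) * (max (R * \<sigma>) \<bar>t - t0\<bar>)\<^sup>2"
          if "\<bar>t - t0\<bar> \<le> L / 2" for t
          using AP(3)[rule_format, OF xP order_refl that] unfolding dev_restrict[OF order_refl] .
        show "\<bar>dev x N t - dev x N u0\<bar> \<le> d * real N" if "u0 \<le> t" "t \<le> t0" for t
        proof -
          have "t \<le> u0 + l" using that by (simp add: l_def)
          from AF(3)[rule_format, OF xF order_refl that(1) this] show ?thesis
            unfolding yf_def dev_restrict[OF order_refl] .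
        qed
      qed
      then show ?thesis by (simp add: Ds)
    qed
    then show ?case unfolding N_def[symmetric] \<Lambda>_def[symmetric] E_def[symmetric] k_def[symmetric]
      using A AE A'(1) A'C B(1,2) by blast
  qed
  with q2 \<epsilon> show ?thesis by (rule that)
qed

end

section \<open>The law of the iterated logarithm\<close>

text \<open>Serves to replace the rate at the end of a block by the rate at \<open>n\<close>. The
  inequality \<open>ln z <= z - 1\<close> is applied to \<open>ln N / ln n\<close> and then to
  \<open>N / n\<close>, and \<open>1 <= ln (ln n)\<close> absorbs the result.\<close>

lemma rate_antimono:
  assumes n: "1 \<le> ln (real n)" "1 \<le> ln (ln (real n))" "n \<le> N"
  shows "rate N \<le> rate n"
proof -
  have n0: "0 < n" using n(1) by (intro gr0I) auto
  have N0: "0 < N" using n0 n(3) by simp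
  have lnn: "ln (real n) \<le> ln (real N)" using n0 n(3) by simp
  have "ln (ln (real N)) - ln (ln (real n)) = ln (ln (real N) / ln (real n))"
    using n lnn by (subst ln_div) auto
  also have "\<dots> \<le> ln (real N) / ln (real n) - 1" using n lnn by (intro ln_le_minus_one) auto
  also have "\<dots> = (ln (real N) - ln (real n)) / ln (real n)" using n by (simp add: field_simps)
  also have "\<dots> \<le> ln (real N) - ln (real n)"
    using mult_left_mono[OF n(1), of "ln (real N) - ln (real n)"] lnn n by (simp add: divide_le_eq)
  also have "\<dots> = ln (real N / real n)" by (subst ln_div) (use n0 N0 in simp_all)
  also have "\<dots> \<le> real N / real n - 1" using n0 N0 by (intro ln_le_minus_one) simp
  also have "\<dots> \<le> (real N / real n - 1) * ln (ln (real n))"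
    using n n0 mult_left_mono[OF n(2), of "real N / real n - 1"] by simp
  finally have "ln (ln (real N)) \<le> real N / real n * ln (ln (real n))" by (simp add: algebra_simps)
  then have "2 * ln (ln (real N)) / real N \<le> 2 * ln (ln (real n)) / real n"
    using n0 N0 by (simp add: field_simps)
  moreover have "0 \<le> 2 * ln (ln (real N)) / real N"
  proof -
    have "ln 1 \<le> ln (ln (real N))" using n lnn by (subst ln_le_cancel_iff) auto
    then show ?thesis by simp
  qed
  ultimately show ?thesis unfolding rate_def by (intro powr_mono2) auto
qed

text \<open>The spaces \<open>N k\<close> vary because the blocks have different lengths. By
  independence and \<open>1 - p <= exp (- p)\<close>, a positive probability that nothing occurs
  from \<open>m\<close> on would bound the partial sums of \<open>p\<close> by minus its
  logarithm.\<close>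

lemma (in prob_space) borel_cantelli_independent:
  assumes ind: "indep_vars N Z UNIV" and B: "\<And>k::nat. B k \<in> sets (N k)"
    and ns: "\<not> summable (\<lambda>k. prob (Z k -` B k \<inter> space M))"
  shows "AE \<omega> in M. \<exists>\<^sub>F k in sequentially. Z k \<omega> \<in> B k"
proof -
  define p where "p k = prob (Z k -` B k \<inter> space M)" for k
  define E where "E k = Z k -` (space (N k) - B k) \<inter> space M" for k
  have Z: "Z k \<in> measurable M (N k)" for k using ind by (auto simp: indep_vars_def)
  have ev: "Z k -` B k \<inter> space M \<in> events" for k by (rule measurable_sets[OF Z B])
  have E: "E k \<in> events" for k unfolding E_def using B by (intro measurable_sets[OF Z]) auto
  have Ek: "E k = space M - (Z k -` B k \<inter> space M)" for k
    using measurable_space[OF Z] by (auto simp: E_def)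
  have pE: "prob (E k) = 1 - p k" for k unfolding Ek p_def by (rule prob_compl[OF ev])
  have null: "(\<Inter>k\<in>{m..}. E k) \<in> null_sets M" for m
  proof -
    have le: "prob (\<Inter>k\<in>{m..}. E k) \<le> exp (- (\<Sum>k\<in>{m..<j}. p k))" if "m < j" for j
    proof -
      have I: "{m..<j} \<noteq> {}" using that by auto
      have "prob (\<Inter>k\<in>{m..}. E k) \<le> prob (\<Inter>k\<in>{m..<j}. E k)"
        using E I by (intro finite_measure_mono) auto
      also have "\<dots> = (\<Prod>k\<in>{m..<j}. prob (E k))"
        unfolding E_def using B by (intro indep_varsD[OF ind I]) auto
      also have "\<dots> \<le> (\<Prod>k\<in>{m..<j}. exp (- p k))"
      proof (rule prod_mono)
        fix k
        show "0 \<le> prob (E k) \<and> prob (E k) \<le> exp (- p k)"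
          using exp_ge_add_one_self[of "- p k"] by (simp add: pE[symmetric])
      qed
      also have "\<dots> = exp (- (\<Sum>k\<in>{m..<j}. p k))" by (simp add: exp_sum sum_negf[symmetric])
      finally show ?thesis .
    qed
    have "prob (\<Inter>k\<in>{m..}. E k) \<le> 0"
    proof (rule ccontr)
      assume "\<not> ?thesis"
      then have pos: "0 < prob (\<Inter>k\<in>{m..}. E k)" by simp
      define b where "b = - ln (prob (\<Inter>k\<in>{m..}. E k))"
      have "(\<Sum>k\<in>{m..<j}. p k) \<le> b" if "m < j" for j
      proof -
        have "ln (prob (\<Inter>k\<in>{m..}. E k)) \<le> ln (exp (- (\<Sum>k\<in>{m..<j}. p k)))"
          using le[OF that] pos by (subst ln_le_cancel_iff) auto
        then show ?thesis by (simp add: b_def)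
      qed
      then have bnd: "(\<Sum>k\<in>{m..<j}. p k) \<le> max b 0" for j by (cases "m < j") force+
      have "summable (\<lambda>i. p (i + m))"
      proof (rule summableI_nonneg_bounded)
        show "(\<Sum>i<j. p (i + m)) \<le> max b 0" for j
          using bnd[of "j + m"] sum.shift_bounds_nat_ivl[of p 0 m j] by (simp add: lessThan_atLeast0)
      qed (simp add: p_def)
      then have "summable p" by (simp add: summable_iff_shift)
      with ns show False by (simp add: p_def[abs_def])
    qed
    then have "prob (\<Inter>k\<in>{m..}. E k) = 0" by (simp add: measure_le_0_iff)
    moreover have "(\<Inter>k\<in>{m..}. E k) \<in> events" using E by (intro sets.countable_INT) auto
    ultimately show ?thesis by (simp add: null_sets_def emeasure_eq_measure)
  qed
  have "AE \<omega> in M. \<forall>m. \<omega> \<notin> (\<Inter>k\<in>{m..}. E k)"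
    unfolding AE_all_countable by (intro allI AE_not_in null)
  then show ?thesis
  proof (rule AE_mp, intro AE_I2 impI)
    fix \<omega> assume \<omega>: "\<omega> \<in> space M" "\<forall>m. \<omega> \<notin> (\<Inter>k\<in>{m..}. E k)"
    show "\<exists>\<^sub>F k in sequentially. Z k \<omega> \<in> B k"
      unfolding frequently_sequentially
    proof
      fix m
      from \<omega>(2) obtain k where "m \<le> k" "\<omega> \<notin> E k" by auto
      then show "\<exists>k\<ge>m. Z k \<omega> \<in> B k" using \<omega>(1) unfolding Ek by auto
    qed
  qed
qed

text \<open>Reindexing is a special case of grouping: the groups are the singletons
  \<open>{m + j}\<close>.\<close>

lemma (in prob_space) indep_vars_shift:
  assumes "indep_vars (\<lambda>_. borel) X (UNIV :: nat set)"
  shows "indep_vars (\<lambda>_. borel) (\<lambda>i. X (m + i)) (UNIV :: nat set)"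
proof -
  have "indep_vars (\<lambda>j. Pi\<^sub>M {m + j} (\<lambda>_. borel)) (\<lambda>j \<omega>. restrict (\<lambda>i. X i \<omega>) {m + j}) UNIV"
    using assms by (rule indep_vars_restrict) (auto simp: disjoint_family_on_def)
  then have "indep_vars (\<lambda>_. borel) (\<lambda>j \<omega>. (restrict (\<lambda>i. X i \<omega>) {m + j}) (m + j)) UNIV"
    by (rule indep_vars_compose2) measurable
  then show ?thesis by simp
qed

locale decreasing_sample = decreasing_density f t0 f0 D + P: prob_space M
  for f t0 f0 D and M :: "'a measure" +
  fixes X :: "nat \<Rightarrow> 'a \<Rightarrow> real"
  assumes indep: "P.indep_vars (\<lambda>_. borel) X UNIV"
    and distr_X: "\<And>i. distr M borel (X i) = density lborel (\<lambda>x. ennreal (f x))"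
begin

text \<open>A window of observations shifted to start at index 0, so that its law is
  \<open>sample {..<n}\<close> wherever it lies.\<close>

definition block :: "nat \<Rightarrow> nat \<Rightarrow> 'a \<Rightarrow> nat \<Rightarrow> real" where
  "block m n \<omega> = restrict (\<lambda>i. X (m + i) \<omega>) {..<n}"

lemma X_measurable[measurable]: "X i \<in> borel_measurable M"
  using indep by (auto simp: P.indep_vars_def)

lemma block_measurable: "block m n \<in> measurable M (sample {..<n})"
proof -
  have "block m n \<in> measurable M (Pi\<^sub>M {..<n} (\<lambda>_. borel))"
    unfolding block_def by (rule measurable_restrict) measurable
  then show ?thesis by (simp only: measurable_cong_sets[OF refl sets_sample])
qed

lemma distr_block:
  assumes "0 < n"
  shows "distr M (sample {..<n}) (block m n) = sample {..<n}"
proof -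
  have iv: "P.indep_vars (\<lambda>_. borel) (\<lambda>i. X (m + i)) {..<n}"
    by (rule P.indep_vars_subset[OF P.indep_vars_shift[OF indep]]) auto
  have ne: "{..<n} \<noteq> {}" using assms by auto
  have "distr M (Pi\<^sub>M {..<n} (\<lambda>_. borel)) (\<lambda>\<omega>. \<lambda>i\<in>{..<n}. X (m + i) \<omega>)
      = Pi\<^sub>M {..<n} (\<lambda>i. distr M borel (X (m + i)))"
    by (rule P.indep_vars_iff_distr_eq_PiM'[OF ne, THEN iffD1]) (use iv in simp_all)
  also have "\<dots> = sample {..<n}" by (simp add: distr_X)
  finally show ?thesis
    unfolding block_def by (subst distr_cong[OF refl sets_sample refl])
qed

lemma prob_block:
  assumes "0 < n" "A \<in> sets (sample {..<n})"
  shows "P.prob (block m n -` A \<inter> space M) = measure (sample {..<n}) A"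
  using measure_distr[OF block_measurable assms(2), of m] distr_block[OF assms(1), of m] by simp

lemma AE_eventually_not_in:
  assumes A: "\<And>k. A k \<in> sets (sample {..<n k})" and n: "eventually (\<lambda>k. 0 < n k) sequentially"
    and le: "eventually (\<lambda>k. measure (sample {..<n k}) (A k) \<le> g k) sequentially" and g: "summable g"
  shows "AE \<omega> in M. eventually (\<lambda>k. block 0 (n k) \<omega> \<notin> A k) sequentially"
proof -
  have "AE \<omega> in M. eventually (\<lambda>k. \<omega> \<in> space M - (block 0 (n k) -` A k \<inter> space M)) sequentially"
  proof (rule borel_cantelli_AE1)
    show "block 0 (n k) -` A k \<inter> space M \<in> P.events" for k by (rule measurable_sets[OF block_measurable A])
    show "emeasure M (block 0 (n k) -` A k \<inter> space M) < \<infinity>" for k by (simp add: P.emeasure_eq_measure)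
    show "summable (\<lambda>k. P.prob (block 0 (n k) -` A k \<inter> space M))"
    proof (rule summable_comparison_test_ev[OF _ g])
      show "eventually (\<lambda>k. norm (P.prob (block 0 (n k) -` A k \<inter> space M)) \<le> g k) sequentially"
        using n le by eventually_elim (simp add: prob_block A)
    qed
  qed
  then show ?thesis by (rule AE_mp) (auto intro!: AE_I2 elim!: eventually_mono)
qed

end

text \<open>\<open>ln (N k)\<close> is at least of order \<open>k\<close>, so the terms are at most
  of order \<open>k powr (- s)\<close>. The factor 1/2 in the hypothesis allows for rounding the
  powers of \<open>q\<close>.\<close>

lemma summable_lnln:
  assumes q: "1 < q" and N: "eventually (\<lambda>k. q ^ k / 2 \<le> real (N k)) sequentially" and s: "1 < s"
  shows "summable (\<lambda>k. C * exp (- (s * ln (ln (real (N k))))))"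
proof (rule summable_mult, rule summable_comparison_test_ev)
  show "summable (\<lambda>k. (ln q / 2) powr (- s) * of_nat k powr (- s))"
    using s by (intro summable_mult) (simp add: summable_real_powr_iff)
  have lq: "0 < ln q" using q by simp
  show "eventually (\<lambda>k. norm (exp (- (s * ln (ln (real (N k)))))) \<le> (ln q / 2) powr (- s) * of_nat k powr (- s)) sequentially"
    \<comment> \<open>From this index on, \<open>ln 2\<close> is at most half of
      \<open>k * ln q\<close>.\<close>
    using N eventually_ge_at_top[of "nat \<lceil>2 * ln 2 / ln q\<rceil>"] eventually_gt_at_top[of 0]
  proof eventually_elim
    case (elim k)
    have "2 * ln 2 / ln q \<le> real k" using elim(2) by linarith
    then have k: "2 * ln 2 \<le> real k * ln q" using lq by (simp add: divide_le_eq)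
    have qk: "0 < q ^ k / 2" using q by simp
    have "ln (q ^ k / 2) \<le> ln (real (N k))" using elim(1) qk by (subst ln_le_cancel_iff) auto
    moreover have "ln (q ^ k / 2) = real k * ln q - ln 2" using q by (simp add: ln_div ln_realpow)
    ultimately have l: "ln q / 2 * real k \<le> ln (real (N k))" using k by (simp add: algebra_simps)
    have pos: "0 < ln q / 2 * real k" using lq elim(3) by simp
    have "exp (- (s * ln (ln (real (N k))))) = ln (real (N k)) powr (- s)"
      using pos l by (simp add: powr_def)
    also have "\<dots> \<le> (ln q / 2 * real k) powr (- s)"
      using pos l s by (intro powr_mono2') auto
    also have "\<dots> = (ln q / 2) powr (- s) * of_nat k powr (- s)" using lq by (subst powr_mult) auto
    finally show ?case by simp
  qed
qed

text \<open>For exact powers \<open>ln (q ^ Suc k) = Suc k * ln q\<close>, so the terms dominate a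
  multiple of a power series in \<open>k\<close> with exponent
  \<open>1 - \<epsilon> < 1\<close>.\<close>

lemma not_summable_lnln:
  assumes q: "2 \<le> q" and \<epsilon>: "0 < \<epsilon>"
    and p: "eventually (\<lambda>k. exp (- ((1 - \<epsilon>) * ln (ln (real (q ^ Suc k))))) / 4 \<le> p k) sequentially"
  shows "\<not> summable p"
proof
  assume "summable p"
  have lq: "0 < ln (real q)" using q by simp
  have "summable (\<lambda>k. (ln (real q)) powr (- (1 - \<epsilon>)) / 4 * of_nat (Suc k) powr (- (1 - \<epsilon>)))"
  proof (rule summable_comparison_test_ev[OF _ \<open>summable p\<close>])
    show "eventually (\<lambda>k. norm ((ln (real q)) powr (- (1 - \<epsilon>)) / 4 * of_nat (Suc k) powr (- (1 - \<epsilon>))) \<le> p k) sequentially"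
      using p
    proof eventually_elim
      case (elim k)
      have "ln (real (q ^ Suc k)) = real (Suc k) * ln (real q)" using q by (simp add: ln_mult ln_realpow algebra_simps)
      then have "exp (- ((1 - \<epsilon>) * ln (ln (real (q ^ Suc k))))) = (real (Suc k) * ln (real q)) powr (- (1 - \<epsilon>))"
        using lq by (simp add: powr_def left_diff_distrib del: of_nat_Suc)
      also have "\<dots> = real (Suc k) powr (- (1 - \<epsilon>)) * ln (real q) powr (- (1 - \<epsilon>))"
        by (rule powr_mult)
      finally show ?case using elim by (simp add: mult.commute)
    qed
  qed
  then have "summable (\<lambda>k. (ln (real q)) powr (- (1 - \<epsilon>)) / 4 * of_nat k powr (- (1 - \<epsilon>)))"
    by (subst (asm) summable_Suc_iff)
  then have "summable (\<lambda>k. real k powr (- (1 - \<epsilon>)))" using lq by (subst (asm) summable_cmult_iff) simp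
  then have "- (1 - \<epsilon>) < -1" by (simp only: summable_real_powr_iff)
  with \<epsilon> show False by simp
qed

section \<open>Almost sure bounds from both sides\<close>

context decreasing_sample
begin

text \<open>The first block end not below \<open>n\<close> is at most \<open>q * n\<close>, so the
  exceptional set of that block controls the estimator at \<open>n\<close>. The bound obtained there
  involves the rate at the block end, which is at most \<open>rate n\<close>.\<close>

lemma AE_eventually_le:
  assumes c: "0 < c" "3 * f0 * D < c ^ 3"
  shows "AE \<omega> in M. eventually (\<lambda>n. grenander (\<lambda>i. X i \<omega>) n t0 \<le> f0 + c * rate n) sequentially"
proof -
  obtain q \<epsilon> C where q: "1 < q" and \<epsilon>: "0 < \<epsilon>"
    and ev: "eventually (\<lambda>N. \<exists>A. A \<in> sets (sample {..<N})
        \<and> measure (sample {..<N}) A \<le> C * exp (- ((1 + \<epsilon>) * ln (ln (real N))))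
        \<and> (\<forall>x\<in>space (sample {..<N}) - A. \<forall>n. 0 < n \<longrightarrow> n \<le> N \<longrightarrow> real N \<le> q * real n
              \<longrightarrow> grenander x n t0 \<le> f0 + c * rate N)) sequentially"
    by (rule upper_block[OF c]) (rule that)
  define G where "G N A \<longleftrightarrow> A \<in> sets (sample {..<N})
        \<and> measure (sample {..<N}) A \<le> C * exp (- ((1 + \<epsilon>) * ln (ln (real N))))
        \<and> (\<forall>x\<in>space (sample {..<N}) - A. \<forall>n. 0 < n \<longrightarrow> n \<le> N \<longrightarrow> real N \<le> q * real n
              \<longrightarrow> grenander x n t0 \<le> f0 + c * rate N)" for N A
  \<comment> \<open>The default \<open>{}\<close> keeps \<open>A N\<close> measurable for the
    finitely many \<open>N\<close> without a suitable set.\<close>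
  define A where "A N = (if \<exists>A. G N A then SOME A. G N A else {})" for N
  have GA: "G N (A N)" if "\<exists>A. G N A" for N using that by (simp add: A_def someI_ex)
  have As: "A N \<in> sets (sample {..<N})" for N
    by (cases "\<exists>A. G N A") (use GA[of N] in \<open>auto simp: G_def A_def\<close>)
  define N where "N k = nat \<lfloor>q ^ k\<rfloor>" for k :: nat
  have Nq: "real (N k) \<le> q ^ k" "q ^ k < real (N k) + 1" for k
  proof -
    have "0 \<le> q ^ k" using q by simp
    then show "real (N k) \<le> q ^ k" "q ^ k < real (N k) + 1" unfolding N_def by linarith+
  qed
  have q1: "1 \<le> q ^ k" for k using q by simp
  have Npos: "0 < N k" for k using Nq(2)[of k] q1[of k] by (intro gr0I) auto
  have Nhalf: "q ^ k / 2 \<le> real (N k)" for k using Nq(2)[of k] Npos[of k] by linarith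
  have above: "\<exists>K. \<forall>k\<ge>K. b \<le> N k" for b
  proof -
    obtain K where K: "real b < q ^ K" using real_arch_pow[OF q, of "real b"] by blast
    have "b \<le> N k" if "K \<le> k" for k
    proof -
      have "q ^ K \<le> q ^ k" using that q by (intro power_increasing) auto
      then show ?thesis using K Nq(2)[of k] by linarith
    qed
    then show ?thesis by blast
  qed
  obtain N0 where N0: "\<And>N. N0 \<le> N \<Longrightarrow> \<exists>A. G N A"
    using ev unfolding eventually_sequentially G_def by blast
  obtain K0 where K0: "\<And>k. K0 \<le> k \<Longrightarrow> N0 \<le> N k" using above by blast
  have GN: "G (N k) (A (N k))" if "K0 \<le> k" for k using GA N0 K0 that by blast
  have "AE \<omega> in M. eventually (\<lambda>k. block 0 (N k) \<omega> \<notin> A (N k)) sequentially"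
  proof (rule AE_eventually_not_in)
    show "A (N k) \<in> sets (sample {..<N k})" for k by (rule As)
    show "eventually (\<lambda>k. 0 < N k) sequentially" using Npos by simp
    show "eventually (\<lambda>k. measure (sample {..<N k}) (A (N k)) \<le> C * exp (- ((1 + \<epsilon>) * ln (ln (real (N k)))))) sequentially"
      using eventually_ge_at_top[of K0] by eventually_elim (use GN in \<open>simp add: G_def\<close>)
    show "summable (\<lambda>k. C * exp (- ((1 + \<epsilon>) * ln (ln (real (N k))))))"
      by (rule summable_lnln[OF q]) (use Nhalf \<epsilon> in simp_all)
  qed
  moreover have "eventually (\<lambda>n. grenander (\<lambda>i. X i \<omega>) n t0 \<le> f0 + c * rate n) sequentially"
    if ev\<omega>: "eventually (\<lambda>k. block 0 (N k) \<omega> \<notin> A (N k)) sequentially" for \<omega>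
  proof -
    obtain K1 where K1: "\<And>k. K1 \<le> k \<Longrightarrow> block 0 (N k) \<omega> \<notin> A (N k)"
      using ev\<omega> unfolding eventually_sequentially by blast
    define K where "K = max K0 K1"
    have "filterlim (\<lambda>n. ln (real n)) at_top sequentially" by real_asymp
    then have ln1: "eventually (\<lambda>n. 1 \<le> ln (real n)) sequentially" by (simp add: filterlim_at_top)
    show ?thesis
      using ln1 eventually_lnln_ge[of 1] eventually_gt_at_top[of 0] eventually_gt_at_top[of "nat \<lceil>q ^ K\<rceil>"]
    proof eventually_elim
      case (elim n)
      have nK: "q ^ K < real n" using elim(4) by linarith
      define k where "k = (LEAST k. n \<le> N k)"
      have "\<exists>k. n \<le> N k" using above[of n] by blast
      then have k: "n \<le> N k" unfolding k_def by (rule LeastI_ex)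
      have "K < k"
      proof (rule ccontr)
        assume "\<not> K < k"
        then have "q ^ k \<le> q ^ K" using q by (intro power_increasing) auto
        then show False using k Nq(1)[of k] nK by linarith
      qed
      then obtain j where j: "k = Suc j" by (cases k) auto
      have "\<not> n \<le> N j" using not_less_Least[of j "\<lambda>k. n \<le> N k"] j unfolding k_def[symmetric] by simp
      \<comment> \<open>The integer inequality \<open>N j + 1 <= n\<close> makes up for the rounding
        in \<open>N j\<close>.\<close>
      then have "q ^ j < real n" using Nq(2)[of j] by linarith
      then have "q ^ k \<le> q * real n" using q by (simp add: j)
      then have kq: "real (N k) \<le> q * real n" using Nq(1)[of k] by linarith
      have kK: "K0 \<le> k" "K1 \<le> k" using \<open>K < k\<close> by (auto simp: K_def)
      have "block 0 (N k) \<omega> \<in> space (sample {..<N k}) - A (N k)"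
        using K1[OF kK(2)] restrict_space_sample by (auto simp: block_def)
      then have "grenander (block 0 (N k) \<omega>) n t0 \<le> f0 + c * rate (N k)"
        using GN[OF kK(1)] elim k kq unfolding G_def by blast
      moreover have "grenander (block 0 (N k) \<omega>) n t0 = grenander (\<lambda>i. X i \<omega>) n t0"
        using grenander_restrict[OF k, of "\<lambda>i. X i \<omega>" t0] by (simp add: block_def)
      moreover have "c * rate (N k) \<le> c * rate n"
        using c(1) by (intro mult_left_mono rate_antimono elim k) auto
      ultimately show ?case by linarith
    qed
  qed
  ultimately show ?thesis by (rule AE_mp[OF _ AE_I2[OF impI]])
qed

text \<open>With \<open>m = q ^ k\<close> and \<open>N = q ^ Suc k\<close> the new observations of
  different blocks have disjoint index ranges, so the events \<open>B\<close> are independent and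
  occur infinitely often. The sets \<open>A\<close> and \<open>A'\<close> involve overlapping
  ranges, but their probabilities are summable, so almost surely they spoil only finitely many of
  these occurrences.\<close>

lemma AE_frequently_ge:
  assumes c: "0 < c" "c ^ 3 < 3 * f0 * D"
  shows "AE \<omega> in M. \<exists>\<^sub>F n in sequentially. f0 + c * rate n \<le> grenander (\<lambda>i. X i \<omega>) n t0"
proof -
  define G where "G q \<epsilon> C m A A' B \<longleftrightarrow> A \<in> sets (sample {..<q * m})
        \<and> measure (sample {..<q * m}) A \<le> C * exp (- (2 * ln (ln (real (q * m)))))
        \<and> A' \<in> sets (sample {..<m})
        \<and> measure (sample {..<m}) A' \<le> C * exp (- (2 * ln (ln (real (q * m)))))
        \<and> B \<in> sets (sample {..<q * m - m})
        \<and> exp (- ((1 - \<epsilon>) * ln (ln (real (q * m))))) / 4 \<le> measure (sample {..<q * m - m}) B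
        \<and> (\<forall>x. restrict x {..<q * m} \<notin> A \<longrightarrow> restrict x {..<m} \<notin> A'
              \<longrightarrow> restrict (\<lambda>i. x (m + i)) {..<q * m - m} \<in> B
              \<longrightarrow> f0 + c * rate (q * m) \<le> grenander x (q * m) t0)" for q :: nat and \<epsilon> C m A A' B
  obtain q :: nat and \<epsilon> C where q: "2 \<le> q" and \<epsilon>: "0 < \<epsilon>"
    and ev: "eventually (\<lambda>m. \<exists>A A' B. G q \<epsilon> C m A A' B) sequentially"
    by (rule lower_block[OF c], rule that, assumption, assumption, unfold G_def, assumption)
  obtain m0 where m0: "\<And>m. m0 \<le> m \<Longrightarrow> \<exists>A A' B. G q \<epsilon> C m A A' B"
    using ev unfolding eventually_sequentially by blast
  define H where "H m S \<longleftrightarrow> G q \<epsilon> C m (fst S) (fst (snd S)) (snd (snd S))" for m S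
  define S where "S m = (if m0 \<le> m then SOME S. H m S else ({}, {}, {}))" for m
  have HS: "H m (S m)" if m: "m0 \<le> m" for m
  proof -
    obtain A A' B where "G q \<epsilon> C m A A' B" using m0[OF m] by blast
    then have "H m (A, A', B)" by (simp add: H_def)
    then have "H m (SOME S. H m S)" by (rule someI)
    then show ?thesis using m by (simp add: S_def)
  qed
  define A where "A m = fst (S m)" for m
  define A' where "A' m = fst (snd (S m))" for m
  define B where "B m = snd (snd (S m))" for m
  have GS: "G q \<epsilon> C m (A m) (A' m) (B m)" if "m0 \<le> m" for m
    using HS[OF that] by (simp add: H_def A_def A'_def B_def)
  have sets: "A m \<in> sets (sample {..<q * m})" "A' m \<in> sets (sample {..<m})" "B m \<in> sets (sample {..<q * m - m})" for m
    by (cases "m0 \<le> m"; use GS[of m] in \<open>simp add: G_def\<close>; simp add: A_def A'_def B_def S_def)+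
  define m where "m k = q ^ k" for k
  have qm: "q * m k = q ^ Suc k" for k by (simp add: m_def)
  have mpos: "0 < m k" "0 < q * m k" "0 < q * m k - m k" for k
  proof -
    show "0 < m k" using q by (simp add: m_def)
    then show "0 < q * m k" using q by simp
    have "m k < q * m k" using q \<open>0 < m k\<close> by simp
    then show "0 < q * m k - m k" by simp
  qed
  have mk: "k \<le> m k" for k
  proof -
    have "k < 2 ^ k" by (rule less_exp)
    also have "2 ^ k \<le> q ^ k" using q by (intro power_mono) auto
    finally show ?thesis by (simp add: m_def)
  qed
  have GSk: "G q \<epsilon> C (m k) (A (m k)) (A' (m k)) (B (m k))" if "m0 \<le> k" for k
    using mk[of k] that by (intro GS) simp
  have q1: "1 < real q" using q by simp
  have half: "real q ^ k / 2 \<le> real (q * m k)" for k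
  proof -
    have "real q ^ k \<le> real q * real q ^ k" using q by simp
    moreover have "0 \<le> real q ^ k" by simp
    moreover have "real (q * m k) = real q * real q ^ k" by (simp add: m_def)
    ultimately show ?thesis by linarith
  qed
  have sum: "summable (\<lambda>k. C * exp (- (2 * ln (ln (real (q * m k))))))"
    by (rule summable_lnln[OF q1]) (use half in simp_all)
  have AEA: "AE \<omega> in M. eventually (\<lambda>k. block 0 (q * m k) \<omega> \<notin> A (m k)) sequentially"
  proof (rule AE_eventually_not_in[OF _ _ _ sum])
    show "eventually (\<lambda>k. measure (sample {..<q * m k}) (A (m k)) \<le> C * exp (- (2 * ln (ln (real (q * m k)))))) sequentially"
      using eventually_ge_at_top[of m0] by eventually_elim (use GSk in \<open>simp only: G_def\<close>)
  qed (use sets mpos in simp_all)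
  have AEA': "AE \<omega> in M. eventually (\<lambda>k. block 0 (m k) \<omega> \<notin> A' (m k)) sequentially"
  proof (rule AE_eventually_not_in[OF _ _ _ sum])
    show "eventually (\<lambda>k. measure (sample {..<m k}) (A' (m k)) \<le> C * exp (- (2 * ln (ln (real (q * m k)))))) sequentially"
      using eventually_ge_at_top[of m0] by eventually_elim (use GSk in \<open>simp only: G_def\<close>)
  qed (use sets mpos in simp_all)
  have AEB: "AE \<omega> in M. \<exists>\<^sub>F k in sequentially. block (m k) (q * m k - m k) \<omega> \<in> B (m k)"
  proof (rule P.borel_cantelli_independent)
    define K where "K k = {m k..<q * m k}" for k
    have "disjoint_family_on K UNIV"
    proof -
      have "K i \<inter> K j = {}" if "i < j" for i j
      proof -
        have "q ^ Suc i \<le> q ^ j" using that q by (intro power_increasing) auto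
        then have "q * m i \<le> m j" by (simp add: m_def)
        then show ?thesis by (auto simp: K_def)
      qed
      then show ?thesis unfolding disjoint_family_on_def by (metis Int_commute linorder_neqE_nat)
    qed
    then have "P.indep_vars (\<lambda>k. Pi\<^sub>M (K k) (\<lambda>_. borel)) (\<lambda>k \<omega>. restrict (\<lambda>i. X i \<omega>) (K k)) UNIV"
      using indep by (intro P.indep_vars_restrict) auto
    then have "P.indep_vars (\<lambda>k. sample {..<q * m k - m k})
        (\<lambda>k \<omega>. (\<lambda>z. restrict (\<lambda>i. z (m k + i)) {..<q * m k - m k}) (restrict (\<lambda>i. X i \<omega>) (K k))) UNIV"
    proof (rule P.indep_vars_compose2)
      fix k
      have "(\<lambda>z. restrict (\<lambda>i. z (m k + i)) {..<q * m k - m k})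
          \<in> measurable (Pi\<^sub>M (K k) (\<lambda>_. borel)) (Pi\<^sub>M {..<q * m k - m k} (\<lambda>_. borel :: real measure))"
        by (rule measurable_restrict) (auto simp: K_def intro!: measurable_component_singleton)
      then show "(\<lambda>z. restrict (\<lambda>i. z (m k + i)) {..<q * m k - m k})
          \<in> measurable (Pi\<^sub>M (K k) (\<lambda>_. borel)) (sample {..<q * m k - m k})"
        by (simp only: measurable_cong_sets[OF refl sets_sample])
    qed
    moreover have "(\<lambda>z. restrict (\<lambda>i. z (m k + i)) {..<q * m k - m k}) (restrict (\<lambda>i. X i \<omega>) (K k))
        = block (m k) (q * m k - m k) \<omega>" for k \<omega>
      by (rule ext) (auto simp: block_def K_def restrict_def)
    ultimately show "P.indep_vars (\<lambda>k. sample {..<q * m k - m k}) (\<lambda>k. block (m k) (q * m k - m k)) UNIV"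
      by simp
    show "B (m k) \<in> sets (sample {..<q * m k - m k})" for k by (rule sets)
    show "\<not> summable (\<lambda>k. P.prob (block (m k) (q * m k - m k) -` B (m k) \<inter> space M))"
    proof (rule not_summable_lnln[OF q \<epsilon>])
      show "eventually (\<lambda>k. exp (- ((1 - \<epsilon>) * ln (ln (real (q ^ Suc k))))) / 4
          \<le> P.prob (block (m k) (q * m k - m k) -` B (m k) \<inter> space M)) sequentially"
        using eventually_ge_at_top[of m0]
      proof eventually_elim
        case (elim k)
        show ?case unfolding prob_block[OF mpos(3) sets(3)] qm[symmetric] using GSk[OF elim] by (simp only: G_def)
      qed
    qed
  qed
  have "\<exists>\<^sub>F n in sequentially. f0 + c * rate n \<le> grenander (\<lambda>i. X i \<omega>) n t0"
    if 1: "eventually (\<lambda>k. block 0 (q * m k) \<omega> \<notin> A (m k)) sequentially"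
      and 2: "eventually (\<lambda>k. block 0 (m k) \<omega> \<notin> A' (m k)) sequentially"
      and 3: "\<exists>\<^sub>F k in sequentially. block (m k) (q * m k - m k) \<omega> \<in> B (m k)" for \<omega>
    unfolding frequently_sequentially
  proof
    fix n0
    have "eventually (\<lambda>k. block 0 (q * m k) \<omega> \<notin> A (m k) \<and> block 0 (m k) \<omega> \<notin> A' (m k) \<and> m0 \<le> k \<and> n0 \<le> k) sequentially"
      by (intro eventually_conj 1 2 eventually_ge_at_top)
    from frequently_eventually_frequently[OF 3 this]
    obtain k where k: "block (m k) (q * m k - m k) \<omega> \<in> B (m k)" "block 0 (q * m k) \<omega> \<notin> A (m k)"
      "block 0 (m k) \<omega> \<notin> A' (m k)" "m0 \<le> k" "n0 \<le> k"
      using frequently_ex by blast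
    have "f0 + c * rate (q * m k) \<le> grenander (\<lambda>i. X i \<omega>) (q * m k) t0"
      using GSk[OF k(4)] k(1-3) unfolding G_def block_def by simp
    moreover have "n0 \<le> q * m k" using k(5) mk[of k] q by (metis le_trans mult_le_mono1 mult_1 one_le_numeral)
    ultimately show "\<exists>n\<ge>n0. f0 + c * rate n \<le> grenander (\<lambda>i. X i \<omega>) n t0" by blast
  qed
  note main = this
  show ?thesis using AEA AEA' AEB by eventually_elim (rule main)
qed

text \<open>The two bounds hold almost surely for each fixed \<open>c\<close>; countably many values
  approaching \<open>b\<close> from either side pin down the limit superior.\<close>

lemma AE_limsup:
  "AE \<omega> in M. limsup (\<lambda>n. ereal (real n powr (1/3) * (grenander (\<lambda>i. X i \<omega>) n t0 - f0)
      / (2 * ln (ln (real n))) powr (1/3))) = ereal ((3 * f0 * D) powr (1/3))"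
proof -
  define b where "b = (3 * f0 * D) powr (1/3)"
  have fD: "0 < 3 * f0 * D" using f0(2) D by simp
  have b: "0 < b" using f0(2) D(1) by (simp add: b_def)
  have "b ^ 3 = b powr 3" using b by (simp add: powr_numeral)
  then have b3: "b ^ 3 = 3 * f0 * D" using f0(2) D(1) by (simp add: b_def powr_powr)
  have up: "AE \<omega> in M. \<forall>j::nat. eventually (\<lambda>n. grenander (\<lambda>i. X i \<omega>) n t0 \<le> f0 + b * (1 + 1 / real (Suc j)) * rate n) sequentially"
    unfolding AE_all_countable
  proof
    fix j :: nat
    have "1 < 1 + 1 / real (Suc j)" by simp
    then have "b * 1 < b * (1 + 1 / real (Suc j))" using b by (intro mult_strict_left_mono) auto
    then have "b ^ 3 < (b * (1 + 1 / real (Suc j))) ^ 3" using b by (intro power_strict_mono) auto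
    then show "AE \<omega> in M. eventually (\<lambda>n. grenander (\<lambda>i. X i \<omega>) n t0 \<le> f0 + b * (1 + 1 / real (Suc j)) * rate n) sequentially"
      using b unfolding b3 by (intro AE_eventually_le mult_pos_pos) (auto intro: add_pos_pos)
  qed
  \<comment> \<open>The denominator \<open>Suc (Suc j)\<close> keeps the factor at least 1/2, hence
    positive, also for \<open>j = 0\<close>.\<close>
  have lo: "AE \<omega> in M. \<forall>j::nat. \<exists>\<^sub>F n in sequentially. f0 + b * (1 - 1 / real (Suc (Suc j))) * rate n \<le> grenander (\<lambda>i. X i \<omega>) n t0"
    unfolding AE_all_countable
  proof
    fix j :: nat
    have j: "0 < 1 - 1 / real (Suc (Suc j))" "1 - 1 / real (Suc (Suc j)) < 1" by simp_all
    then have "b * (1 - 1 / real (Suc (Suc j))) < b * 1" using b by (intro mult_strict_left_mono) auto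
    moreover have p: "0 < b * (1 - 1 / real (Suc (Suc j)))" using b j by (intro mult_pos_pos) auto
    ultimately have "(b * (1 - 1 / real (Suc (Suc j)))) ^ 3 < b ^ 3" by (intro power_strict_mono) auto
    then show "AE \<omega> in M. \<exists>\<^sub>F n in sequentially. f0 + b * (1 - 1 / real (Suc (Suc j))) * rate n \<le> grenander (\<lambda>i. X i \<omega>) n t0"
      using p unfolding b3 by (intro AE_frequently_ge) auto
  qed
  have "limsup (\<lambda>n. ereal (real n powr (1/3) * (grenander (\<lambda>i. X i \<omega>) n t0 - f0)
      / (2 * ln (ln (real n))) powr (1/3))) = ereal b"
    if U: "\<forall>j::nat. eventually (\<lambda>n. grenander (\<lambda>i. X i \<omega>) n t0 \<le> f0 + b * (1 + 1 / real (Suc j)) * rate n) sequentially"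
      and Lo: "\<forall>j::nat. \<exists>\<^sub>F n in sequentially. f0 + b * (1 - 1 / real (Suc (Suc j))) * rate n \<le> grenander (\<lambda>i. X i \<omega>) n t0" for \<omega>
  proof -
    define Z where "Z n = real n powr (1/3) * (grenander (\<lambda>i. X i \<omega>) n t0 - f0) / (2 * ln (ln (real n))) powr (1/3)" for n
    have Z: "eventually (\<lambda>n. 0 < rate n \<and> Z n = (grenander (\<lambda>i. X i \<omega>) n t0 - f0) / rate n) sequentially"
      using eventually_lnln_ge[of 1] eventually_gt_at_top[of 0]
    proof eventually_elim
      case (elim n)
      then show ?case using rate_pos[of n] by (simp add: Z_def rate_def powr_divide)
    qed
    have "limsup (\<lambda>n. ereal (Z n)) \<le> ereal b"
    proof (rule ereal_le_epsilon2)
      fix e :: real assume "0 < e"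
      then obtain j where j: "inverse (real (Suc j)) < e / b" using reals_Archimedean[of "e / b"] b by auto
      then have be: "b * (1 + 1 / real (Suc j)) \<le> b + e" using b by (simp add: field_simps)
      have "eventually (\<lambda>n. ereal (Z n) \<le> ereal (b * (1 + 1 / real (Suc j)))) sequentially"
        using U[rule_format, of j] Z
        by eventually_elim (simp add: divide_le_eq algebra_simps)
      from Limsup_bounded[OF this] have L: "limsup (\<lambda>n. ereal (Z n)) \<le> ereal (b * (1 + 1 / real (Suc j)))" .
      show "limsup (\<lambda>n. ereal (Z n)) \<le> ereal b + ereal e"
        by (rule order_trans[OF L]) (use be in simp)
    qed
    moreover have "ereal b \<le> limsup (\<lambda>n. ereal (Z n))"
    proof (rule ereal_le_epsilon2)
      fix e :: real assume "0 < e"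
      then obtain j where j: "inverse (real (Suc j)) < e / b" using reals_Archimedean[of "e / b"] b by auto
      have "1 / real (Suc (Suc j)) \<le> inverse (real (Suc j))" by (simp add: field_simps)
      with j have "1 / real (Suc (Suc j)) \<le> e / b" by linarith
      then have "b * (1 / real (Suc (Suc j))) \<le> b * (e / b)" using b by (intro mult_left_mono) auto
      then have be: "b \<le> b * (1 - 1 / real (Suc (Suc j))) + e" using b by (simp add: right_diff_distrib)
      have "ereal (b * (1 - 1 / real (Suc (Suc j)))) \<le> limsup (\<lambda>n. ereal (Z n))"
      proof (rule ccontr)
        assume "\<not> ?thesis"
        then have "limsup (\<lambda>n. ereal (Z n)) < ereal (b * (1 - 1 / real (Suc (Suc j))))" by simp
        from Limsup_lessD[OF this] have "eventually (\<lambda>n. Z n < b * (1 - 1 / real (Suc (Suc j)))) sequentially" by simp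
        with Z have "eventually (\<lambda>n. \<not> f0 + b * (1 - 1 / real (Suc (Suc j))) * rate n \<le> grenander (\<lambda>i. X i \<omega>) n t0) sequentially"
          by eventually_elim (simp add: divide_less_eq)
        with Lo show False by (simp add: frequently_def)
      qed
      then have "ereal (b * (1 - 1 / real (Suc (Suc j)))) + ereal e \<le> limsup (\<lambda>n. ereal (Z n)) + ereal e"
        by (rule add_right_mono)
      with be show "ereal b \<le> limsup (\<lambda>n. ereal (Z n)) + ereal e"
        by (metis ereal_less_eq(3) order_trans plus_ereal.simps(1))
    qed
    ultimately have "limsup (\<lambda>n. ereal (Z n)) = ereal b" by (rule antisym)
    then show ?thesis by (simp only: Z_def)
  qed
  note main = this
  show ?thesis unfolding b_def[symmetric] using up lo by eventually_elim (rule main)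
qed

end

theorem theorem1:
  fixes M :: "'a measure" and X :: "nat \<Rightarrow> 'a \<Rightarrow> real" and f :: "real \<Rightarrow> real" and t0 :: real
  assumes "prob_space M"
    and "prob_space.indep_vars M (\<lambda>_. borel) X UNIV"
    and "\<And>i. distributed M lborel (X i) (\<lambda>x. ennreal (f x))"
    and "\<And>x. f x \<ge> 0"
    and "\<And>x. x < 0 \<Longrightarrow> f x = 0"
    and "antimono_on {0<..} f"
    and "t0 > 0"
    and "f t0 > 0"
    and "deriv f t0 < 0"
    and "\<exists>U. open U \<and> t0 \<in> U \<and> (\<forall>x\<in>U. f differentiable (at x)) \<and> continuous_on U (deriv f)"
  shows "(AE \<omega> in M.
      limsup (\<lambda>n. ereal (real n powr (1/3) * (grenander (\<lambda>i. X i \<omega>) n t0 - f t0)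
                          / (2 * ln (ln (real n))) powr (1/3)))
        = ereal (\<bar>1/2 * f t0 * deriv f t0\<bar> powr (1/3)) * (2 * sup_argmax))
    \<and> sup_argmax = ereal ((3/4) powr (1/3))"
proof (intro conjI)
  interpret P: prob_space M by (rule assms(1))
  have f: "f \<in> borel_measurable borel"
    using distributed_real_measurable[OF assms(4) assms(3)] by simp
  have Xm: "X i \<in> borel_measurable M" for i
    using distributed_measurable[OF assms(3), of i] by simp
  have law: "distr M borel (X i) = density lborel (\<lambda>x. ennreal (f x))" for i
  proof -
    have "distr M borel (X i) = distr M lborel (X i)" by (rule distr_cong) simp_all
    then show ?thesis using distributed_distr_eq_density[OF assms(3), of i] by simp
  qed
  \<comment> \<open>The total mass of \<open>f\<close> is recovered from the law of
    \<open>X 0\<close>.\<close>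
  have total: "(\<integral>\<^sup>+x. ennreal (f x) \<partial>lborel) = 1"
  proof -
    have "prob_space (distr M borel (X 0))" by (rule P.prob_space_distr[OF Xm])
    then have "emeasure (density lborel (\<lambda>x. ennreal (f x))) (space lborel) = 1"
      using prob_space.emeasure_space_1 by (fastforce simp: law)
    then show ?thesis using f by (subst (asm) emeasure_density) (auto cong: nn_integral_cong)
  qed
  have diff: "(f has_real_derivative - (- deriv f t0)) (at t0)"
    using assms(10) by (auto simp: DERIV_deriv_iff_real_differentiable)
  interpret decreasing_sample f t0 "f t0" "- deriv f t0" M X
    using assms(2,4,6-9) f total diff law by unfold_locales auto
  show sup: "sup_argmax = ereal ((3/4) powr (1/3))" by (rule sup_argmax_eq)
  define b where "b = - (f t0 * deriv f t0)"
  have b: "0 < b" using assms(8,9) by (simp add: b_def mult_pos_neg)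
  have "\<bar>1/2 * f t0 * deriv f t0\<bar> = b / 2" using b by (simp add: b_def)
  \<comment> \<open>Since \<open>8 * (3/4) * (1/2) = 3\<close>, twice the constant of the Strassen
    ball gives exactly the factor found by the two probability bounds.\<close>
  moreover have "(b / 2) powr (1/3) * (2 * (3/4) powr (1/3)) = (3 * b) powr (1/3)"
  proof -
    have "(8::real) powr (1/3) = (2 powr 3) powr (1/3)" by simp
    also have "\<dots> = 2" by (simp only: powr_powr) simp
    finally have "(8::real) powr (1/3) = 2" .
    then have "(b / 2) powr (1/3) * (2 * (3/4) powr (1/3)) = (b / 2) powr (1/3) * (8 powr (1/3) * (3/4) powr (1/3))" by simp
    also have "\<dots> = (b / 2 * (8 * (3/4))) powr (1/3)" by (simp only: powr_mult)
    finally show ?thesis by (simp add: mult.commute)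
  qed
  ultimately have "ereal (\<bar>1/2 * f t0 * deriv f t0\<bar> powr (1/3)) * (2 * sup_argmax)
      = ereal ((3 * f t0 * - deriv f t0) powr (1/3))"
    unfolding sup by (simp add: b_def mult.assoc)
  then show "AE \<omega> in M.
      limsup (\<lambda>n. ereal (real n powr (1/3) * (grenander (\<lambda>i. X i \<omega>) n t0 - f t0)
                          / (2 * ln (ln (real n))) powr (1/3)))
        = ereal (\<bar>1/2 * f t0 * deriv f t0\<bar> powr (1/3)) * (2 * sup_argmax)"
    using AE_limsup by simp
qed

end
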